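(* For any regular multiplier bimonoid $(t_1,t_2,t_3,t_4:A\otimes A\to A\otimes A,\ e:A\to I)$ in a braided monoidal category $\mathcal C$, the monoidal structure of $\mathcal C$ lifts to the category of comodules over it; that is, the category of comodules is monoidal in such a way that the forgetful functor to $\mathcal C$, $(V,v_1,v_3)\mapsto V$, is strict monoidal.
   Context: Conventions: $\otimes$ is the monoidal product, $I$ the unit, $b_{X,Y}:X\otimes Y\to Y\otimes X$ the braiding ($b=b_{A,A}$ where no subscript is given); composition is juxtaposition, $1$ denotes identities, associativity and unit isomorphisms are suppressed. $\overline{\mathcal C}$ is the same monoidal category with the inverse braiding $(b_{Y,X})^{-1}:X\otimes Y\to Y\otimes X$. $\mathcal C^{\mathsf{rev}}$ is the same category with the opposite monoidal product $(X,Y)\mapsto Y\otimes X$, the same unit, and the braiding $b_{Y,X}:Y\otimes X\to X\otimes Y$. In any braided monoidal category: a *fusion morphism* is a morphism $t:A\otimes A\to A\otimes A$ with $(t\otimes 1)(b^{-1}\otimes 1)(1\otimes t)(b\otimes 1)(1\otimes t)=(1\otimes t)(t\otimes 1)$; a *counit* for it is a morphism $e:A\to I$ with $(1\otimes e)t=1\otimes e$. A *multiplier bimonoid* $(t_1,t_2,e)$ in $\mathcal C$ consists of a fusion morphism $t_1:A\otimes A\to A\otimes A$ in $\mathcal C$ and a fusion morphism $t_2:A\otimes A\to A\otimes A$ in $\mathcal C^{\mathsf{rev}}$ (i.e. $(1\otimes t_2)(1\otimes b^{-1})(t_2\otimes 1)(1\otimes b)(t_2\otimes 1)=(t_2\otimes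 1)(1\otimes t_2)$) with a common counit $e:A\to I$ (i.e. $(1\otimes e)t_1=1\otimes e$ and $(e\otimes 1)t_2=e\otimes 1$), such that $(1\otimes t_1)(t_2\otimes 1)=(t_2\otimes 1)(1\otimes t_1)$ and $(e\otimes 1)t_1=(1\otimes e)t_2$. A *regular multiplier bimonoid* $(t_1,t_2,t_3,t_4,e)$ in $\mathcal C$ consists of a multiplier bimonoid $(t_1,t_2,e)$ in $\mathcal C$, with multiplication $m:=(e\otimes 1)t_1=(1\otimes e)t_2$, and a multiplier bimonoid $(t_3,t_4,e)$ in $\overline{\mathcal C}$ with a common counit $e:A\to I$, such that - (A) $(1\otimes m)(t_3\otimes 1)(b\otimes 1)=(1\otimes m)(b\otimes 1)(1\otimes t_1)$; - (B) $(t_4\otimes 1)(1\otimes t_1)=(1\otimes t_1)(t_4\otimes 1)$; - (A$^{\mathsf{rev}}$) $(m\otimes 1)(1\otimes t_4)(1\otimes b)=(m\otimes 1)(1\otimes b)(t_2\otimes 1)$; - (B$^{\mathsf{rev}}$) $(1\otimes t_3)(t_2\otimes 1)=(t_2\otimes 1)(1\otimes t_3)$; - (C) $(e\otimes 1)t_3=(e\otimes 1)t_1b^{-1}$. A *comodule* over this regular multiplier bimonoid is an object $V$ with morphisms $v_1,v_3:V\otimes A\to V\otimes A$ such that - $v_1$ is a comodule over the counital fusion morphism $(t_1,e)$ in $\mathcal C$: $(v_1\otimes 1)(b_{V,A}^{-1}\otimes 1)(1\otimes v_1)(b_{V,A}\otimes 1)(1\otimes t_1)=(1\otimes t_1)(v_1\otimes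 1)$ on $V\otimes A\otimes A$, and $(1\otimes e)v_1=1\otimes e$; - $v_3$ is a comodule over the counital fusion morphism $(t_3,e)$ in $\overline{\mathcal C}$: $(v_3\otimes 1)(b_{A,V}\otimes 1)(1\otimes v_3)(b_{A,V}^{-1}\otimes 1)(1\otimes t_3)=(1\otimes t_3)(v_3\otimes 1)$ on $V\otimes A\otimes A$, and $(1\otimes e)v_3=1\otimes e$; - $(1\otimes m)(b_{A,V}\otimes 1)(1\otimes v_1)=(1\otimes m)(v_3\otimes 1)(b_{A,V}\otimes 1):A\otimes V\otimes A\to V\otimes A$. A *morphism* of comodules $(V,v_1,v_3)\to(W,w_1,w_3)$ is a morphism $f:V\to W$ in $\mathcal C$ such that $(f\otimes 1)v_1=w_1(f\otimes 1)$ and $(f\otimes 1)v_3=w_3(f\otimes 1)$. *)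

theory Defs
  imports Main
begin

section \<open>Categories and functors\<close>

record ('o, 'a) category =
  obj :: "'o set"
  arr :: "'a set"
  src :: "'a \<Rightarrow> 'o"
  tgt :: "'a \<Rightarrow> 'o"
  ident :: "'o \<Rightarrow> 'a"
  cmp :: "'a \<Rightarrow> 'a \<Rightarrow> 'a"  (infixr "\<cdot>\<index>" 55)

definition hom :: "('o, 'a, 'z) category_scheme \<Rightarrow> 'o \<Rightarrow> 'o \<Rightarrow> 'a set"
  where "hom C X Y = {f \<in> arr C. src C f = X \<and> tgt C f = Y}"

locale category =
  fixes C :: "('o, 'a, 'z) category_scheme" (structure)
  assumes src_obj: "f \<in> arr C \<Longrightarrow> src C f \<in> obj C"
    and tgt_obj: "f \<in> arr C \<Longrightarrow> tgt C f \<in> obj C"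
    and ident_hom: "X \<in> obj C \<Longrightarrow> ident C X \<in> hom C X X"
    and cmp_hom: "\<lbrakk>f \<in> hom C X Y; g \<in> hom C Y Z\<rbrakk> \<Longrightarrow> g \<cdot> f \<in> hom C X Z"
    and cmp_ident: "f \<in> hom C X Y \<Longrightarrow> f \<cdot> ident C X = f"
    and ident_cmp: "f \<in> hom C X Y \<Longrightarrow> ident C Y \<cdot> f = f"
    and cmp_assoc: "\<lbrakk>f \<in> hom C W X; g \<in> hom C X Y; h \<in> hom C Y Z\<rbrakk>
      \<Longrightarrow> (h \<cdot> g) \<cdot> f = h \<cdot> (g \<cdot> f)"

definition inverse_arrs :: "('o, 'a, 'z) category_scheme \<Rightarrow> 'a \<Rightarrow> 'a \<Rightarrow> bool"
  where "inverse_arrs C f g \<longleftrightarrow>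
    f \<in> hom C (src C f) (tgt C f) \<and> g \<in> hom C (tgt C f) (src C f) \<and>
    cmp C g f = ident C (src C f) \<and> cmp C f g = ident C (tgt C f)"

definition iso_arr :: "('o, 'a, 'z) category_scheme \<Rightarrow> 'a \<Rightarrow> bool"
  where "iso_arr C f \<longleftrightarrow> (\<exists>g. inverse_arrs C f g)"

definition arr_inv :: "('o, 'a, 'z) category_scheme \<Rightarrow> 'a \<Rightarrow> 'a"  ("Inv\<index>[_]")
  where "arr_inv C f = (THE g. inverse_arrs C f g)"

locale category_functor = C: category C + D: category D
  for C :: "('o, 'a, 'z) category_scheme"
    and D :: "('p, 'b, 'y) category_scheme" +
  fixes Fo :: "'o \<Rightarrow> 'p" and Fa :: "'a \<Rightarrow> 'b"
  assumes Fo_obj: "X \<in> obj C \<Longrightarrow> Fo X \<in> obj D"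
    and Fa_hom: "f \<in> hom C X Y \<Longrightarrow> Fa f \<in> hom D (Fo X) (Fo Y)"
    and Fa_ident: "X \<in> obj C \<Longrightarrow> Fa (ident C X) = ident D (Fo X)"
    and Fa_cmp: "\<lbrakk>f \<in> hom C X Y; g \<in> hom C Y Z\<rbrakk> \<Longrightarrow> Fa (cmp C g f) = cmp D (Fa g) (Fa f)"

section \<open>Monoidal and braided monoidal categories\<close>

text \<open>The product of objects is written \<open>\<odot>\<close>, that of arrows \<open>\<otimes>\<close>.  The associator goes
  from \<open>(X \<odot> Y) \<odot> Z\<close> to \<open>X \<odot> (Y \<odot> Z)\<close>.\<close>

record ('o, 'a) monoidal_category = "('o, 'a) category" +
  tens_obj :: "'o \<Rightarrow> 'o \<Rightarrow> 'o"  (infixr "\<odot>\<index>" 70)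
  tens_arr :: "'a \<Rightarrow> 'a \<Rightarrow> 'a"  (infixr "\<otimes>\<index>" 70)
  unit_obj :: 'o  ("\<I>\<index>")
  associator :: "'o \<Rightarrow> 'o \<Rightarrow> 'o \<Rightarrow> 'a"  ("\<a>\<index>[_, _, _]")
  left_unitor :: "'o \<Rightarrow> 'a"  ("\<l>\<index>[_]")
  right_unitor :: "'o \<Rightarrow> 'a"  ("\<r>\<index>[_]")

locale monoidal_category = category C
  for C :: "('o, 'a, 'z) monoidal_category_scheme" (structure) +
  assumes tens_obj_closed: "\<lbrakk>X \<in> obj C; Y \<in> obj C\<rbrakk> \<Longrightarrow> X \<odot> Y \<in> obj C"
    and unit_obj_closed: "\<I> \<in> obj C"
    and tens_hom: "\<lbrakk>f \<in> hom C X X'; g \<in> hom C Y Y'\<rbrakk> \<Longrightarrow> f \<otimes> g \<in> hom C (X \<odot> Y) (X' \<odot> Y')"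
    and tens_ident: "\<lbrakk>X \<in> obj C; Y \<in> obj C\<rbrakk>
      \<Longrightarrow> ident C X \<otimes> ident C Y = ident C (X \<odot> Y)"
    and tens_cmp: "\<lbrakk>f \<in> hom C X X'; f' \<in> hom C X' X''; g \<in> hom C Y Y'; g' \<in> hom C Y' Y''\<rbrakk>
      \<Longrightarrow> (f' \<cdot> f) \<otimes> (g' \<cdot> g) = (f' \<otimes> g') \<cdot> (f \<otimes> g)"
    and assoc_hom: "\<lbrakk>X \<in> obj C; Y \<in> obj C; Z \<in> obj C\<rbrakk>
      \<Longrightarrow> \<a>[X, Y, Z] \<in> hom C ((X \<odot> Y) \<odot> Z) (X \<odot> (Y \<odot> Z))"
    and assoc_iso: "\<lbrakk>X \<in> obj C; Y \<in> obj C; Z \<in> obj C\<rbrakk> \<Longrightarrow> iso_arr C \<a>[X, Y, Z]"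
    and assoc_natural: "\<lbrakk>f \<in> hom C X X'; g \<in> hom C Y Y'; h \<in> hom C Z Z'\<rbrakk>
      \<Longrightarrow> \<a>[X', Y', Z'] \<cdot> ((f \<otimes> g) \<otimes> h) = (f \<otimes> (g \<otimes> h)) \<cdot> \<a>[X, Y, Z]"
    and left_unitor_hom: "X \<in> obj C \<Longrightarrow> \<l>[X] \<in> hom C (\<I> \<odot> X) X"
    and left_unitor_iso: "X \<in> obj C \<Longrightarrow> iso_arr C \<l>[X]"
    and left_unitor_natural: "f \<in> hom C X Y \<Longrightarrow> \<l>[Y] \<cdot> (ident C \<I> \<otimes> f) = f \<cdot> \<l>[X]"
    and right_unitor_hom: "X \<in> obj C \<Longrightarrow> \<r>[X] \<in> hom C (X \<odot> \<I>) X"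
    and right_unitor_iso: "X \<in> obj C \<Longrightarrow> iso_arr C \<r>[X]"
    and right_unitor_natural: "f \<in> hom C X Y \<Longrightarrow> \<r>[Y] \<cdot> (f \<otimes> ident C \<I>) = f \<cdot> \<r>[X]"
    and pentagon: "\<lbrakk>W \<in> obj C; X \<in> obj C; Y \<in> obj C; Z \<in> obj C\<rbrakk>
      \<Longrightarrow> (ident C W \<otimes> \<a>[X, Y, Z]) \<cdot> \<a>[W, X \<odot> Y, Z] \<cdot> (\<a>[W, X, Y] \<otimes> ident C Z)
        = \<a>[W, X, Y \<odot> Z] \<cdot> \<a>[W \<odot> X, Y, Z]"
    and triangle: "\<lbrakk>X \<in> obj C; Y \<in> obj C\<rbrakk>
      \<Longrightarrow> (ident C X \<otimes> \<l>[Y]) \<cdot> \<a>[X, \<I>, Y] = \<r>[X] \<otimes> ident C Y"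

locale strict_monoidal_functor =
  C: monoidal_category C + D: monoidal_category D + category_functor C D Fo Fa
  for C :: "('o, 'a, 'z) monoidal_category_scheme"
    and D :: "('p, 'b, 'y) monoidal_category_scheme"
    and Fo :: "'o \<Rightarrow> 'p" and Fa :: "'a \<Rightarrow> 'b" +
  assumes Fo_tens: "\<lbrakk>X \<in> obj C; Y \<in> obj C\<rbrakk> \<Longrightarrow> Fo (tens_obj C X Y) = tens_obj D (Fo X) (Fo Y)"
    and Fa_tens: "\<lbrakk>f \<in> arr C; g \<in> arr C\<rbrakk> \<Longrightarrow> Fa (tens_arr C f g) = tens_arr D (Fa f) (Fa g)"
    and Fo_unit: "Fo (unit_obj C) = unit_obj D"
    and Fa_associator: "\<lbrakk>X \<in> obj C; Y \<in> obj C; Z \<in> obj C\<rbrakk>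
      \<Longrightarrow> Fa (associator C X Y Z) = associator D (Fo X) (Fo Y) (Fo Z)"
    and Fa_left_unitor: "X \<in> obj C \<Longrightarrow> Fa (left_unitor C X) = left_unitor D (Fo X)"
    and Fa_right_unitor: "X \<in> obj C \<Longrightarrow> Fa (right_unitor C X) = right_unitor D (Fo X)"

record ('o, 'a) braided_monoidal_category = "('o, 'a) monoidal_category" +
  braiding :: "'o \<Rightarrow> 'o \<Rightarrow> 'a"  ("\<b>\<index>[_, _]")

locale braided_monoidal_category = monoidal_category C
  for C :: "('o, 'a, 'z) braided_monoidal_category_scheme" (structure) +
  assumes braiding_hom: "\<lbrakk>X \<in> obj C; Y \<in> obj C\<rbrakk> \<Longrightarrow> \<b>[X, Y] \<in> hom C (X \<odot> Y) (Y \<odot> X)"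
    and braiding_iso: "\<lbrakk>X \<in> obj C; Y \<in> obj C\<rbrakk> \<Longrightarrow> iso_arr C \<b>[X, Y]"
    and braiding_natural: "\<lbrakk>f \<in> hom C X X'; g \<in> hom C Y Y'\<rbrakk>
      \<Longrightarrow> \<b>[X', Y'] \<cdot> (f \<otimes> g) = (g \<otimes> f) \<cdot> \<b>[X, Y]"
    and hexagon1: "\<lbrakk>X \<in> obj C; Y \<in> obj C; Z \<in> obj C\<rbrakk>
      \<Longrightarrow> \<a>[Y, Z, X] \<cdot> \<b>[X, Y \<odot> Z] \<cdot> \<a>[X, Y, Z]
        = (ident C Y \<otimes> \<b>[X, Z]) \<cdot> \<a>[Y, X, Z] \<cdot> (\<b>[X, Y] \<otimes> ident C Z)"
    and hexagon2: "\<lbrakk>X \<in> obj C; Y \<in> obj C; Z \<in> obj C\<rbrakk>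
      \<Longrightarrow> Inv[\<a>[Z, X, Y]] \<cdot> \<b>[X \<odot> Y, Z] \<cdot> Inv[\<a>[X, Y, Z]]
        = (\<b>[X, Z] \<otimes> ident C Y) \<cdot> Inv[\<a>[X, Z, Y]] \<cdot> (ident C X \<otimes> \<b>[Y, Z])"

definition bar :: "('o, 'a) braided_monoidal_category \<Rightarrow> ('o, 'a) braided_monoidal_category"
  where "bar C = C\<lparr>braiding := \<lambda>X Y. arr_inv C (braiding C Y X)\<rparr>"

definition reversed :: "('o, 'a) braided_monoidal_category \<Rightarrow> ('o, 'a) braided_monoidal_category"
  where "reversed C = C\<lparr>
    tens_obj := \<lambda>X Y. tens_obj C Y X,
    tens_arr := \<lambda>f g. tens_arr C g f,
    associator := \<lambda>X Y Z. arr_inv C (associator C Z Y X),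
    left_unitor := right_unitor C,
    right_unitor := left_unitor C,
    braiding := \<lambda>X Y. braiding C Y X\<rparr>"

section \<open>Regular multiplier bimonoids\<close>

text \<open>Triple products are bracketed to the left, so that \<open>f \<otimes> 1\<close> is a plain product of arrows,
  whereas \<open>1 \<otimes> f\<close>, for an endomorphism \<open>f\<close> of \<open>Y \<odot> Z\<close>, has to be conjugated by the associator to
  become an endomorphism of \<open>(X \<odot> Y) \<odot> Z\<close>.\<close>

definition on_right ::
    "('o, 'a, 'z) monoidal_category_scheme \<Rightarrow> 'o \<Rightarrow> 'o \<Rightarrow> 'o \<Rightarrow> 'a \<Rightarrow> 'a"
  where "on_right C X Y Z f =
    cmp C (arr_inv C (associator C X Y Z))
      (cmp C (tens_arr C (ident C X) f) (associator C X Y Z))"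

locale fusion_morphism =
  fixes C :: "('o, 'a) braided_monoidal_category" (structure) and A :: 'o and t :: 'a
  assumes A_obj: "A \<in> obj C"
    and t_hom: "t \<in> hom C (A \<odot> A) (A \<odot> A)"
    and fusion: "(t \<otimes> ident C A) \<cdot> (Inv[\<b>[A, A]] \<otimes> ident C A) \<cdot> on_right C A A A t
        \<cdot> (\<b>[A, A] \<otimes> ident C A) \<cdot> on_right C A A A t
      = on_right C A A A t \<cdot> (t \<otimes> ident C A)"

locale counital_fusion_morphism = fusion_morphism +
  fixes e :: 'a
  assumes e_hom: "e \<in> hom C A \<I>"
    and counit: "(ident C A \<otimes> e) \<cdot> t = ident C A \<otimes> e"

locale multiplier_bimonoid =
  fixes C :: "('o, 'a) braided_monoidal_category" (structure)
    and A :: 'o and t1 t2 e :: 'a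
  assumes t1_fusion: "counital_fusion_morphism C A t1 e"
    and t2_fusion: "counital_fusion_morphism (reversed C) A t2 e"
    and t1_t2: "on_right C A A A t1 \<cdot> (t2 \<otimes> ident C A) = (t2 \<otimes> ident C A) \<cdot> on_right C A A A t1"
    and e_t1_t2: "\<l>[A] \<cdot> (e \<otimes> ident C A) \<cdot> t1 = \<r>[A] \<cdot> (ident C A \<otimes> e) \<cdot> t2"

definition mult :: "('o, 'a, 'z) monoidal_category_scheme \<Rightarrow> 'o \<Rightarrow> 'a \<Rightarrow> 'a \<Rightarrow> 'a"
  where "mult C A t1 e = cmp C (left_unitor C A) (cmp C (tens_arr C e (ident C A)) t1)"

locale regular_multiplier_bimonoid =
  fixes C :: "('o, 'a) braided_monoidal_category" (structure)
    and A :: 'o and t1 t2 t3 t4 e :: 'a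
  assumes t1_t2_bimonoid: "multiplier_bimonoid C A t1 t2 e"
    and t3_t4_bimonoid: "multiplier_bimonoid (bar C) A t3 t4 e"
    and axiom_A: "(ident C A \<otimes> mult C A t1 e) \<cdot> \<a>[A, A, A]
        \<cdot> (t3 \<otimes> ident C A) \<cdot> (\<b>[A, A] \<otimes> ident C A)
      = (ident C A \<otimes> mult C A t1 e) \<cdot> \<a>[A, A, A]
        \<cdot> (\<b>[A, A] \<otimes> ident C A) \<cdot> on_right C A A A t1"
    and axiom_B: "(t4 \<otimes> ident C A) \<cdot> on_right C A A A t1
      = on_right C A A A t1 \<cdot> (t4 \<otimes> ident C A)"
    and axiom_A_rev: "(mult C A t1 e \<otimes> ident C A)
        \<cdot> on_right C A A A t4 \<cdot> on_right C A A A \<b>[A, A]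
      = (mult C A t1 e \<otimes> ident C A)
        \<cdot> on_right C A A A \<b>[A, A] \<cdot> (t2 \<otimes> ident C A)"
    and axiom_B_rev: "on_right C A A A t3 \<cdot> (t2 \<otimes> ident C A)
      = (t2 \<otimes> ident C A) \<cdot> on_right C A A A t3"
    and axiom_C: "(e \<otimes> ident C A) \<cdot> t3 = (e \<otimes> ident C A) \<cdot> t1 \<cdot> Inv[\<b>[A, A]]"

section \<open>The category of comodules\<close>

text \<open>A comodule over the counital fusion morphism \<open>(t, e)\<close>.\<close>

locale fusion_comodule =
  fixes C :: "('o, 'a) braided_monoidal_category" (structure)
    and A :: 'o and t e :: 'a and V :: 'o and v :: 'a
  assumes V_obj: "V \<in> obj C"
    and v_hom: "v \<in> hom C (V \<odot> A) (V \<odot> A)"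
    and fusion_coaction: "(v \<otimes> ident C A) \<cdot> (Inv[\<b>[V, A]] \<otimes> ident C A) \<cdot> on_right C A V A v
        \<cdot> (\<b>[V, A] \<otimes> ident C A) \<cdot> on_right C V A A t
      = on_right C V A A t \<cdot> (v \<otimes> ident C A)"
    and counit_coaction: "(ident C V \<otimes> e) \<cdot> v = ident C V \<otimes> e"

text \<open>Comodules over a regular multiplier bimonoid \<open>(t1, t2, t3, t4, e)\<close> do not involve \<open>t2\<close> and
  \<open>t4\<close>.\<close>

locale comodule =
  fixes C :: "('o, 'a) braided_monoidal_category" (structure)
    and A :: 'o and t1 t3 e :: 'a and V :: 'o and v1 v3 :: 'a
  assumes v1_comodule: "fusion_comodule C A t1 e V v1"
    and v3_comodule: "fusion_comodule (bar C) A t3 e V v3"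
    and v1_v3: "(ident C V \<otimes> mult C A t1 e) \<cdot> \<a>[V, A, A]
        \<cdot> (\<b>[A, V] \<otimes> ident C A) \<cdot> on_right C A V A v1
      = (ident C V \<otimes> mult C A t1 e) \<cdot> \<a>[V, A, A]
        \<cdot> (v3 \<otimes> ident C A) \<cdot> (\<b>[A, V] \<otimes> ident C A)"

definition comodule_morphism ::
    "('o, 'a) braided_monoidal_category \<Rightarrow> 'o \<Rightarrow> 'o \<times> 'a \<times> 'a \<Rightarrow> 'o \<times> 'a \<times> 'a \<Rightarrow> 'a \<Rightarrow> bool"
  where "comodule_morphism C A = (\<lambda>(V, v1, v3) (W, w1, w3) f.
    f \<in> hom C V W \<and>
    cmp C (tens_arr C f (ident C A)) v1 = cmp C w1 (tens_arr C f (ident C A)) \<and>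
    cmp C (tens_arr C f (ident C A)) v3 = cmp C w3 (tens_arr C f (ident C A)))"

text \<open>An arrow of the category of comodules is a morphism of the base category together with its
  source and target comodules.\<close>

definition comodule_category ::
    "('o, 'a) braided_monoidal_category \<Rightarrow> 'o \<Rightarrow> 'a \<Rightarrow> 'a \<Rightarrow> 'a \<Rightarrow>
      ('o \<times> 'a \<times> 'a, ('o \<times> 'a \<times> 'a) \<times> 'a \<times> ('o \<times> 'a \<times> 'a)) category"
  where "comodule_category C A t1 t3 e =
    (let Comod = {(V, v1, v3). comodule C A t1 t3 e V v1 v3} in
    \<lparr>obj = Comod,
     arr = {(P, f, Q). P \<in> Comod \<and> Q \<in> Comod \<and> comodule_morphism C A P Q f},
     src = (\<lambda>(P, f, Q). P),
     tgt = (\<lambda>(P, f, Q). Q),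
     ident = (\<lambda>(V, v1, v3). ((V, v1, v3), ident C V, (V, v1, v3))),
     cmp = (\<lambda>(Q', g, R) (P, f, Q). (P, cmp C g f, R))\<rparr>)"

definition forget_obj :: "'o \<times> 'a \<times> 'a \<Rightarrow> 'o"
  where "forget_obj = (\<lambda>(V, v1, v3). V)"

definition forget_arr :: "('o \<times> 'a \<times> 'a) \<times> 'a \<times> ('o \<times> 'a \<times> 'a) \<Rightarrow> 'a"
  where "forget_arr = (\<lambda>(P, f, Q). f)"

end

theory Submission
  imports Defs
begin

text \<open>
  In Sweedler notation, the structure maps of a comodule \<open>V\<close> are \<open>v\<^sub>1 : x \<otimes> a \<mapsto> x\<^sub>0 \<otimes> x\<^sub>1 a\<close> and
  \<open>v\<^sub>3 : x \<otimes> a \<mapsto> x\<^sub>0 \<otimes> a x\<^sub>1\<close>, and the compatibility condition says \<open>(a x\<^sub>1) b = a (x\<^sub>1 b)\<close>. The tensor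
  product of \<open>V\<close> and \<open>W\<close> has to be \<open>x \<otimes> y \<mapsto> x\<^sub>0 \<otimes> y\<^sub>0 \<otimes> x\<^sub>1 y\<^sub>1\<close>. So on \<open>V \<otimes> W \<otimes> A\<close> the first structure
  map applies \<open>w\<^sub>1\<close> and then \<open>v\<^sub>1\<close>, the second one \<open>v\<^sub>3\<close> and then \<open>w\<^sub>3\<close>, where in both cases \<open>V\<close> reaches
  \<open>A\<close> and returns by the braiding of \<open>C\<close> with \<open>W\<close> and its inverse. The unit object carries identities.

  The fusion equation of such a product follows from those of the factors as soon as a
  structure map of one factor, acting on one copy of \<open>A\<close>, commutes with a structure map of the other
  factor, acting on the other copy. For \<open>v\<^sub>1\<close> and \<open>w\<^sub>1\<close> this holds because the strand of \<open>V\<close> passes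
  everything between on the same side (\<open>legs_commute_over\<close>). For \<open>v\<^sub>3\<close> and \<open>w\<^sub>3\<close>, the fusion equation is
  formed with the inverse braiding, but \<open>V\<close> still passes \<open>W\<close> by the braiding of \<open>C\<close>; then \<open>W\<close> lies
  on one side of both \<open>V\<close> and \<open>A\<close> and can be moved away (\<open>legs_commute_under\<close>). The resulting
  lemmas are \<open>coaction_tens1\<close> and \<open>coaction_tens3\<close>. Since both structure maps use the same crossing,
  the compatibility conditions of the factors can be applied one after the other
  (\<open>compatible_tens\<close>). Tensor products of morphisms and the coherence isomorphisms of \<open>C\<close> respect
  these structure maps by naturality of the braiding and the hexagons, and the axioms of a monoidal
  category are then inherited from \<open>C\<close>, as the forgetful functor is faithful.

  These arguments are string diagrams, whereas \<open>C\<close> need not be strict. The associators are eliminated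
  as follows. An arrow \<open>f : X \<odot> Y \<rightarrow> X' \<odot> Y'\<close> is represented by the natural family of arrows
  \<open>X \<odot> (Y \<odot> Z) \<rightarrow> X' \<odot> (Y' \<odot> Z)\<close> for all \<open>Z\<close>. Tensoring \<open>f\<close> with an object on the right then becomes a
  substitution for \<open>Z\<close>, by naturality of the associator, and tensoring with an object on the left
  becomes tensoring the family, by the pentagon. The hexagons and the naturality of the
  braiding turn into the statement that a strand may slide past an arrow (\<open>slide_left\<close>,
  \<open>slide_right\<close>). The representation is faithful, since \<open>Z\<close> may be the unit.
\<close>

section \<open>Arrows, inverses and whiskering\<close>

context category
begin

lemma in_hom: "f \<in> hom C X Y \<longleftrightarrow> f \<in> arr C \<and> src C f = X \<and> tgt C f = Y"
  by (simp add: hom_def)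

lemma src_in_obj [simp]: "f \<in> arr C \<Longrightarrow> src C f \<in> obj C"
  and tgt_in_obj [simp]: "f \<in> arr C \<Longrightarrow> tgt C f \<in> obj C"
  by (rule src_obj tgt_obj, assumption)+

lemma ident_arr [simp]:
  assumes "X \<in> obj C"
  shows "ident C X \<in> arr C" "src C (ident C X) = X" "tgt C (ident C X) = X"
  using ident_hom[OF assms] by (simp_all add: in_hom)

lemma cmp_arr [simp]:
  assumes "f \<in> arr C" "g \<in> arr C" "src C g = tgt C f"
  shows "g \<cdot> f \<in> arr C" "src C (g \<cdot> f) = src C f" "tgt C (g \<cdot> f) = tgt C g"
  using cmp_hom[of f _ _ g] assms by (simp_all add: in_hom)

lemma cmp_ident_arr [simp]: "f \<in> arr C \<Longrightarrow> src C f = X \<Longrightarrow> f \<cdot> ident C X = f"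
  and ident_cmp_arr [simp]: "f \<in> arr C \<Longrightarrow> tgt C f = X \<Longrightarrow> ident C X \<cdot> f = f"
  by (simp_all add: cmp_ident[of f X "tgt C f"] ident_cmp[of f "src C f" X] in_hom)

lemma cmp_assoc_arr:
  assumes "f \<in> arr C" "g \<in> arr C" "h \<in> arr C" "src C g = tgt C f" "src C h = tgt C g"
  shows "(h \<cdot> g) \<cdot> f = h \<cdot> g \<cdot> f"
  using assms by (intro cmp_assoc) (auto simp: in_hom)

lemma inverse_arrs_unique:
  assumes "inverse_arrs C f g" "inverse_arrs C f h"
  shows "g = h"
proof -
  have "g = (h \<cdot> f) \<cdot> g"
    using assms by (auto simp: inverse_arrs_def in_hom)
  also have "\<dots> = h \<cdot> f \<cdot> g"
    using assms by (intro cmp_assoc_arr) (auto simp: inverse_arrs_def in_hom)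
  also have "\<dots> = h"
    using assms by (auto simp: inverse_arrs_def in_hom)
  finally show ?thesis .
qed

lemma Inv_eqI: "inverse_arrs C f g \<Longrightarrow> Inv[f] = g"
  unfolding arr_inv_def by (rule the_equality, assumption, rule inverse_arrs_unique)

lemma inverse_arrs_Inv: "iso_arr C f \<Longrightarrow> inverse_arrs C f Inv[f]"
  unfolding iso_arr_def by (auto simp: Inv_eqI)

lemma iso_in_arr: "iso_arr C f \<Longrightarrow> f \<in> arr C"
  by (auto simp: iso_arr_def inverse_arrs_def in_hom)

lemma Inv_arr [simp]:
  assumes "iso_arr C f"
  shows "Inv[f] \<in> arr C" "src C Inv[f] = tgt C f" "tgt C Inv[f] = src C f"
    "Inv[f] \<cdot> f = ident C (src C f)" "f \<cdot> Inv[f] = ident C (tgt C f)"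
  using inverse_arrs_Inv[OF assms] by (simp_all add: inverse_arrs_def in_hom)

lemma inverse_arrs_sym: "inverse_arrs C f g \<Longrightarrow> inverse_arrs C g f"
  by (auto simp: inverse_arrs_def in_hom)

lemma iso_Inv [simp]: "iso_arr C f \<Longrightarrow> iso_arr C Inv[f]"
  unfolding iso_arr_def[of C "Inv[f]"] by (rule exI, rule inverse_arrs_sym, rule inverse_arrs_Inv)

lemma Inv_Inv [simp]: "iso_arr C f \<Longrightarrow> Inv[Inv[f]] = f"
  by (rule Inv_eqI, rule inverse_arrs_sym, rule inverse_arrs_Inv)

lemma Inv_cmp_cmp [simp]:
  assumes "iso_arr C f" "g \<in> arr C"
  shows "src C f = tgt C g \<Longrightarrow> Inv[f] \<cdot> f \<cdot> g = g"
    and "tgt C f = tgt C g \<Longrightarrow> f \<cdot> Inv[f] \<cdot> g = g"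
  using assms by (simp_all add: cmp_assoc_arr[symmetric] iso_in_arr)

lemma iso_cmp:
  assumes "iso_arr C f" "iso_arr C g" "src C g = tgt C f"
  shows "iso_arr C (g \<cdot> f)" and "Inv[g \<cdot> f] = Inv[f] \<cdot> Inv[g]"
proof -
  have "inverse_arrs C (g \<cdot> f) (Inv[f] \<cdot> Inv[g])"
    using assms by (simp add: inverse_arrs_def in_hom iso_in_arr cmp_assoc_arr)
  then show "iso_arr C (g \<cdot> f)" "Inv[g \<cdot> f] = Inv[f] \<cdot> Inv[g]"
    by (auto simp: iso_arr_def intro: Inv_eqI)
qed

lemma iso_cancel_left:
  assumes "iso_arr C f" "f \<cdot> g = f \<cdot> h" "g \<in> arr C" "h \<in> arr C" "tgt C g = src C f" "tgt C h = src C f"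
  shows "g = h"
proof -
  have "g = Inv[f] \<cdot> f \<cdot> g" using assms(1,3,5) by simp
  also have "\<dots> = Inv[f] \<cdot> f \<cdot> h" by (simp only: assms(2))
  also have "\<dots> = h" using assms(1,4,6) by simp
  finally show ?thesis .
qed

lemma iso_cancel_right:
  assumes "iso_arr C f" "g \<cdot> f = h \<cdot> f" "g \<in> arr C" "h \<in> arr C" "src C g = tgt C f" "src C h = tgt C f"
  shows "g = h"
proof -
  have "g = (g \<cdot> f) \<cdot> Inv[f]" using assms(1,3,5) by (simp add: cmp_assoc_arr iso_in_arr)
  also have "\<dots> = (h \<cdot> f) \<cdot> Inv[f]" by (simp only: assms(2))
  also have "\<dots> = h" using assms(1,4,6) by (simp add: cmp_assoc_arr iso_in_arr)
  finally show ?thesis .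
qed

text \<open>Turns a commuting square around when two parallel sides are invertible. This is how a
  statement on the braiding yields the one on the inverse braiding.\<close>

lemma iso_conj:
  assumes "p \<cdot> f = g \<cdot> q" "iso_arr C p" "iso_arr C q" "f \<in> arr C" "g \<in> arr C"
    and "src C p = tgt C f" "tgt C q = src C g"
    and "src C q = src C f" "tgt C p = tgt C g"
  shows "Inv[p] \<cdot> g = f \<cdot> Inv[q]"
proof -
  have "Inv[p] \<cdot> g = Inv[p] \<cdot> (g \<cdot> q) \<cdot> Inv[q]" using assms(2-) by (simp add: cmp_assoc_arr iso_in_arr)
  also have "\<dots> = Inv[p] \<cdot> (p \<cdot> f) \<cdot> Inv[q]" by (simp only: assms(1))
  also have "\<dots> = f \<cdot> Inv[q]" using assms(2-) by (simp add: cmp_assoc_arr iso_in_arr)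
  finally show ?thesis .
qed

text \<open>Arrows act on sets of arrows by post-composition. A composite then becomes an iterated
  application \<open>h \<rhd> g \<rhd> f \<rhd> S\<close>, so that an equation between composites rewrites any segment of a
  longer composite: no re-association is necessary, and the typing conditions have to be checked
  only for the equation itself.\<close>

definition act :: "'a \<Rightarrow> 'a set \<Rightarrow> 'a set"  (infixr "\<rhd>" 54)
  where "f \<rhd> S = {f \<cdot> x | x. x \<in> S \<and> x \<in> arr C \<and> tgt C x = src C f}"

lemma act_cmp:
  assumes "f \<in> arr C" "g \<in> arr C" "src C g = tgt C f"
  shows "(g \<cdot> f) \<rhd> S = g \<rhd> f \<rhd> S"
proof (intro set_eqI iffI)
  fix y assume "y \<in> (g \<cdot> f) \<rhd> S"
  then obtain x where x: "y = (g \<cdot> f) \<cdot> x" "x \<in> S" "x \<in> arr C" "tgt C x = src C f"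
    using assms by (auto simp: act_def)
  then have "y = g \<cdot> f \<cdot> x" "f \<cdot> x \<in> arr C" "tgt C (f \<cdot> x) = src C g"
    using assms by (simp_all add: cmp_assoc_arr)
  with x show "y \<in> g \<rhd> f \<rhd> S" unfolding act_def by blast
next
  fix y assume "y \<in> g \<rhd> f \<rhd> S"
  then obtain x where "y = g \<cdot> f \<cdot> x" "x \<in> S" "x \<in> arr C" "tgt C x = src C f"
    by (auto simp: act_def)
  with assms have "y = (g \<cdot> f) \<cdot> x" "x \<in> S" "x \<in> arr C" "tgt C x = src C (g \<cdot> f)"
    by (simp_all add: cmp_assoc_arr)
  then show "y \<in> (g \<cdot> f) \<rhd> S" unfolding act_def by blast
qed

lemma act_ident: "f \<in> arr C \<Longrightarrow> tgt C f = X \<Longrightarrow> ident C X \<rhd> f \<rhd> S = f \<rhd> S"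
  by (auto simp: act_cmp[symmetric])

text \<open>The set consisting of the identity of the source detects the arrow.\<close>

lemma act_eqI:
  assumes "\<And>S. f \<rhd> S = g \<rhd> S" "f \<in> arr C" "g \<in> arr C" "src C f = src C g"
  shows "f = g"
  using assms(1)[of "{ident C (src C f)}"] assms(2-4) by (simp add: act_def)

end

context monoidal_category
begin

declare tens_obj_closed [simp] unit_obj_closed [simp] assoc_iso [simp]
  left_unitor_iso [simp] right_unitor_iso [simp]

lemma tens_arr [simp]:
  assumes "f \<in> arr C" "g \<in> arr C"
  shows "f \<otimes> g \<in> arr C" "src C (f \<otimes> g) = src C f \<odot> src C g" "tgt C (f \<otimes> g) = tgt C f \<odot> tgt C g"
  using tens_hom[of f _ _ g] assms by (simp_all add: in_hom)

lemma assoc_arr [simp]: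
  assumes "X \<in> obj C" "Y \<in> obj C" "Z \<in> obj C"
  shows "\<a>[X, Y, Z] \<in> arr C" "src C \<a>[X, Y, Z] = (X \<odot> Y) \<odot> Z" "tgt C \<a>[X, Y, Z] = X \<odot> Y \<odot> Z"
  using assoc_hom[OF assms] by (simp_all add: in_hom)

lemma left_unitor_arr [simp]:
  assumes "X \<in> obj C"
  shows "\<l>[X] \<in> arr C" "src C \<l>[X] = \<I> \<odot> X" "tgt C \<l>[X] = X"
  using left_unitor_hom[OF assms] by (simp_all add: in_hom)

lemma right_unitor_arr [simp]:
  assumes "X \<in> obj C"
  shows "\<r>[X] \<in> arr C" "src C \<r>[X] = X \<odot> \<I>" "tgt C \<r>[X] = X"
  using right_unitor_hom[OF assms] by (simp_all add: in_hom)

lemma tens_ident_arr [simp]: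
  "X \<in> obj C \<Longrightarrow> Y \<in> obj C \<Longrightarrow> ident C X \<otimes> ident C Y = ident C (X \<odot> Y)"
  by (rule tens_ident)

lemma tens_cmp_tens:
  assumes "f \<in> arr C" "g \<in> arr C" "f' \<in> arr C" "g' \<in> arr C" "src C f' = tgt C f" "src C g' = tgt C g"
  shows "(f' \<otimes> g') \<cdot> (f \<otimes> g) = (f' \<cdot> f) \<otimes> (g' \<cdot> g)"
  using assms by (intro tens_cmp[symmetric]) (auto simp: in_hom)

lemma assoc_nat:
  assumes "f \<in> arr C" "g \<in> arr C" "h \<in> arr C" "tgt C f = X'" "tgt C g = Y'" "tgt C h = Z'"
  shows "\<a>[X', Y', Z'] \<cdot> ((f \<otimes> g) \<otimes> h)
    = (f \<otimes> g \<otimes> h) \<cdot> \<a>[src C f, src C g, src C h]"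
  using assms by (intro assoc_natural) (auto simp: in_hom)

abbreviation whisk (infixr "\<ltimes>" 70) where "X \<ltimes> f \<equiv> ident C X \<otimes> f"
abbreviation rwhisk (infixl "\<rtimes>" 71) where "f \<rtimes> X \<equiv> f \<otimes> ident C X"

lemma whisk_cmp:
  assumes "X \<in> obj C" "f \<in> arr C" "g \<in> arr C" "src C g = tgt C f"
  shows "X \<ltimes> (g \<cdot> f) = (X \<ltimes> g) \<cdot> (X \<ltimes> f)"
    and "(g \<cdot> f) \<rtimes> X = (g \<rtimes> X) \<cdot> (f \<rtimes> X)"
  using assms by (simp_all add: tens_cmp_tens)

lemma interchange:
  assumes "f \<in> arr C" "g \<in> arr C" "src C f = X" "tgt C f = X'" "src C g = Y" "tgt C g = Y'"
  shows "(f \<rtimes> Y') \<cdot> (X \<ltimes> g) = f \<otimes> g" "(X' \<ltimes> g) \<cdot> (f \<rtimes> Y) = f \<otimes> g"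
  using assms by (auto simp add: tens_cmp_tens)

lemma iso_tens:
  assumes "iso_arr C f" "iso_arr C g"
  shows "iso_arr C (f \<otimes> g)" and "Inv[f \<otimes> g] = Inv[f] \<otimes> Inv[g]"
proof -
  have "inverse_arrs C (f \<otimes> g) (Inv[f] \<otimes> Inv[g])"
    using assms by (simp add: inverse_arrs_def in_hom iso_in_arr tens_cmp_tens)
  then show "iso_arr C (f \<otimes> g)" "Inv[f \<otimes> g] = Inv[f] \<otimes> Inv[g]"
    by (auto simp: iso_arr_def intro: Inv_eqI)
qed

lemma iso_ident [simp]: "X \<in> obj C \<Longrightarrow> iso_arr C (ident C X)"
  and Inv_ident [simp]: "X \<in> obj C \<Longrightarrow> Inv[ident C X] = ident C X"
proof -
  assume "X \<in> obj C"
  then have "inverse_arrs C (ident C X) (ident C X)" by (simp add: inverse_arrs_def in_hom)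
  then show "iso_arr C (ident C X)" "Inv[ident C X] = ident C X"
    by (auto simp: iso_arr_def intro: Inv_eqI)
qed

lemma tens_Inv_cancel [simp]:
  assumes "iso_arr C f" "X \<in> obj C"
  shows "(X \<ltimes> Inv[f]) \<cdot> (X \<ltimes> f) = ident C (X \<odot> src C f)"
    and "(X \<ltimes> f) \<cdot> (X \<ltimes> Inv[f]) = ident C (X \<odot> tgt C f)"
    and "(Inv[f] \<rtimes> X) \<cdot> (f \<rtimes> X) = ident C (src C f \<odot> X)"
    and "(f \<rtimes> X) \<cdot> (Inv[f] \<rtimes> X) = ident C (tgt C f \<odot> X)"
  using assms by (simp_all add: iso_in_arr flip: whisk_cmp)

lemma tens_Inv_cmp_cancel [simp]:
  assumes "iso_arr C f" "X \<in> obj C" "g \<in> arr C"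
  shows "tgt C g = X \<odot> src C f \<Longrightarrow> (X \<ltimes> Inv[f]) \<cdot> (X \<ltimes> f) \<cdot> g = g"
    and "tgt C g = X \<odot> tgt C f \<Longrightarrow> (X \<ltimes> f) \<cdot> (X \<ltimes> Inv[f]) \<cdot> g = g"
    and "tgt C g = src C f \<odot> X \<Longrightarrow> (Inv[f] \<rtimes> X) \<cdot> (f \<rtimes> X) \<cdot> g = g"
    and "tgt C g = tgt C f \<odot> X \<Longrightarrow> (f \<rtimes> X) \<cdot> (Inv[f] \<rtimes> X) \<cdot> g = g"
  using assms by (simp_all add: iso_in_arr flip: cmp_assoc_arr)

lemma left_unitor_nat:
  "f \<in> arr C \<Longrightarrow> tgt C f = Y \<Longrightarrow> \<l>[Y] \<cdot> (\<I> \<ltimes> f) = f \<cdot> \<l>[src C f]"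
  by (intro left_unitor_natural) (auto simp: in_hom)

lemma right_unitor_nat:
  "f \<in> arr C \<Longrightarrow> tgt C f = Y \<Longrightarrow> \<r>[Y] \<cdot> (f \<rtimes> \<I>) = f \<cdot> \<r>[src C f]"
  by (intro right_unitor_natural) (auto simp: in_hom)

lemma unit_whisk_inject:
  assumes "\<I> \<ltimes> f = \<I> \<ltimes> g" "f \<in> arr C" "g \<in> arr C" "src C f = src C g" "tgt C f = tgt C g"
  shows "f = g"
proof -
  have "f \<cdot> \<l>[src C f] = g \<cdot> \<l>[src C f]"
    using assms left_unitor_nat[of f] left_unitor_nat[of g] by simp
  then show ?thesis by (rule iso_cancel_right[rotated]) (use assms in auto)
qed

lemma rwhisk_unit_inject:
  assumes "f \<rtimes> \<I> = g \<rtimes> \<I>" "f \<in> arr C" "g \<in> arr C" "src C f = src C g" "tgt C f = tgt C g"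
  shows "f = g"
proof -
  have "f \<cdot> \<r>[src C f] = g \<cdot> \<r>[src C f]"
    using assms right_unitor_nat[of f] right_unitor_nat[of g] by simp
  then show ?thesis by (rule iso_cancel_right[rotated]) (use assms in auto)
qed

text \<open>Kelly's argument: after tensoring with the unit on the left, which is faithful, the
  claim is a consequence of one pentagon and two triangles.\<close>

lemma left_unitor_tens:
  assumes "X \<in> obj C" "Y \<in> obj C"
  shows "\<l>[X \<odot> Y] \<cdot> \<a>[\<I>, X, Y] = \<l>[X] \<rtimes> Y"
proof (rule unit_whisk_inject)
  let ?p = "\<a>[\<I>, \<I> \<odot> X, Y] \<cdot> (\<a>[\<I>, \<I>, X] \<rtimes> Y)"
  have "(\<I> \<ltimes> (\<l>[X \<odot> Y] \<cdot> \<a>[\<I>, X, Y])) \<cdot> ?p = (\<I> \<ltimes> \<l>[X \<odot> Y]) \<cdot> (\<I> \<ltimes> \<a>[\<I>, X, Y]) \<cdot> ?p"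
    using assms by (simp add: whisk_cmp cmp_assoc_arr)
  also have "\<dots> = (\<I> \<ltimes> \<l>[X \<odot> Y]) \<cdot> \<a>[\<I>, \<I>, X \<odot> Y] \<cdot> \<a>[\<I> \<odot> \<I>, X, Y]"
    using assms by (simp add: pentagon)
  also have "\<dots> = (\<r>[\<I>] \<rtimes> (X \<odot> Y)) \<cdot> \<a>[\<I> \<odot> \<I>, X, Y]"
    using assms by (simp add: cmp_assoc_arr[symmetric] triangle)
  also have "\<dots> = \<a>[\<I>, X, Y] \<cdot> ((\<r>[\<I>] \<rtimes> X) \<rtimes> Y)"
    using assms by (simp add: assoc_nat)
  also have "\<dots> = \<a>[\<I>, X, Y] \<cdot> ((\<I> \<ltimes> \<l>[X]) \<rtimes> Y) \<cdot> (\<a>[\<I>, \<I>, X] \<rtimes> Y)"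
    using assms by (simp add: whisk_cmp[symmetric] triangle)
  also have "\<dots> = (\<I> \<ltimes> (\<l>[X] \<rtimes> Y)) \<cdot> ?p"
    using assms by (simp add: cmp_assoc_arr[symmetric] assoc_nat)
  finally show "\<I> \<ltimes> (\<l>[X \<odot> Y] \<cdot> \<a>[\<I>, X, Y]) = \<I> \<ltimes> (\<l>[X] \<rtimes> Y)"
    by (rule iso_cancel_right[rotated])
      (use assms in \<open>auto simp: iso_tens intro!: iso_cmp\<close>)
qed (use assms in auto)

end

section \<open>Arrows in right-bracketed form\<close>

context monoidal_category
begin

text \<open>An arrow \<open>f : X \<odot> Y \<rightarrow> X' \<odot> Y'\<close> is replaced by the family of the arrows
  \<open>X \<odot> Y \<odot> Z \<rightarrow> X' \<odot> Y' \<odot> Z\<close> that apply it to the two leading factors of a product bracketed to the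
  right. In this form \<open>f\<close> acts at a later position through whiskering from the left alone, and
  in front of further factors through the choice of \<open>Z\<close>. So no associators occur in
  string-diagram calculations with lifted arrows. The four objects are arguments because they are
  not determined by the objects \<open>X \<odot> Y\<close> and \<open>X' \<odot> Y'\<close>.\<close>

definition lift :: "'o \<Rightarrow> 'o \<Rightarrow> 'o \<Rightarrow> 'o \<Rightarrow> 'a \<Rightarrow> 'o \<Rightarrow> 'a"
  where "lift X Y X' Y' f Z = \<a>[X', Y', Z] \<cdot> (f \<rtimes> Z) \<cdot> Inv[\<a>[X, Y, Z]]"

lemma lift_arr [simp]:
  assumes "f \<in> arr C" "src C f = X \<odot> Y" "tgt C f = X' \<odot> Y'"
    and "X \<in> obj C" "Y \<in> obj C" "X' \<in> obj C" "Y' \<in> obj C" "Z \<in> obj C"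
  shows "lift X Y X' Y' f Z \<in> arr C" "src C (lift X Y X' Y' f Z) = X \<odot> Y \<odot> Z"
    "tgt C (lift X Y X' Y' f Z) = X' \<odot> Y' \<odot> Z"
  unfolding lift_def using assms by simp_all

lemma lift_cmp:
  assumes "f \<in> arr C" "src C f = X \<odot> Y" "tgt C f = X' \<odot> Y'"
    and "g \<in> arr C" "src C g = X' \<odot> Y'" "tgt C g = X'' \<odot> Y''"
    and "X \<in> obj C" "Y \<in> obj C" "X' \<in> obj C" "Y' \<in> obj C" "X'' \<in> obj C" "Y'' \<in> obj C" "Z \<in> obj C"
  shows "lift X Y X'' Y'' (g \<cdot> f) Z = lift X' Y' X'' Y'' g Z \<cdot> lift X Y X' Y' f Z"
  unfolding lift_def using assms by (simp add: whisk_cmp cmp_assoc_arr)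

lemma lift_tens:
  assumes "f \<in> arr C" "src C f = X" "tgt C f = X'" "g \<in> arr C" "src C g = Y" "tgt C g = Y'"
    and "Z \<in> obj C"
  shows "lift X Y X' Y' (f \<otimes> g) Z = f \<otimes> (g \<rtimes> Z)"
proof -
  have "X \<in> obj C" "Y \<in> obj C" "X' \<in> obj C" "Y' \<in> obj C" using assms by auto
  then have "lift X Y X' Y' (f \<otimes> g) Z = (\<a>[X', Y', Z] \<cdot> ((f \<otimes> g) \<rtimes> Z)) \<cdot> Inv[\<a>[X, Y, Z]]"
    unfolding lift_def using assms by (simp add: cmp_assoc_arr)
  also have "\<dots> = f \<otimes> (g \<rtimes> Z)"
    using assms \<open>X \<in> obj C\<close> \<open>Y \<in> obj C\<close> by (simp add: assoc_nat cmp_assoc_arr)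
  finally show ?thesis .
qed

lemma lift_ident:
  assumes "X \<in> obj C" "Y \<in> obj C" "Z \<in> obj C"
  shows "lift X Y X Y (ident C (X \<odot> Y)) Z = ident C (X \<odot> Y \<odot> Z)"
  using lift_tens[of "ident C X" X X "ident C Y" Y Y Z] assms by simp

text \<open>Arrows at disjoint positions commute.\<close>

lemma lift_natural:
  assumes "f \<in> arr C" "src C f = X \<odot> Y" "tgt C f = X' \<odot> Y'"
    and "X \<in> obj C" "Y \<in> obj C" "X' \<in> obj C" "Y' \<in> obj C"
    and "h \<in> arr C" "src C h = Z" "tgt C h = Z'"
  shows "(X' \<ltimes> Y' \<ltimes> h) \<cdot> lift X Y X' Y' f Z = lift X Y X' Y' f Z' \<cdot> (X \<ltimes> Y \<ltimes> h)"
proof -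
  have Z: "Z \<in> obj C" "Z' \<in> obj C" using assms by auto
  have nat: "(U \<ltimes> V \<ltimes> h) \<cdot> \<a>[U, V, Z] = \<a>[U, V, Z'] \<cdot> ((U \<odot> V) \<ltimes> h)"
    if "U \<in> obj C" "V \<in> obj C" for U V
    using assoc_nat[of "ident C U" "ident C V" h U V Z'] assms that by simp
  have "(X' \<ltimes> Y' \<ltimes> h) \<cdot> lift X Y X' Y' f Z
      = ((X' \<ltimes> Y' \<ltimes> h) \<cdot> \<a>[X', Y', Z]) \<cdot> (f \<rtimes> Z) \<cdot> Inv[\<a>[X, Y, Z]]"
    unfolding lift_def using assms Z by (simp add: cmp_assoc_arr)
  also have "\<dots> = \<a>[X', Y', Z'] \<cdot> (((X' \<odot> Y') \<ltimes> h) \<cdot> (f \<rtimes> Z)) \<cdot> Inv[\<a>[X, Y, Z]]"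
    using assms Z by (simp add: nat cmp_assoc_arr)
  also have "\<dots> = \<a>[X', Y', Z'] \<cdot> ((f \<rtimes> Z') \<cdot> Inv[\<a>[X, Y, Z']] \<cdot> (\<a>[X, Y, Z'] \<cdot> ((X \<odot> Y) \<ltimes> h))) \<cdot> Inv[\<a>[X, Y, Z]]"
    using assms Z by (simp add: interchange)
  also have "\<dots> = lift X Y X' Y' f Z' \<cdot> (X \<ltimes> Y \<ltimes> h)"
    unfolding lift_def nat[OF assms(4,5), symmetric] using assms Z by (simp add: cmp_assoc_arr)
  finally show ?thesis .
qed

text \<open>The instance at the unit object determines the arrow, because tensoring with the unit is
  faithful.\<close>

lemma lift_inject:
  assumes "lift X Y X' Y' f \<I> = lift X Y X' Y' g \<I>"
    and "f \<in> arr C" "src C f = X \<odot> Y" "tgt C f = X' \<odot> Y'"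
    and "g \<in> arr C" "src C g = X \<odot> Y" "tgt C g = X' \<odot> Y'"
    and "X \<in> obj C" "Y \<in> obj C" "X' \<in> obj C" "Y' \<in> obj C"
  shows "f = g"
proof (rule rwhisk_unit_inject)
  have "(f \<rtimes> \<I>) \<cdot> Inv[\<a>[X, Y, \<I>]] = (g \<rtimes> \<I>) \<cdot> Inv[\<a>[X, Y, \<I>]]"
    by (rule iso_cancel_left[OF _ assms(1)[unfolded lift_def]]) (use assms(2-) in auto)
  then show "f \<rtimes> \<I> = g \<rtimes> \<I>"
    by (rule iso_cancel_right[rotated]) (use assms(2-) in auto)
qed (use assms in auto)

lemma iso_lift:
  assumes "iso_arr C f" "src C f = X \<odot> Y" "tgt C f = X' \<odot> Y'"
    and "X \<in> obj C" "Y \<in> obj C" "X' \<in> obj C" "Y' \<in> obj C" "Z \<in> obj C"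
  shows "iso_arr C (lift X Y X' Y' f Z)"
    and "Inv[lift X Y X' Y' f Z] = lift X' Y' X Y Inv[f] Z"
  unfolding lift_def using assms by (simp_all add: iso_cmp iso_tens iso_in_arr cmp_assoc_arr)

definition assoc3 :: "'o \<Rightarrow> 'o \<Rightarrow> 'o \<Rightarrow> 'o \<Rightarrow> 'a"
  where "assoc3 X Y Z W = \<a>[X, Y, Z \<odot> W] \<cdot> \<a>[X \<odot> Y, Z, W]"

lemma assoc3_arr [simp]:
  assumes "X \<in> obj C" "Y \<in> obj C" "Z \<in> obj C" "W \<in> obj C"
  shows "iso_arr C (assoc3 X Y Z W)" "assoc3 X Y Z W \<in> arr C"
    "src C (assoc3 X Y Z W) = ((X \<odot> Y) \<odot> Z) \<odot> W" "tgt C (assoc3 X Y Z W) = X \<odot> Y \<odot> Z \<odot> W"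
  unfolding assoc3_def using assms by (simp_all add: iso_cmp)

lemma assoc3_pentagon:
  assumes "X \<in> obj C" "Y \<in> obj C" "Z \<in> obj C" "W \<in> obj C"
  shows "assoc3 X Y Z W = (X \<ltimes> \<a>[Y, Z, W]) \<cdot> \<a>[X, Y \<odot> Z, W] \<cdot> (\<a>[X, Y, Z] \<rtimes> W)"
  unfolding assoc3_def using assms by (simp add: pentagon)

text \<open>The analogue of \<^const>\<open>lift\<close> for products of three factors. It is the translation from the
  left-bracketed triple products of the axioms to the right-bracketed form.\<close>

definition lift3 :: "'o \<Rightarrow> 'o \<Rightarrow> 'o \<Rightarrow> 'o \<Rightarrow> 'o \<Rightarrow> 'o \<Rightarrow> 'a \<Rightarrow> 'o \<Rightarrow> 'a"
  where "lift3 X Y Z X' Y' Z' f W = assoc3 X' Y' Z' W \<cdot> (f \<rtimes> W) \<cdot> Inv[assoc3 X Y Z W]"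

lemma lift3_arr [simp]:
  assumes "f \<in> arr C" "src C f = (X \<odot> Y) \<odot> Z" "tgt C f = (X' \<odot> Y') \<odot> Z'"
    and "X \<in> obj C" "Y \<in> obj C" "Z \<in> obj C" "X' \<in> obj C" "Y' \<in> obj C" "Z' \<in> obj C" "W \<in> obj C"
  shows "lift3 X Y Z X' Y' Z' f W \<in> arr C" "src C (lift3 X Y Z X' Y' Z' f W) = X \<odot> Y \<odot> Z \<odot> W"
    "tgt C (lift3 X Y Z X' Y' Z' f W) = X' \<odot> Y' \<odot> Z' \<odot> W"
  unfolding lift3_def using assms by simp_all

lemma lift3_cmp:
  assumes "f \<in> arr C" "src C f = (X \<odot> Y) \<odot> Z" "tgt C f = (X' \<odot> Y') \<odot> Z'"
    and "g \<in> arr C" "src C g = (X' \<odot> Y') \<odot> Z'" "tgt C g = (X'' \<odot> Y'') \<odot> Z''"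
    and "X \<in> obj C" "Y \<in> obj C" "Z \<in> obj C" "X' \<in> obj C" "Y' \<in> obj C" "Z' \<in> obj C"
    and "X'' \<in> obj C" "Y'' \<in> obj C" "Z'' \<in> obj C" "W \<in> obj C"
  shows "lift3 X Y Z X'' Y'' Z'' (g \<cdot> f) W
    = lift3 X' Y' Z' X'' Y'' Z'' g W \<cdot> lift3 X Y Z X' Y' Z' f W"
  unfolding lift3_def using assms by (simp add: whisk_cmp cmp_assoc_arr)

lemma lift3_inject:
  assumes "lift3 X Y Z X' Y' Z' f \<I> = lift3 X Y Z X' Y' Z' g \<I>"
    and "f \<in> arr C" "src C f = (X \<odot> Y) \<odot> Z" "tgt C f = (X' \<odot> Y') \<odot> Z'"
    and "g \<in> arr C" "src C g = (X \<odot> Y) \<odot> Z" "tgt C g = (X' \<odot> Y') \<odot> Z'"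
    and "X \<in> obj C" "Y \<in> obj C" "Z \<in> obj C" "X' \<in> obj C" "Y' \<in> obj C" "Z' \<in> obj C"
  shows "f = g"
proof (rule rwhisk_unit_inject)
  have "(f \<rtimes> \<I>) \<cdot> Inv[assoc3 X Y Z \<I>] = (g \<rtimes> \<I>) \<cdot> Inv[assoc3 X Y Z \<I>]"
    by (rule iso_cancel_left[OF _ assms(1)[unfolded lift3_def]]) (use assms(2-) in auto)
  then show "f \<rtimes> \<I> = g \<rtimes> \<I>"
    by (rule iso_cancel_right[rotated]) (use assms(2-) in auto)
qed (use assms in auto)

lemma lift3_eq_lift:
  assumes "f \<in> arr C" "src C f = (X \<odot> Y) \<odot> Z" "tgt C f = (X' \<odot> Y') \<odot> Z'"
    and "X \<in> obj C" "Y \<in> obj C" "Z \<in> obj C" "X' \<in> obj C" "Y' \<in> obj C" "Z' \<in> obj C" "W \<in> obj C"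
  shows "lift3 X Y Z X' Y' Z' f W
    = \<a>[X', Y', Z' \<odot> W] \<cdot> lift (X \<odot> Y) Z (X' \<odot> Y') Z' f W \<cdot> Inv[\<a>[X, Y, Z \<odot> W]]"
  unfolding lift3_def lift_def assoc3_def using assms by (simp add: iso_cmp cmp_assoc_arr)

text \<open>An arrow on the first two of three factors becomes a mere change of the parameter, by
  naturality of the associator.\<close>

lemma lift3_rwhisk:
  assumes "f \<in> arr C" "src C f = X \<odot> Y" "tgt C f = X' \<odot> Y'"
    and "X \<in> obj C" "Y \<in> obj C" "X' \<in> obj C" "Y' \<in> obj C" "Z \<in> obj C" "W \<in> obj C"
  shows "lift3 X Y Z X' Y' Z (f \<rtimes> Z) W = lift X Y X' Y' f (Z \<odot> W)"
proof -
  have "lift3 X Y Z X' Y' Z (f \<rtimes> Z) W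
      = \<a>[X', Y', Z \<odot> W] \<cdot> lift (X \<odot> Y) Z (X' \<odot> Y') Z (f \<rtimes> Z) W \<cdot> Inv[\<a>[X, Y, Z \<odot> W]]"
    using assms by (simp add: lift3_eq_lift)
  also have "lift (X \<odot> Y) Z (X' \<odot> Y') Z (f \<rtimes> Z) W = f \<rtimes> (Z \<odot> W)"
    using assms by (simp add: lift_tens)
  finally show ?thesis by (simp add: lift_def)
qed

text \<open>An arrow on the last two of three factors becomes a whiskered one: the pentagon absorbs the
  associators that \<^const>\<open>on_right\<close> introduces.\<close>

lemma lift3_assoc_conj:
  assumes "f \<in> arr C" "src C f = Y \<odot> Z" "tgt C f = Y' \<odot> Z'"
    and "X \<in> obj C" "Y \<in> obj C" "Z \<in> obj C" "Y' \<in> obj C" "Z' \<in> obj C" "W \<in> obj C"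
  shows "lift3 X Y Z X Y' Z' (Inv[\<a>[X, Y', Z']] \<cdot> (X \<ltimes> f) \<cdot> \<a>[X, Y, Z]) W = X \<ltimes> lift Y Z Y' Z' f W"
proof -
  have "lift3 X Y Z X Y' Z' (Inv[\<a>[X, Y', Z']] \<cdot> (X \<ltimes> f) \<cdot> \<a>[X, Y, Z]) W
    = (X \<ltimes> \<a>[Y', Z', W]) \<cdot> \<a>[X, Y' \<odot> Z', W] \<cdot> ((\<a>[X, Y', Z'] \<rtimes> W) \<cdot> (Inv[\<a>[X, Y', Z']] \<rtimes> W))
      \<cdot> ((X \<ltimes> f) \<rtimes> W) \<cdot> ((\<a>[X, Y, Z] \<rtimes> W) \<cdot> (Inv[\<a>[X, Y, Z]] \<rtimes> W))
      \<cdot> Inv[\<a>[X, Y \<odot> Z, W]] \<cdot> (X \<ltimes> Inv[\<a>[Y, Z, W]])"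
    unfolding lift3_def assoc3_pentagon[OF assms(4,5,6,9)] assoc3_pentagon[OF assms(4,7,8,9)]
    using assms by (simp add: iso_cmp iso_tens whisk_cmp cmp_assoc_arr)
  also have "\<dots> = (X \<ltimes> \<a>[Y', Z', W]) \<cdot> (\<a>[X, Y' \<odot> Z', W]
      \<cdot> ((X \<ltimes> f) \<rtimes> W)) \<cdot> Inv[\<a>[X, Y \<odot> Z, W]] \<cdot> (X \<ltimes> Inv[\<a>[Y, Z, W]])"
    using assms by (simp add: whisk_cmp(2)[symmetric] cmp_assoc_arr)
  also have "\<dots> = (X \<ltimes> \<a>[Y', Z', W]) \<cdot> (X \<ltimes> (f \<rtimes> W)) \<cdot> (X \<ltimes> Inv[\<a>[Y, Z, W]])"
    using assms by (simp add: assoc_nat cmp_assoc_arr)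
  also have "\<dots> = X \<ltimes> lift Y Z Y' Z' f W"
    unfolding lift_def using assms by (simp add: whisk_cmp)
  finally show ?thesis .
qed

lemma on_right_arr [simp]:
  assumes "f \<in> arr C" "src C f = Y \<odot> Z" "tgt C f = Y \<odot> Z" "X \<in> obj C" "Y \<in> obj C" "Z \<in> obj C"
  shows "on_right C X Y Z f \<in> arr C" "src C (on_right C X Y Z f) = (X \<odot> Y) \<odot> Z"
    "tgt C (on_right C X Y Z f) = (X \<odot> Y) \<odot> Z"
  unfolding on_right_def using assms by simp_all

lemma lift3_on_right:
  assumes "f \<in> arr C" "src C f = Y \<odot> Z" "tgt C f = Y \<odot> Z"
    and "X \<in> obj C" "Y \<in> obj C" "Z \<in> obj C" "W \<in> obj C"
  shows "lift3 X Y Z X Y Z (on_right C X Y Z f) W = X \<ltimes> lift Y Z Y Z f W"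
  unfolding on_right_def using assms by (simp add: lift3_assoc_conj)

end

section \<open>Crossings\<close>

context braided_monoidal_category
begin

declare braiding_iso [simp]

lemma braiding_arr [simp]:
  assumes "X \<in> obj C" "Y \<in> obj C"
  shows "\<b>[X, Y] \<in> arr C" "src C \<b>[X, Y] = X \<odot> Y" "tgt C \<b>[X, Y] = Y \<odot> X"
  using braiding_hom[OF assms] by (simp_all add: in_hom)

lemma braiding_nat:
  assumes "f \<in> arr C" "g \<in> arr C" "tgt C f = X'" "tgt C g = Y'"
  shows "\<b>[X', Y'] \<cdot> (f \<otimes> g) = (g \<otimes> f) \<cdot> \<b>[src C f, src C g]"
  using assms by (intro braiding_natural) (auto simp: in_hom)

text \<open>The two crossings of \<open>X\<close> with \<open>Y\<close>. A parameter for the sign allows one proof for \<open>C\<close> and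
  \<open>bar C\<close>, whose braiding is \<open>braid False\<close>.\<close>

definition braid :: "bool \<Rightarrow> 'o \<Rightarrow> 'o \<Rightarrow> 'a"
  where "braid s X Y = (if s then \<b>[X, Y] else Inv[\<b>[Y, X]])"

lemma braid_arr [simp]:
  assumes "X \<in> obj C" "Y \<in> obj C"
  shows "iso_arr C (braid s X Y)" "braid s X Y \<in> arr C" "src C (braid s X Y) = X \<odot> Y"
    "tgt C (braid s X Y) = Y \<odot> X" "Inv[braid s X Y] = braid (\<not> s) Y X"
  unfolding braid_def using assms by simp_all

abbreviation cross :: "bool \<Rightarrow> 'o \<Rightarrow> 'o \<Rightarrow> 'o \<Rightarrow> 'a"
  where "cross s X Y Z \<equiv> lift X Y Y X (braid s X Y) Z"

lemma cross_iso [simp]: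
  assumes "X \<in> obj C" "Y \<in> obj C" "Z \<in> obj C"
  shows "iso_arr C (cross s X Y Z)" "Inv[cross s X Y Z] = cross (\<not> s) Y X Z"
  using assms by (simp_all add: iso_lift)

text \<open>The hexagon for an object that moves to the right past \<open>X \<odot> Y\<close>.\<close>

lemma cross_tens_left:
  assumes "U \<in> obj C" "X \<in> obj C" "Y \<in> obj C" "Z \<in> obj C"
  shows "\<a>[X, Y, U \<odot> Z] \<cdot> lift U (X \<odot> Y) (X \<odot> Y) U \<b>[U, X \<odot> Y] Z
    = (X \<ltimes> cross True U Y Z) \<cdot> cross True U X (Y \<odot> Z) \<cdot> (U \<ltimes> \<a>[X, Y, Z])"
proof -
  let ?h = "Inv[\<a>[X, Y, U]] \<cdot> (X \<ltimes> \<b>[U, Y]) \<cdot> \<a>[X, U, Y]"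
  have "lift3 U X Y X Y U (\<b>[U, X \<odot> Y] \<cdot> \<a>[U, X, Y]) Z
    = \<a>[X, Y, U \<odot> Z] \<cdot> lift U (X \<odot> Y) (X \<odot> Y) U \<b>[U, X \<odot> Y] Z \<cdot> (U \<ltimes> Inv[\<a>[X, Y, Z]])"
    unfolding lift3_def assoc3_pentagon[OF assms] assoc3_def[of X Y U Z] lift_def
    using assms by (simp add: iso_cmp iso_tens whisk_cmp cmp_assoc_arr)
  moreover have "\<b>[U, X \<odot> Y] \<cdot> \<a>[U, X, Y] = ?h \<cdot> (\<b>[U, X] \<rtimes> Y)"
    by (rule iso_cancel_left[of "\<a>[X, Y, U]"]) (use assms in \<open>auto simp: hexagon1 cmp_assoc_arr\<close>)
  moreover have "lift3 U X Y X Y U (?h \<cdot> (\<b>[U, X] \<rtimes> Y)) Z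
    = lift3 X U Y X Y U ?h Z \<cdot> lift3 U X Y X U Y (\<b>[U, X] \<rtimes> Y) Z"
    using assms by (intro lift3_cmp) auto
  moreover have "\<dots> = (X \<ltimes> cross True U Y Z) \<cdot> cross True U X (Y \<odot> Z)"
    using assms by (simp add: lift3_assoc_conj lift3_rwhisk braid_def)
  ultimately have *: "(\<a>[X, Y, U \<odot> Z] \<cdot> lift U (X \<odot> Y) (X \<odot> Y) U \<b>[U, X \<odot> Y] Z) \<cdot> (U \<ltimes> Inv[\<a>[X, Y, Z]])
    = (X \<ltimes> cross True U Y Z) \<cdot> cross True U X (Y \<odot> Z)"
    using assms by (simp add: cmp_assoc_arr)
  show ?thesis
    by (rule iso_cancel_right[of "U \<ltimes> Inv[\<a>[X, Y, Z]]"])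
      (use assms * in \<open>auto simp: iso_tens cmp_assoc_arr\<close>)
qed

text \<open>The hexagon for an object that moves to the left past \<open>X \<odot> Y\<close>.\<close>

lemma cross_tens_right:
  assumes "X \<in> obj C" "Y \<in> obj C" "U \<in> obj C" "Z \<in> obj C"
  shows "(U \<ltimes> \<a>[X, Y, Z]) \<cdot> lift (X \<odot> Y) U U (X \<odot> Y) \<b>[X \<odot> Y, U] Z
    = cross True X U (Y \<odot> Z) \<cdot> (X \<ltimes> cross True Y U Z) \<cdot> \<a>[X, Y, U \<odot> Z]"
proof -
  let ?h = "Inv[\<a>[X, U, Y]] \<cdot> (X \<ltimes> \<b>[Y, U]) \<cdot> \<a>[X, Y, U]"
  have "lift3 X Y U U X Y (Inv[\<a>[U, X, Y]] \<cdot> \<b>[X \<odot> Y, U]) Z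
    = (U \<ltimes> \<a>[X, Y, Z]) \<cdot> lift (X \<odot> Y) U U (X \<odot> Y) \<b>[X \<odot> Y, U] Z \<cdot> Inv[\<a>[X, Y, U \<odot> Z]]"
    unfolding lift3_def assoc3_pentagon[OF assms(3,1,2,4)] assoc3_def[of X Y U Z] lift_def
    using assms by (simp add: iso_cmp iso_tens whisk_cmp cmp_assoc_arr)
  moreover have "Inv[\<a>[U, X, Y]] \<cdot> \<b>[X \<odot> Y, U] = (\<b>[X, U] \<rtimes> Y) \<cdot> ?h"
    by (rule iso_cancel_right[of "Inv[\<a>[X, Y, U]]"]) (use assms in \<open>auto simp: hexagon2 cmp_assoc_arr\<close>)
  moreover have "lift3 X Y U U X Y ((\<b>[X, U] \<rtimes> Y) \<cdot> ?h) Z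
    = lift3 X U Y U X Y (\<b>[X, U] \<rtimes> Y) Z \<cdot> lift3 X Y U X U Y ?h Z"
    using assms by (intro lift3_cmp) auto
  moreover have "\<dots> = cross True X U (Y \<odot> Z) \<cdot> (X \<ltimes> cross True Y U Z)"
    using assms by (simp add: lift3_assoc_conj lift3_rwhisk braid_def)
  ultimately have *: "((U \<ltimes> \<a>[X, Y, Z]) \<cdot> lift (X \<odot> Y) U U (X \<odot> Y) \<b>[X \<odot> Y, U] Z) \<cdot> Inv[\<a>[X, Y, U \<odot> Z]]
    = cross True X U (Y \<odot> Z) \<cdot> (X \<ltimes> cross True Y U Z)"
    using assms by (simp add: cmp_assoc_arr)
  show ?thesis
    by (rule iso_cancel_right[of "Inv[\<a>[X, Y, U \<odot> Z]]"])
      (use assms * in \<open>auto simp: iso_tens cmp_assoc_arr\<close>)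
qed

text \<open>Naturality of the braiding at \<open>f\<close>: a strand \<open>U\<close> that crosses both strands of \<open>f\<close> may do so
  before or after \<open>f\<close>. The hexagon splits the crossing with \<open>X \<odot> Y\<close> into two crossings.\<close>

lemma slide_left_True:
  assumes "f \<in> arr C" "src C f = X \<odot> Y" "tgt C f = X' \<odot> Y'"
    and "X \<in> obj C" "Y \<in> obj C" "X' \<in> obj C" "Y' \<in> obj C" "U \<in> obj C" "Z \<in> obj C"
  shows "(X' \<ltimes> cross True U Y' Z) \<cdot> cross True U X' (Y' \<odot> Z) \<cdot> (U \<ltimes> lift X Y X' Y' f Z)
    = lift X Y X' Y' f (U \<odot> Z) \<cdot> (X \<ltimes> cross True U Y Z) \<cdot> cross True U X (Y \<odot> Z)"
proof -
  let ?B = "\<lambda>X Y. lift U (X \<odot> Y) (X \<odot> Y) U \<b>[U, X \<odot> Y] Z"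
  have B: "(X \<ltimes> cross True U Y Z) \<cdot> cross True U X (Y \<odot> Z) = \<a>[X, Y, U \<odot> Z] \<cdot> ?B X Y \<cdot> (U \<ltimes> Inv[\<a>[X, Y, Z]])"
    if "X \<in> obj C" "Y \<in> obj C" for X Y
  proof (rule iso_cancel_right[of "U \<ltimes> \<a>[X, Y, Z]"])
    show "((X \<ltimes> cross True U Y Z) \<cdot> cross True U X (Y \<odot> Z)) \<cdot> (U \<ltimes> \<a>[X, Y, Z])
      = (\<a>[X, Y, U \<odot> Z] \<cdot> ?B X Y \<cdot> (U \<ltimes> Inv[\<a>[X, Y, Z]])) \<cdot> (U \<ltimes> \<a>[X, Y, Z])"
      using assms that by (simp add: cmp_assoc_arr cross_tens_left)
  qed (use assms that in \<open>auto simp: iso_tens\<close>)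
  have nat: "?B X' Y' \<cdot> (U \<ltimes> (f \<rtimes> Z)) = (f \<rtimes> (U \<odot> Z)) \<cdot> ?B X Y"
  proof -
    have "lift U (X \<odot> Y) (X' \<odot> Y') U (\<b>[U, X' \<odot> Y'] \<cdot> (U \<ltimes> f)) Z
        = lift U (X \<odot> Y) (X' \<odot> Y') U ((f \<rtimes> U) \<cdot> \<b>[U, X \<odot> Y]) Z"
      using assms by (simp add: braiding_nat)
    then show ?thesis
      using assms lift_cmp[of "U \<ltimes> f" U "X \<odot> Y" U "X' \<odot> Y'" "\<b>[U, X' \<odot> Y']" "X' \<odot> Y'" U Z]
        lift_cmp[of "\<b>[U, X \<odot> Y]" U "X \<odot> Y" "X \<odot> Y" U "f \<rtimes> U" "X' \<odot> Y'" U Z]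
      by (simp add: lift_tens)
  qed
  have "((X' \<ltimes> cross True U Y' Z) \<cdot> cross True U X' (Y' \<odot> Z)) \<cdot> (U \<ltimes> lift X Y X' Y' f Z)
    = \<a>[X', Y', U \<odot> Z] \<cdot> (?B X' Y' \<cdot> (U \<ltimes> (f \<rtimes> Z))) \<cdot> (U \<ltimes> Inv[\<a>[X, Y, Z]])"
    unfolding B[OF assms(6,7)] using assms by (simp add: lift_def[of X Y X' Y'] whisk_cmp cmp_assoc_arr)
  also have "\<dots> = lift X Y X' Y' f (U \<odot> Z) \<cdot> (X \<ltimes> cross True U Y Z) \<cdot> cross True U X (Y \<odot> Z)"
    unfolding B[OF assms(4,5)] nat lift_def[of X Y X' Y'] using assms by (simp add: cmp_assoc_arr)
  finally show ?thesis using assms by (simp add: cmp_assoc_arr)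
qed

lemma slide_right_True:
  assumes "f \<in> arr C" "src C f = X \<odot> Y" "tgt C f = X' \<odot> Y'"
    and "X \<in> obj C" "Y \<in> obj C" "X' \<in> obj C" "Y' \<in> obj C" "U \<in> obj C" "Z \<in> obj C"
  shows "cross True X' U (Y' \<odot> Z) \<cdot> (X' \<ltimes> cross True Y' U Z) \<cdot> lift X Y X' Y' f (U \<odot> Z)
    = (U \<ltimes> lift X Y X' Y' f Z) \<cdot> cross True X U (Y \<odot> Z) \<cdot> (X \<ltimes> cross True Y U Z)"
proof -
  let ?B = "\<lambda>X Y. lift (X \<odot> Y) U U (X \<odot> Y) \<b>[X \<odot> Y, U] Z"
  have B: "cross True X U (Y \<odot> Z) \<cdot> (X \<ltimes> cross True Y U Z) = (U \<ltimes> \<a>[X, Y, Z]) \<cdot> ?B X Y \<cdot> Inv[\<a>[X, Y, U \<odot> Z]]"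
    if "X \<in> obj C" "Y \<in> obj C" for X Y
  proof (rule iso_cancel_right[of "\<a>[X, Y, U \<odot> Z]"])
    show "(cross True X U (Y \<odot> Z) \<cdot> (X \<ltimes> cross True Y U Z)) \<cdot> \<a>[X, Y, U \<odot> Z]
      = ((U \<ltimes> \<a>[X, Y, Z]) \<cdot> ?B X Y \<cdot> Inv[\<a>[X, Y, U \<odot> Z]]) \<cdot> \<a>[X, Y, U \<odot> Z]"
      using assms that by (simp add: cmp_assoc_arr cross_tens_right)
  qed (use assms that in \<open>auto simp: iso_tens\<close>)
  have nat: "?B X' Y' \<cdot> (f \<rtimes> (U \<odot> Z)) = (U \<ltimes> (f \<rtimes> Z)) \<cdot> ?B X Y"
  proof -
    have "lift (X \<odot> Y) U U (X' \<odot> Y') (\<b>[X' \<odot> Y', U] \<cdot> (f \<rtimes> U)) Z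
        = lift (X \<odot> Y) U U (X' \<odot> Y') ((U \<ltimes> f) \<cdot> \<b>[X \<odot> Y, U]) Z"
      using assms by (simp add: braiding_nat)
    then show ?thesis
      using assms lift_cmp[of "f \<rtimes> U" "X \<odot> Y" U "X' \<odot> Y'" U "\<b>[X' \<odot> Y', U]" U "X' \<odot> Y'" Z]
        lift_cmp[of "\<b>[X \<odot> Y, U]" "X \<odot> Y" U U "X \<odot> Y" "U \<ltimes> f" U "X' \<odot> Y'" Z]
      by (simp add: lift_tens)
  qed
  have "(cross True X' U (Y' \<odot> Z) \<cdot> (X' \<ltimes> cross True Y' U Z)) \<cdot> lift X Y X' Y' f (U \<odot> Z)
    = (U \<ltimes> \<a>[X', Y', Z]) \<cdot> (?B X' Y' \<cdot> (f \<rtimes> (U \<odot> Z))) \<cdot> Inv[\<a>[X, Y, U \<odot> Z]]"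
    unfolding B[OF assms(6,7)] using assms by (simp add: lift_def[of X Y X' Y'] cmp_assoc_arr)
  also have "\<dots> = (U \<ltimes> lift X Y X' Y' f Z) \<cdot> (cross True X U (Y \<odot> Z) \<cdot> (X \<ltimes> cross True Y U Z))"
    unfolding B[OF assms(4,5)] nat lift_def[of X Y X' Y'] using assms by (simp add: whisk_cmp cmp_assoc_arr)
  finally show ?thesis using assms by (simp add: cmp_assoc_arr)
qed

text \<open>The hexagons for both signs; those for the inverse braiding arise from the other hexagon by
  inverting it.\<close>

lemma assoc_cross_tens:
  assumes "X \<in> obj C" "Y \<in> obj C" "U \<in> obj C" "Z \<in> obj C"
  shows "\<a>[X, Y, U \<odot> Z] \<cdot> cross s U (X \<odot> Y) Z
      = (X \<ltimes> cross s U Y Z) \<cdot> cross s U X (Y \<odot> Z) \<cdot> (U \<ltimes> \<a>[X, Y, Z])"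
    and "(U \<ltimes> \<a>[X, Y, Z]) \<cdot> cross s (X \<odot> Y) U Z
      = cross s X U (Y \<odot> Z) \<cdot> (X \<ltimes> cross s Y U Z) \<cdot> \<a>[X, Y, U \<odot> Z]"
proof -
  have braid_True: "\<b>[X, Y] = braid True X Y" for X Y by (simp add: braid_def)
  note T = cross_tens_left[of U X Y Z, unfolded braid_True] cross_tens_right[of X Y U Z, unfolded braid_True]
  have flip: "q' \<cdot> Inv[c] = Inv[p] \<cdot> q"
    if "q \<cdot> c = p \<cdot> q'" "iso_arr C p" "iso_arr C c" "q \<in> arr C" "q' \<in> arr C"
      "src C q = tgt C c" "src C p = tgt C q'" "tgt C q = tgt C p" "src C q' = src C c" for p q q' c
    by (rule iso_conj[symmetric]) (simp_all add: that)
  show "\<a>[X, Y, U \<odot> Z] \<cdot> cross s U (X \<odot> Y) Z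
      = (X \<ltimes> cross s U Y Z) \<cdot> cross s U X (Y \<odot> Z) \<cdot> (U \<ltimes> \<a>[X, Y, Z])"
  proof (cases s)
    case False
    have "\<a>[X, Y, U \<odot> Z] \<cdot> Inv[cross True (X \<odot> Y) U Z]
        = Inv[cross True X U (Y \<odot> Z) \<cdot> (X \<ltimes> cross True Y U Z)] \<cdot> (U \<ltimes> \<a>[X, Y, Z])"
      by (rule flip) (use assms T in \<open>auto simp: iso_cmp iso_tens cmp_assoc_arr\<close>)
    then show ?thesis using assms False by (simp add: iso_cmp iso_tens cmp_assoc_arr)
  qed (use assms T in simp)
  show "(U \<ltimes> \<a>[X, Y, Z]) \<cdot> cross s (X \<odot> Y) U Z
      = cross s X U (Y \<odot> Z) \<cdot> (X \<ltimes> cross s Y U Z) \<cdot> \<a>[X, Y, U \<odot> Z]"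
  proof (cases s)
    case False
    have "(U \<ltimes> \<a>[X, Y, Z]) \<cdot> Inv[cross True U (X \<odot> Y) Z]
        = Inv[(X \<ltimes> cross True U Y Z) \<cdot> cross True U X (Y \<odot> Z)] \<cdot> \<a>[X, Y, U \<odot> Z]"
      by (rule flip) (use assms T in \<open>auto simp: iso_cmp iso_tens cmp_assoc_arr\<close>)
    then show ?thesis using assms False by (simp add: iso_cmp iso_tens cmp_assoc_arr)
  qed (use assms T in simp)
qed

end

section \<open>Sliding coactions through crossings\<close>

context braided_monoidal_category
begin

text \<open>Inverting the statement for a strand that leaves to the left gives the one for the inverse
  braiding and a strand that leaves to the right, and conversely.\<close>

lemma slide_left:
  assumes "f \<in> arr C" "src C f = X \<odot> Y" "tgt C f = X' \<odot> Y'"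
    and "X \<in> obj C" "Y \<in> obj C" "X' \<in> obj C" "Y' \<in> obj C" "U \<in> obj C" "Z \<in> obj C"
  shows "(X' \<ltimes> cross s U Y' Z) \<cdot> cross s U X' (Y' \<odot> Z) \<cdot> (U \<ltimes> lift X Y X' Y' f Z)
    = lift X Y X' Y' f (U \<odot> Z) \<cdot> (X \<ltimes> cross s U Y Z) \<cdot> cross s U X (Y \<odot> Z)"
proof (cases s)
  case False
  have "Inv[cross True X' U (Y' \<odot> Z) \<cdot> (X' \<ltimes> cross True Y' U Z)] \<cdot> (U \<ltimes> lift X Y X' Y' f Z)
    = lift X Y X' Y' f (U \<odot> Z) \<cdot> Inv[cross True X U (Y \<odot> Z) \<cdot> (X \<ltimes> cross True Y U Z)]"
    by (rule iso_conj)
      (use assms slide_right_True[OF assms] in \<open>auto simp: iso_cmp iso_tens cmp_assoc_arr\<close>)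
  then show ?thesis using assms False by (simp add: iso_cmp iso_tens cmp_assoc_arr)
qed (use assms slide_left_True in simp)

lemma slide_right:
  assumes "f \<in> arr C" "src C f = X \<odot> Y" "tgt C f = X' \<odot> Y'"
    and "X \<in> obj C" "Y \<in> obj C" "X' \<in> obj C" "Y' \<in> obj C" "U \<in> obj C" "Z \<in> obj C"
  shows "cross s X' U (Y' \<odot> Z) \<cdot> (X' \<ltimes> cross s Y' U Z) \<cdot> lift X Y X' Y' f (U \<odot> Z)
    = (U \<ltimes> lift X Y X' Y' f Z) \<cdot> cross s X U (Y \<odot> Z) \<cdot> (X \<ltimes> cross s Y U Z)"
proof (cases s)
  case False
  have "Inv[(X' \<ltimes> cross True U Y' Z) \<cdot> cross True U X' (Y' \<odot> Z)] \<cdot> lift X Y X' Y' f (U \<odot> Z)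
    = (U \<ltimes> lift X Y X' Y' f Z) \<cdot> Inv[(X \<ltimes> cross True U Y Z) \<cdot> cross True U X (Y \<odot> Z)]"
    by (rule iso_conj)
      (use assms slide_left_True[OF assms] in \<open>auto simp: iso_cmp iso_tens cmp_assoc_arr\<close>)
  then show ?thesis using assms False by (simp add: iso_cmp iso_tens cmp_assoc_arr)
qed (use assms slide_right_True in simp)

lemma act_natural:
  assumes "f \<in> arr C" "src C f = X \<odot> Y" "tgt C f = X' \<odot> Y'"
    and "X \<in> obj C" "Y \<in> obj C" "X' \<in> obj C" "Y' \<in> obj C"
    and "h \<in> arr C" "src C h = Z" "tgt C h = Z'"
  shows "(X' \<ltimes> Y' \<ltimes> h) \<rhd> lift X Y X' Y' f Z \<rhd> S = lift X Y X' Y' f Z' \<rhd> (X \<ltimes> Y \<ltimes> h) \<rhd> S"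
proof -
  have "Z \<in> obj C" "Z' \<in> obj C" using assms by auto
  then show ?thesis using lift_natural[OF assms] assms by (simp flip: act_cmp)
qed

lemma act_slide_left:
  assumes "f \<in> arr C" "src C f = X \<odot> Y" "tgt C f = X' \<odot> Y'"
    and "X \<in> obj C" "Y \<in> obj C" "X' \<in> obj C" "Y' \<in> obj C" "U \<in> obj C" "Z \<in> obj C"
  shows "(X' \<ltimes> cross s U Y' Z) \<rhd> cross s U X' (Y' \<odot> Z) \<rhd> (U \<ltimes> lift X Y X' Y' f Z) \<rhd> S
    = lift X Y X' Y' f (U \<odot> Z) \<rhd> (X \<ltimes> cross s U Y Z) \<rhd> cross s U X (Y \<odot> Z) \<rhd> S"
  using slide_left[OF assms] assms by (simp flip: act_cmp)

lemma act_slide_right: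
  assumes "f \<in> arr C" "src C f = X \<odot> Y" "tgt C f = X' \<odot> Y'"
    and "X \<in> obj C" "Y \<in> obj C" "X' \<in> obj C" "Y' \<in> obj C" "U \<in> obj C" "Z \<in> obj C"
  shows "cross s X' U (Y' \<odot> Z) \<rhd> (X' \<ltimes> cross s Y' U Z) \<rhd> lift X Y X' Y' f (U \<odot> Z) \<rhd> S
    = (U \<ltimes> lift X Y X' Y' f Z) \<rhd> cross s X U (Y \<odot> Z) \<rhd> (X \<ltimes> cross s Y U Z) \<rhd> S"
  using slide_right[OF assms] assms by (simp flip: act_cmp)

lemma act_cancel:
  assumes "f \<in> arr C" "tgt C f = X \<odot> Y \<odot> Z" "X \<in> obj C" "Y \<in> obj C" "Z \<in> obj C"
  shows "cross (\<not> s) Y X Z \<rhd> cross s X Y Z \<rhd> f \<rhd> S = f \<rhd> S"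
    and "cross s Y X Z \<rhd> cross (\<not> s) X Y Z \<rhd> f \<rhd> S = f \<rhd> S"
proof -
  have "cross (\<not> s) Y X Z \<cdot> cross s X Y Z \<cdot> f = f"
    using assms Inv_cmp_cmp(1)[of "cross s X Y Z" f] by simp
  then show "cross (\<not> s) Y X Z \<rhd> cross s X Y Z \<rhd> f \<rhd> S = f \<rhd> S" 
    using assms by (simp flip: act_cmp)
  have "cross s Y X Z \<cdot> cross (\<not> s) X Y Z \<cdot> f = f"
    using assms Inv_cmp_cmp(1)[of "cross (\<not> s) X Y Z" f] by simp
  then show "cross s Y X Z \<rhd> cross (\<not> s) X Y Z \<rhd> f \<rhd> S = f \<rhd> S" 
    using assms by (simp flip: act_cmp)
qed

text \<open>A cancelling pair at the end of a chain needs a typed arrow before it: an identity arrow acting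
  on \<open>S\<close> removes the elements with a different target.\<close>

lemma act_cancel_last:
  assumes "f \<in> arr C" "src C f = X \<odot> Y \<odot> Z" "X \<in> obj C" "Y \<in> obj C" "Z \<in> obj C"
  shows "f \<rhd> cross (\<not> s) Y X Z \<rhd> cross s X Y Z \<rhd> S = f \<rhd> S"
proof -
  have "f \<cdot> cross (\<not> s) Y X Z \<cdot> cross s X Y Z = f"
    using assms Inv_arr(4)[of "cross s X Y Z"] by simp
  then show ?thesis
    using assms by (simp flip: act_cmp)
qed

lemma act_whisk_cancel:
  assumes "f \<in> arr C" "tgt C f = W \<odot> X \<odot> Y \<odot> Z" "W \<in> obj C" "X \<in> obj C" "Y \<in> obj C" "Z \<in> obj C"
  shows "(W \<ltimes> cross (\<not> s) Y X Z) \<rhd> (W \<ltimes> cross s X Y Z) \<rhd> f \<rhd> S = f \<rhd> S"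
    and "(W \<ltimes> cross s Y X Z) \<rhd> (W \<ltimes> cross (\<not> s) X Y Z) \<rhd> f \<rhd> S = f \<rhd> S"
proof -
  have "(W \<ltimes> cross (\<not> s) Y X Z) \<cdot> (W \<ltimes> cross s X Y Z) \<cdot> f = f"
    using assms tens_Inv_cmp_cancel(1)[of "cross s X Y Z" W f] by simp
  then show "(W \<ltimes> cross (\<not> s) Y X Z) \<rhd> (W \<ltimes> cross s X Y Z) \<rhd> f \<rhd> S = f \<rhd> S"
    using assms by (simp flip: act_cmp)
  have "(W \<ltimes> cross s Y X Z) \<cdot> (W \<ltimes> cross (\<not> s) X Y Z) \<cdot> f = f"
    using assms tens_Inv_cmp_cancel(1)[of "cross (\<not> s) X Y Z" W f] by simp
  then show "(W \<ltimes> cross s Y X Z) \<rhd> (W \<ltimes> cross (\<not> s) X Y Z) \<rhd> f \<rhd> S = f \<rhd> S"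
    using assms by (simp flip: act_cmp)
qed

text \<open>The arrow \<open>v\<close> on the first and third strand of \<open>V \<odot> W \<odot> A \<odot> Z\<close>. The sign says how the strand
  \<open>V\<close> crosses \<open>W\<close> on its way to \<open>A\<close> and back. In the fusion equations, \<open>W\<close> is a copy of \<open>A\<close> and
  the sign is that of the ambient braiding; in the tensor product of comodules it is always
  \<open>True\<close>.\<close>

definition leg :: "bool \<Rightarrow> 'o \<Rightarrow> 'o \<Rightarrow> 'o \<Rightarrow> 'a \<Rightarrow> 'o \<Rightarrow> 'a"
  where "leg s V W A v Z
    = cross (\<not> s) W V (A \<odot> Z) \<cdot> (W \<ltimes> lift V A V A v Z) \<cdot> cross s V W (A \<odot> Z)"

lemma leg_arr [simp]:
  assumes "v \<in> arr C" "src C v = V \<odot> A" "tgt C v = V \<odot> A"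
    and "V \<in> obj C" "W \<in> obj C" "A \<in> obj C" "Z \<in> obj C"
  shows "leg s V W A v Z \<in> arr C" "src C (leg s V W A v Z) = V \<odot> W \<odot> A \<odot> Z"
    "tgt C (leg s V W A v Z) = V \<odot> W \<odot> A \<odot> Z"
  unfolding leg_def using assms by simp_all

lemma act_leg:
  assumes "v \<in> arr C" "src C v = V \<odot> A" "tgt C v = V \<odot> A"
    and "V \<in> obj C" "W \<in> obj C" "A \<in> obj C" "Z \<in> obj C"
  shows "leg s V W A v Z \<rhd> S
      = cross (\<not> s) W V (A \<odot> Z) \<rhd> (W \<ltimes> lift V A V A v Z) \<rhd> cross s V W (A \<odot> Z) \<rhd> S"
    and "X \<in> obj C \<Longrightarrow> (X \<ltimes> leg s V W A v Z) \<rhd> S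
      = (X \<ltimes> cross (\<not> s) W V (A \<odot> Z)) \<rhd> (X \<ltimes> W \<ltimes> lift V A V A v Z) \<rhd> (X \<ltimes> cross s V W (A \<odot> Z)) \<rhd> S"
  unfolding leg_def using assms by (simp_all add: act_cmp whisk_cmp)

text \<open>Together with \<open>leg_past_tensor_left\<close>, this computes the arrow on the first and third strand
  for a comodule of the form \<open>V \<odot> W\<close>. The arrow \<open>w\<close> is disjoint from the crossing of \<open>V\<close> with
  \<open>A\<close>, so that only the crossing of \<open>W\<close> with \<open>A\<close> surrounds it.\<close>

lemma leg_past_tensor_right:
  assumes w: "w \<in> arr C" "src C w = W \<odot> D" "tgt C w = W \<odot> D"
    and obj: "V \<in> obj C" "W \<in> obj C" "A \<in> obj C" "D \<in> obj C" "Z \<in> obj C"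
  shows "(A \<ltimes> V \<ltimes> lift W D W D w Z) \<rhd> cross s V A (W \<odot> D \<odot> Z) \<rhd> (V \<ltimes> cross s W A (D \<odot> Z)) \<rhd> S
    = cross s V A (W \<odot> D \<odot> Z) \<rhd> (V \<ltimes> cross s W A (D \<odot> Z)) \<rhd> (V \<ltimes> leg s W A D w Z) \<rhd> S"
proof -
  have nat: "(A \<ltimes> V \<ltimes> lift W D W D w Z) \<rhd> cross s V A (W \<odot> D \<odot> Z) \<rhd> S
      = cross s V A (W \<odot> D \<odot> Z) \<rhd> (V \<ltimes> A \<ltimes> lift W D W D w Z) \<rhd> S" for S
    using assms by (intro act_natural) auto
  show ?thesis using assms by (simp add: nat act_leg act_whisk_cancel)
qed

text \<open>The Yang-Baxter equation is the sliding of a strand past a crossing. The sign \<open>r\<close> of that crossing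
  is arbitrary, which is what the mixed signs in the tensor product of comodules need.\<close>

lemma act_yang_baxter:
  assumes obj: "V \<in> obj C" "W \<in> obj C" "A \<in> obj C" "Z \<in> obj C"
  shows "(A \<ltimes> cross r V W Z) \<rhd> cross s V A (W \<odot> Z) \<rhd> (V \<ltimes> cross s W A Z) \<rhd> S
    = cross s W A (V \<odot> Z) \<rhd> (W \<ltimes> cross s V A Z) \<rhd> cross r V W (A \<odot> Z) \<rhd> S"
    and "cross s V A (W \<odot> Z) \<rhd> (V \<ltimes> cross s W A Z) \<rhd> cross r W V (A \<odot> Z) \<rhd> S
    = (A \<ltimes> cross r W V Z) \<rhd> cross s W A (V \<odot> Z) \<rhd> (W \<ltimes> cross s V A Z) \<rhd> S"
  using assms by (simp_all add: act_slide_right)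

text \<open>The crossings of \<open>V\<close> and \<open>W\<close> with \<open>A\<close> have equal signs, so that by Yang-Baxter they can be
  moved past those of \<open>V\<close> with \<open>W\<close>. The crossing of \<open>W\<close> with \<open>A\<close> is then disjoint from \<open>v\<close>, and
  only that of \<open>V\<close> with \<open>A\<close> surrounds it.\<close>

lemma leg_past_tensor_left:
  assumes v: "v \<in> arr C" "src C v = V \<odot> D" "tgt C v = V \<odot> D"
    and obj: "V \<in> obj C" "W \<in> obj C" "A \<in> obj C" "D \<in> obj C" "Z \<in> obj C"
  shows "(A \<ltimes> leg r V W D v Z) \<rhd> cross s V A (W \<odot> D \<odot> Z) \<rhd> (V \<ltimes> cross s W A (D \<odot> Z)) \<rhd> S
    = cross s V A (W \<odot> D \<odot> Z) \<rhd> (V \<ltimes> cross s W A (D \<odot> Z))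
      \<rhd> cross (\<not> r) W V (A \<odot> D \<odot> Z) \<rhd> (W \<ltimes> leg s V A D v Z) \<rhd> cross r V W (A \<odot> D \<odot> Z) \<rhd> S"
proof -
  have nat: "(A \<ltimes> W \<ltimes> lift V D V D v Z) \<rhd> cross s W A (V \<odot> D \<odot> Z) \<rhd> S
      = cross s W A (V \<odot> D \<odot> Z) \<rhd> (W \<ltimes> A \<ltimes> lift V D V D v Z) \<rhd> S" for S
    using assms by (intro act_natural) auto
  show ?thesis using assms 
    by (simp add: nat act_leg act_whisk_cancel act_yang_baxter(1)[where V = V and r = r]
        act_yang_baxter(2)[where V = V and r = "\<not> r"])
qed

text \<open>On \<open>V \<odot> W \<odot> A \<odot> D \<odot> Z\<close>, the arrow \<open>w\<close> on \<open>W\<close> and \<open>A\<close> commutes with \<open>v\<close> on \<open>V\<close> and \<open>D\<close>, if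
  \<open>V\<close> crosses both \<open>W\<close> and \<open>A\<close> with the same sign: \<open>w\<close> slides through.\<close>

lemma legs_commute_over:
  assumes v: "v \<in> arr C" "src C v = V \<odot> D" "tgt C v = V \<odot> D"
    and w: "w \<in> arr C" "src C w = W \<odot> A" "tgt C w = W \<odot> A"
    and obj: "V \<in> obj C" "W \<in> obj C" "A \<in> obj C" "D \<in> obj C" "Z \<in> obj C"
  shows "(V \<ltimes> lift W A W A w (D \<odot> Z)) \<rhd> cross (\<not> r) W V (A \<odot> D \<odot> Z)
      \<rhd> (W \<ltimes> leg r V A D v Z) \<rhd> cross r V W (A \<odot> D \<odot> Z) \<rhd> S
    = cross (\<not> r) W V (A \<odot> D \<odot> Z) \<rhd> (W \<ltimes> leg r V A D v Z)
      \<rhd> cross r V W (A \<odot> D \<odot> Z) \<rhd> (V \<ltimes> lift W A W A w (D \<odot> Z)) \<rhd> S"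
proof -
  have nat: "(W \<ltimes> A \<ltimes> lift V D V D v Z) \<rhd> lift W A W A w (V \<odot> D \<odot> Z) \<rhd> S
      = lift W A W A w (V \<odot> D \<odot> Z) \<rhd> (W \<ltimes> A \<ltimes> lift V D V D v Z) \<rhd> S" for S
    using assms by (intro act_natural) auto
  have slide_in: "(W \<ltimes> cross r V A (D \<odot> Z)) \<rhd> cross r V W (A \<odot> D \<odot> Z) \<rhd> (V \<ltimes> lift W A W A w (D \<odot> Z)) \<rhd> S
    = lift W A W A w (V \<odot> D \<odot> Z) \<rhd> (W \<ltimes> cross r V A (D \<odot> Z)) \<rhd> cross r V W (A \<odot> D \<odot> Z) \<rhd> S" for S
    using assms by (intro act_slide_left) auto
  have slide_out: "(V \<ltimes> lift W A W A w (D \<odot> Z)) \<rhd> cross (\<not> r) W V (A \<odot> D \<odot> Z) \<rhd> (W \<ltimes> cross (\<not> r) A V (D \<odot> Z)) \<rhd> S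
    = cross (\<not> r) W V (A \<odot> D \<odot> Z) \<rhd> (W \<ltimes> cross (\<not> r) A V (D \<odot> Z)) \<rhd> lift W A W A w (V \<odot> D \<odot> Z) \<rhd> S" for S
    using assms by (intro act_slide_right[symmetric]) auto
  show ?thesis using assms by (simp add: nat slide_in slide_out act_leg)
qed

text \<open>A strand \<open>W\<close> with both of its crossings on the same side of \<open>v\<close> slides over to the other side.\<close>

lemma leg_slide:
  assumes v: "v \<in> arr C" "src C v = V \<odot> A" "tgt C v = V \<odot> A"
    and obj: "V \<in> obj C" "W \<in> obj C" "A \<in> obj C" "Z \<in> obj C"
  shows "leg r V W A v Z \<rhd> (V \<ltimes> cross r A W Z) \<rhd> S = (V \<ltimes> cross r A W Z) \<rhd> lift V A V A v (W \<odot> Z) \<rhd> S"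
    and "(V \<ltimes> cross (\<not> r) W A Z) \<rhd> leg r V W A v Z \<rhd> S = lift V A V A v (W \<odot> Z) \<rhd> (V \<ltimes> cross (\<not> r) W A Z) \<rhd> S"
proof -
  have "leg r V W A v Z \<rhd> (V \<ltimes> cross r A W Z) \<rhd> S
    = cross (\<not> r) W V (A \<odot> Z) \<rhd> cross r V W (A \<odot> Z) \<rhd> (V \<ltimes> cross r A W Z) \<rhd> lift V A V A v (W \<odot> Z) \<rhd> S"
    using assms by (simp add: act_leg act_slide_right)
  also have "\<dots> = (V \<ltimes> cross r A W Z) \<rhd> lift V A V A v (W \<odot> Z) \<rhd> S"
    using assms by (simp add: act_cancel)
  finally show "leg r V W A v Z \<rhd> (V \<ltimes> cross r A W Z) \<rhd> S = (V \<ltimes> cross r A W Z) \<rhd> lift V A V A v (W \<odot> Z) \<rhd> S" .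
  have "(V \<ltimes> cross (\<not> r) W A Z) \<rhd> leg r V W A v Z \<rhd> S
    = lift V A V A v (W \<odot> Z) \<rhd> (V \<ltimes> cross (\<not> r) W A Z) \<rhd> cross (\<not> r) W V (A \<odot> Z) \<rhd> cross r V W (A \<odot> Z) \<rhd> S"
    using assms by (simp add: act_leg act_slide_left)
  also have "\<dots> = lift V A V A v (W \<odot> Z) \<rhd> (V \<ltimes> cross (\<not> r) W A Z) \<rhd> S"
    using assms by (simp add: act_cancel_last)
  finally show "(V \<ltimes> cross (\<not> r) W A Z) \<rhd> leg r V W A v Z \<rhd> S = lift V A V A v (W \<odot> Z) \<rhd> (V \<ltimes> cross (\<not> r) W A Z) \<rhd> S" .
qed

text \<open>On \<open>V \<odot> W \<odot> A \<odot> D \<odot> Z\<close>, the arrow \<open>v\<close> on \<open>V\<close> and \<open>A\<close> commutes with \<open>w\<close> on \<open>W\<close> and \<open>D\<close>,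
  if the two detours have opposite signs: then \<open>W\<close> lies on the same side of both \<open>V\<close> and \<open>A\<close>, and
  sliding it away turns \<open>v\<close> into an arrow on adjacent strands, disjoint from those of \<open>w\<close>.\<close>

lemma legs_commute_under:
  assumes v: "v \<in> arr C" "src C v = V \<odot> A" "tgt C v = V \<odot> A"
    and w: "w \<in> arr C" "src C w = W \<odot> D" "tgt C w = W \<odot> D"
    and obj: "V \<in> obj C" "W \<in> obj C" "A \<in> obj C" "D \<in> obj C" "Z \<in> obj C"
  shows "leg r V W A v (D \<odot> Z) \<rhd> (V \<ltimes> leg (\<not> r) W A D w Z) \<rhd> S
    = (V \<ltimes> leg (\<not> r) W A D w Z) \<rhd> leg r V W A v (D \<odot> Z) \<rhd> S"
proof -
  have nat: "(V \<ltimes> A \<ltimes> lift W D W D w Z) \<rhd> lift V A V A v (W \<odot> D \<odot> Z) \<rhd> S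
      = lift V A V A v (W \<odot> D \<odot> Z) \<rhd> (V \<ltimes> A \<ltimes> lift W D W D w Z) \<rhd> S" for S
    using assms by (intro act_natural) auto
  show ?thesis using assms by (simp add: nat act_leg(2) leg_slide)
qed

end

section \<open>Comodule axioms in right-bracketed form\<close>

lemma bar_simps [simp]:
  "obj (bar C) = obj C" "arr (bar C) = arr C" "src (bar C) = src C" "tgt (bar C) = tgt C"
  "ident (bar C) = ident C" "cmp (bar C) = cmp C" "tens_obj (bar C) = tens_obj C"
  "tens_arr (bar C) = tens_arr C" "unit_obj (bar C) = unit_obj C"
  "associator (bar C) = associator C" "left_unitor (bar C) = left_unitor C"
  "braiding (bar C) X Y = arr_inv C (braiding C Y X)"
  by (simp_all add: bar_def)

lemma bar_derived [simp]:
  "hom (bar C) = hom C" "arr_inv (bar C) = arr_inv C" "on_right (bar C) = on_right C"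
  "mult (bar C) = mult C"
  by (simp_all add: hom_def arr_inv_def inverse_arrs_def on_right_def mult_def fun_eq_iff)

context monoidal_category
begin

lemma lift_eq_iff:
  assumes "f \<in> arr C" "src C f = X \<odot> Y" "tgt C f = X' \<odot> Y'"
    and "g \<in> arr C" "src C g = X \<odot> Y" "tgt C g = X' \<odot> Y'"
    and "X \<in> obj C" "Y \<in> obj C" "X' \<in> obj C" "Y' \<in> obj C"
  shows "f = g \<longleftrightarrow> (\<forall>Z \<in> obj C. lift X Y X' Y' f Z = lift X Y X' Y' g Z)"
  using lift_inject[of X Y X' Y' f g] assms by auto

lemma lift3_eq_iff:
  assumes "f \<in> arr C" "src C f = (X \<odot> Y) \<odot> Z" "tgt C f = (X' \<odot> Y') \<odot> Z'"
    and "g \<in> arr C" "src C g = (X \<odot> Y) \<odot> Z" "tgt C g = (X' \<odot> Y') \<odot> Z'"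
    and "X \<in> obj C" "Y \<in> obj C" "Z \<in> obj C" "X' \<in> obj C" "Y' \<in> obj C" "Z' \<in> obj C"
  shows "f = g \<longleftrightarrow> (\<forall>W \<in> obj C. lift3 X Y Z X' Y' Z' f W = lift3 X Y Z X' Y' Z' g W)"
  using lift3_inject[of X Y Z X' Y' Z' f g] assms by auto

text \<open>The right-bracketed form \<open>A \<odot> A \<odot> Z \<rightarrow> A \<odot> Z\<close> of a multiplication.\<close>

definition lift_mult :: "'o \<Rightarrow> 'a \<Rightarrow> 'o \<Rightarrow> 'a"
  where "lift_mult A m Z = (m \<rtimes> Z) \<cdot> Inv[\<a>[A, A, Z]]"

lemma lift_mult_arr [simp]:
  assumes "m \<in> arr C" "src C m = A \<odot> A" "tgt C m = A" "A \<in> obj C" "Z \<in> obj C"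
  shows "lift_mult A m Z \<in> arr C" "src C (lift_mult A m Z) = A \<odot> A \<odot> Z"
    "tgt C (lift_mult A m Z) = A \<odot> Z"
  unfolding lift_mult_def using assms by simp_all

lemma lift_whisk_mult:
  assumes "m \<in> arr C" "src C m = A \<odot> A" "tgt C m = A" "V \<in> obj C" "A \<in> obj C" "Z \<in> obj C"
  shows "lift (V \<odot> A) A V A ((V \<ltimes> m) \<cdot> \<a>[V, A, A]) Z = (V \<ltimes> lift_mult A m Z) \<cdot> \<a>[V, A, A \<odot> Z]"
proof -
  have "lift (V \<odot> A) A V A ((V \<ltimes> m) \<cdot> \<a>[V, A, A]) Z \<cdot> Inv[\<a>[V, A, A \<odot> Z]]
    = \<a>[V, A, Z] \<cdot> ((V \<ltimes> m) \<rtimes> Z) \<cdot> (\<a>[V, A, A] \<rtimes> Z) \<cdot> Inv[assoc3 V A A Z]"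
    unfolding lift_def assoc3_def using assms by (simp add: whisk_cmp iso_cmp cmp_assoc_arr)
  also have "\<dots> = (\<a>[V, A, Z] \<cdot> ((V \<ltimes> m) \<rtimes> Z)) \<cdot> Inv[\<a>[V, A \<odot> A, Z]] \<cdot> (V \<ltimes> Inv[\<a>[A, A, Z]])"
    unfolding assoc3_pentagon[OF assms(4,5,5,6)] using assms by (simp add: iso_cmp iso_tens cmp_assoc_arr)
  also have "\<dots> = V \<ltimes> lift_mult A m Z"
    unfolding lift_mult_def using assms by (simp add: assoc_nat whisk_cmp cmp_assoc_arr)
  finally have "lift (V \<odot> A) A V A ((V \<ltimes> m) \<cdot> \<a>[V, A, A]) Z \<cdot> Inv[\<a>[V, A, A \<odot> Z]] = V \<ltimes> lift_mult A m Z" .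
  then show ?thesis
    by (intro iso_cancel_right[of "Inv[\<a>[V, A, A \<odot> Z]]" "lift (V \<odot> A) A V A ((V \<ltimes> m) \<cdot> \<a>[V, A, A]) Z"])
      (use assms in \<open>simp_all add: cmp_assoc_arr\<close>)
qed

end

text \<open>The arrows of a regular multiplier bimonoid that enter the definition of its comodules.\<close>

locale comodule_data = braided_monoidal_category C
  for C :: "('o, 'a) braided_monoidal_category" (structure) +
  fixes A :: 'o and t1 t3 e :: 'a
  assumes A_obj [simp]: "A \<in> obj C"
    and t1_arr [simp]: "t1 \<in> arr C" "src C t1 = A \<odot> A" "tgt C t1 = A \<odot> A"
    and t3_arr [simp]: "t3 \<in> arr C" "src C t3 = A \<odot> A" "tgt C t3 = A \<odot> A"
    and e_arr [simp]: "e \<in> arr C" "src C e = A" "tgt C e = \<I>"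
begin

abbreviation endo :: "'o \<Rightarrow> 'a \<Rightarrow> 'o \<Rightarrow> 'a"
  where "endo V v Z \<equiv> lift V A V A v Z"

definition endo_arr :: "'o \<Rightarrow> 'a \<Rightarrow> bool"
  where "endo_arr V v \<longleftrightarrow> V \<in> obj C \<and> v \<in> hom C (V \<odot> A) (V \<odot> A)"

lemma endo_arrD:
  "endo_arr V v \<Longrightarrow> V \<in> obj C" "endo_arr V v \<Longrightarrow> v \<in> arr C"
  "endo_arr V v \<Longrightarrow> src C v = V \<odot> A" "endo_arr V v \<Longrightarrow> tgt C v = V \<odot> A"
  by (simp_all add: endo_arr_def in_hom)

text \<open>The axioms of a comodule over \<open>(t, e)\<close> in right-bracketed form, for \<open>C\<close> if the sign is
  \<open>True\<close> and for \<^term>\<open>bar C\<close> if it is \<open>False\<close>.\<close>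

definition coaction :: "bool \<Rightarrow> 'a \<Rightarrow> 'o \<Rightarrow> 'a \<Rightarrow> bool"
  where "coaction s t V v \<longleftrightarrow> endo_arr V v \<and>
    (\<forall>Z \<in> obj C. endo V v (A \<odot> Z) \<cdot> leg s V A A v Z \<cdot> (V \<ltimes> endo A t Z)
      = (V \<ltimes> endo A t Z) \<cdot> endo V v (A \<odot> Z)) \<and>
    (\<forall>Z \<in> obj C. (V \<ltimes> e \<rtimes> Z) \<cdot> endo V v Z = V \<ltimes> e \<rtimes> Z)"

abbreviation "m \<equiv> mult C A t1 e"

lemma m_arr [simp]: "m \<in> arr C" "src C m = A \<odot> A" "tgt C m = A"
  by (simp_all add: mult_def)

definition compatible :: "'o \<Rightarrow> 'a \<Rightarrow> 'a \<Rightarrow> bool"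
  where "compatible V v1 v3 \<longleftrightarrow> (\<forall>Z \<in> obj C.
    (V \<ltimes> lift_mult A m Z) \<cdot> cross True A V (A \<odot> Z) \<cdot> (A \<ltimes> endo V v1 Z)
      = (V \<ltimes> lift_mult A m Z) \<cdot> endo V v3 (A \<odot> Z) \<cdot> cross True A V (A \<odot> Z))"

text \<open>Both sides are lifted by \<^const>\<open>lift3\<close>, which is functorial and faithful. The three arrows in
  the middle of the left hand side become a \<^const>\<open>leg\<close>.\<close>

lemma fusion_iff:
  assumes v: "endo_arr V v" and t [simp]: "t \<in> arr C" "src C t = A \<odot> A" "tgt C t = A \<odot> A"
  shows "(v \<rtimes> A) \<cdot> (braid (\<not> s) A V \<rtimes> A) \<cdot> on_right C A V A v
        \<cdot> (braid s V A \<rtimes> A) \<cdot> on_right C V A A t = on_right C V A A t \<cdot> (v \<rtimes> A)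
    \<longleftrightarrow> (\<forall>Z \<in> obj C. endo V v (A \<odot> Z) \<cdot> leg s V A A v Z \<cdot> (V \<ltimes> endo A t Z)
      = (V \<ltimes> endo A t Z) \<cdot> endo V v (A \<odot> Z))" (is "?l = ?r \<longleftrightarrow> _")
proof -
  note [simp] = endo_arrD[OF v]
  let ?L = "lift3 V A A V A A"
  have l: "?L ?l Z = endo V v (A \<odot> Z) \<cdot> leg s V A A v Z \<cdot> (V \<ltimes> endo A t Z)" if [simp]: "Z \<in> obj C" for Z
    by (simp add: lift3_cmp[where X' = V and Y' = A and Z' = A]
        lift3_cmp[where X' = A and Y' = V and Z' = A]
        lift3_rwhisk lift3_on_right leg_def cmp_assoc_arr)
  have r: "?L ?r Z = (V \<ltimes> endo A t Z) \<cdot> endo V v (A \<odot> Z)" if [simp]: "Z \<in> obj C" for Z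
    by (simp add: lift3_cmp[where X' = V and Y' = A and Z' = A] lift3_rwhisk lift3_on_right)
  have "?l = ?r \<longleftrightarrow> (\<forall>Z \<in> obj C. ?L ?l Z = ?L ?r Z)"
    by (rule lift3_eq_iff) simp_all
  then show ?thesis by (simp add: l r)
qed

lemma counit_iff:
  assumes v: "endo_arr V v"
  shows "(V \<ltimes> e) \<cdot> v = V \<ltimes> e \<longleftrightarrow> (\<forall>Z \<in> obj C. (V \<ltimes> e \<rtimes> Z) \<cdot> endo V v Z = V \<ltimes> e \<rtimes> Z)"
proof -
  note [simp] = endo_arrD[OF v]
  have "(V \<ltimes> e) \<cdot> v = V \<ltimes> e
    \<longleftrightarrow> (\<forall>Z \<in> obj C. lift V A V \<I> ((V \<ltimes> e) \<cdot> v) Z = lift V A V \<I> (V \<ltimes> e) Z)"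
    by (rule lift_eq_iff) simp_all
  then show ?thesis by (simp add: lift_cmp[where X' = V and Y' = A] lift_tens)
qed

lemma fusion_comodule_iff:
  assumes [simp]: "t \<in> arr C" "src C t = A \<odot> A" "tgt C t = A \<odot> A"
  shows "fusion_comodule C A t e V v \<longleftrightarrow> coaction True t V v"
    and "fusion_comodule (bar C) A t e V v \<longleftrightarrow> coaction False t V v"
proof -
  show "fusion_comodule C A t e V v \<longleftrightarrow> coaction True t V v"
  proof (cases "endo_arr V v")
    case True
    then have [simp]: "V \<in> obj C" by (rule endo_arrD)
    show ?thesis
      using fusion_iff[OF True assms, of True] counit_iff[OF True] True
      by (simp add: fusion_comodule_def coaction_def braid_def endo_arr_def)
  qed (auto simp: fusion_comodule_def coaction_def endo_arr_def)
  show "fusion_comodule (bar C) A t e V v \<longleftrightarrow> coaction False t V v"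
  proof (cases "endo_arr V v")
    case True
    then have [simp]: "V \<in> obj C" by (rule endo_arrD)
    show ?thesis
      using fusion_iff[OF True assms, of False] counit_iff[OF True] True
      by (simp add: fusion_comodule_def coaction_def braid_def endo_arr_def)
  qed (auto simp: fusion_comodule_def coaction_def endo_arr_def)
qed

text \<open>The target has only two factors. So the equation is lifted with \<open>A \<odot> V\<close> as a single factor, and
  the remaining associator at the source cancels.\<close>

lemma compatible_iff:
  assumes v: "endo_arr V v1" "endo_arr V v3"
  shows "(V \<ltimes> m) \<cdot> \<a>[V, A, A] \<cdot> (\<b>[A, V] \<rtimes> A) \<cdot> on_right C A V A v1
      = (V \<ltimes> m) \<cdot> \<a>[V, A, A] \<cdot> (v3 \<rtimes> A) \<cdot> (\<b>[A, V] \<rtimes> A) \<longleftrightarrow> compatible V v1 v3" (is "?l = ?r \<longleftrightarrow> _")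
proof -
  note [simp] = endo_arrD[OF v(1)] endo_arrD[OF v(2)]
  let ?L = "lift (A \<odot> V) A V A"
  have push: "?L ((V \<ltimes> m) \<cdot> \<a>[V, A, A] \<cdot> f) Z
    = (V \<ltimes> lift_mult A m Z) \<cdot> lift3 A V A V A A f Z \<cdot> \<a>[A, V, A \<odot> Z]"
    if [simp]: "f \<in> arr C" "src C f = (A \<odot> V) \<odot> A" "tgt C f = (V \<odot> A) \<odot> A" "Z \<in> obj C" for f Z
  proof -
    have "?L ((V \<ltimes> m) \<cdot> \<a>[V, A, A] \<cdot> f) Z = ?L (((V \<ltimes> m) \<cdot> \<a>[V, A, A]) \<cdot> f) Z"
      by (simp add: cmp_assoc_arr)
    also have "\<dots> = (V \<ltimes> lift_mult A m Z) \<cdot> \<a>[V, A, A \<odot> Z] \<cdot> lift (A \<odot> V) A (V \<odot> A) A f Z"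
      by (subst lift_cmp[where X' = "V \<odot> A" and Y' = A]) (simp_all add: lift_whisk_mult cmp_assoc_arr)
    finally show ?thesis by (simp add: lift3_eq_lift cmp_assoc_arr)
  qed
  have l: "?L ?l Z = ((V \<ltimes> lift_mult A m Z) \<cdot> cross True A V (A \<odot> Z) \<cdot> (A \<ltimes> endo V v1 Z)) \<cdot> \<a>[A, V, A \<odot> Z]"
    if [simp]: "Z \<in> obj C" for Z
    by (simp add: push lift3_cmp[where X' = A and Y' = V and Z' = A] lift3_rwhisk lift3_on_right
        cmp_assoc_arr braid_def)
  have r: "?L ?r Z = ((V \<ltimes> lift_mult A m Z) \<cdot> endo V v3 (A \<odot> Z) \<cdot> cross True A V (A \<odot> Z)) \<cdot> \<a>[A, V, A \<odot> Z]"
    if [simp]: "Z \<in> obj C" for Z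
    by (simp add: push lift3_cmp[where X' = V and Y' = A and Z' = A] lift3_rwhisk
        cmp_assoc_arr braid_def)
  have "?l = ?r \<longleftrightarrow> (\<forall>Z \<in> obj C. ?L ?l Z = ?L ?r Z)"
    by (rule lift_eq_iff) simp_all
  also have "\<dots> \<longleftrightarrow> compatible V v1 v3"
    unfolding compatible_def
    by (intro ball_cong refl, unfold l r) (auto dest: iso_cancel_right[rotated])
  finally show ?thesis .
qed

lemma comodule_iff:
  "comodule C A t1 t3 e V v1 v3 \<longleftrightarrow> coaction True t1 V v1 \<and> coaction False t3 V v3 \<and> compatible V v1 v3"
proof -
  have *: "comodule C A t1 t3 e V v1 v3 \<longleftrightarrow> coaction True t1 V v1 \<and> coaction False t3 V v3 \<and>
    (V \<ltimes> m) \<cdot> \<a>[V, A, A] \<cdot> (\<b>[A, V] \<rtimes> A) \<cdot> on_right C A V A v1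
      = (V \<ltimes> m) \<cdot> \<a>[V, A, A] \<cdot> (v3 \<rtimes> A) \<cdot> (\<b>[A, V] \<rtimes> A)"
    by (simp add: comodule_def fusion_comodule_iff)
  show ?thesis
  proof (cases "endo_arr V v1 \<and> endo_arr V v3")
    case True
    then show ?thesis unfolding * using compatible_iff[of V v1 v3] by simp
  next
    case False
    then show ?thesis unfolding * by (auto simp: coaction_def)
  qed
qed

end

section \<open>The tensor product of two coactions\<close>

context comodule_data
begin

text \<open>The arrow \<open>v\<close> on the first and third factor of \<open>(V \<odot> W) \<odot> A\<close>, in left-bracketed form.\<close>

definition far :: "'o \<Rightarrow> 'a \<Rightarrow> 'o \<Rightarrow> 'a"
  where "far V v W = (Inv[\<b>[V, W]] \<rtimes> A) \<cdot> on_right C W V A v \<cdot> (\<b>[V, W] \<rtimes> A)"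

text \<open>If \<open>v\<close> and \<open>w\<close> are \<open>x \<otimes> a \<mapsto> x\<^sub>0 \<otimes> x\<^sub>1 a\<close>, then this is
  \<open>x \<otimes> y \<otimes> a \<mapsto> x\<^sub>0 \<otimes> y\<^sub>0 \<otimes> x\<^sub>1 y\<^sub>1 a\<close>. So \<open>w\<close> comes first.\<close>

definition tens1 :: "'o \<Rightarrow> 'a \<Rightarrow> 'o \<Rightarrow> 'a \<Rightarrow> 'a"
  where "tens1 V v W w = far V v W \<cdot> on_right C V W A w"

text \<open>If \<open>v\<close> and \<open>w\<close> are \<open>x \<otimes> a \<mapsto> x\<^sub>0 \<otimes> a x\<^sub>1\<close>, then this is
  \<open>x \<otimes> y \<otimes> a \<mapsto> x\<^sub>0 \<otimes> y\<^sub>0 \<otimes> a x\<^sub>1 y\<^sub>1\<close>. So \<open>v\<close> comes first. The crossing of \<open>V\<close> with \<open>W\<close> is the same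
  as in \<open>tens1\<close>, although the fusion equation for \<open>v\<close> now lives in \<^term>\<open>bar C\<close>.\<close>

definition tens3 :: "'o \<Rightarrow> 'a \<Rightarrow> 'o \<Rightarrow> 'a \<Rightarrow> 'a"
  where "tens3 V v W w = on_right C V W A w \<cdot> far V v W"

lemma endo_arr_tens:
  assumes "endo_arr V v" "endo_arr W w"
  shows "endo_arr (V \<odot> W) (tens1 V v W w)" "endo_arr (V \<odot> W) (tens3 V v W w)"
  using endo_arrD[OF assms(1)] endo_arrD[OF assms(2)]
  by (simp_all add: endo_arr_def in_hom tens1_def tens3_def far_def)

lemma lift3_far:
  assumes "endo_arr V v" and [simp]: "W \<in> obj C" "Z \<in> obj C"
  shows "lift3 V W A V W A (far V v W) Z = leg True V W A v Z"
proof -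
  note [simp] = endo_arrD[OF assms(1)]
  show ?thesis unfolding far_def
    by (simp add: lift3_cmp[where X' = W and Y' = V and Z' = A] lift3_rwhisk lift3_on_right leg_def braid_def)
qed

lemma lift3_tens:
  assumes v: "endo_arr V v" and w: "endo_arr W w" and [simp]: "Z \<in> obj C"
  shows "lift3 V W A V W A (tens1 V v W w) Z = leg True V W A v Z \<cdot> (V \<ltimes> endo W w Z)"
    and "lift3 V W A V W A (tens3 V v W w) Z = (V \<ltimes> endo W w Z) \<cdot> leg True V W A v Z"
proof -
  note [simp] = endo_arrD[OF v] endo_arrD[OF w]
  have [simp]: "far V v W \<in> arr C" "src C (far V v W) = (V \<odot> W) \<odot> A" "tgt C (far V v W) = (V \<odot> W) \<odot> A"
    by (simp_all add: far_def)
  show "lift3 V W A V W A (tens1 V v W w) Z = leg True V W A v Z \<cdot> (V \<ltimes> endo W w Z)"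
    "lift3 V W A V W A (tens3 V v W w) Z = (V \<ltimes> endo W w Z) \<cdot> leg True V W A v Z"
    by (simp_all add: tens1_def tens3_def lift3_cmp[where X' = V and Y' = W and Z' = A]
        lift3_far[OF v] lift3_on_right)
qed

text \<open>This and the next two lemmas move the associator \<open>(V \<odot> W) \<odot> Z \<rightarrow> V \<odot> W \<odot> Z\<close> through a composite.
  An equation in which \<open>V \<odot> W\<close> is a single factor thereby becomes one with separate
  strands \<open>V\<close> and \<open>W\<close>.\<close>

lemma act_assoc_endo:
  assumes u: "endo_arr (V \<odot> W) u" and [simp]: "V \<in> obj C" "W \<in> obj C" "Z \<in> obj C"
  shows "\<a>[V, W, A \<odot> Z] \<rhd> endo (V \<odot> W) u Z \<rhd> S
      = lift3 V W A V W A u Z \<rhd> \<a>[V, W, A \<odot> Z] \<rhd> S"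
    and "X \<in> obj C \<Longrightarrow> (X \<ltimes> \<a>[V, W, A \<odot> Z]) \<rhd> (X \<ltimes> endo (V \<odot> W) u Z) \<rhd> S
      = (X \<ltimes> lift3 V W A V W A u Z) \<rhd> (X \<ltimes> \<a>[V, W, A \<odot> Z]) \<rhd> S"
proof -
  note [simp] = endo_arrD[OF u]
  have "\<a>[V, W, A \<odot> Z] \<cdot> endo (V \<odot> W) u Z = lift3 V W A V W A u Z \<cdot> \<a>[V, W, A \<odot> Z]"
    by (simp add: lift3_eq_lift cmp_assoc_arr)
  then show "\<a>[V, W, A \<odot> Z] \<rhd> endo (V \<odot> W) u Z \<rhd> S
      = lift3 V W A V W A u Z \<rhd> \<a>[V, W, A \<odot> Z] \<rhd> S"
    "X \<in> obj C \<Longrightarrow> (X \<ltimes> \<a>[V, W, A \<odot> Z]) \<rhd> (X \<ltimes> endo (V \<odot> W) u Z) \<rhd> S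
      = (X \<ltimes> lift3 V W A V W A u Z) \<rhd> (X \<ltimes> \<a>[V, W, A \<odot> Z]) \<rhd> S"
    by (simp_all flip: act_cmp whisk_cmp)
qed

lemma act_assoc_cross:
  assumes "X \<in> obj C" "Y \<in> obj C" "U \<in> obj C" "Z \<in> obj C"
  shows "\<a>[X, Y, U \<odot> Z] \<rhd> cross s U (X \<odot> Y) Z \<rhd> S
      = (X \<ltimes> cross s U Y Z) \<rhd> cross s U X (Y \<odot> Z) \<rhd> (U \<ltimes> \<a>[X, Y, Z]) \<rhd> S"
    and "(U \<ltimes> \<a>[X, Y, Z]) \<rhd> cross s (X \<odot> Y) U Z \<rhd> S
      = cross s X U (Y \<odot> Z) \<rhd> (X \<ltimes> cross s Y U Z) \<rhd> \<a>[X, Y, U \<odot> Z] \<rhd> S"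
  using assoc_cross_tens[OF assms, of s] assms by (simp_all flip: act_cmp)

lemma act_assoc_natural:
  assumes "X \<in> obj C" "Y \<in> obj C" "h \<in> arr C" "src C h = Z" "tgt C h = Z'"
  shows "\<a>[X, Y, Z'] \<rhd> ((X \<odot> Y) \<ltimes> h) \<rhd> S = (X \<ltimes> Y \<ltimes> h) \<rhd> \<a>[X, Y, Z] \<rhd> S"
proof -
  have "Z \<in> obj C" "Z' \<in> obj C" using assms by auto
  then show ?thesis
    using assoc_nat[of "ident C X" "ident C Y" h X Y Z'] assms by (simp flip: act_cmp)
qed

lemma coactionD:
  assumes "coaction s t V v"
  shows "endo_arr V v" "V \<in> obj C" "v \<in> arr C" "src C v = V \<odot> A" "tgt C v = V \<odot> A"
  using assms by (auto simp: coaction_def dest: endo_arrD)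

lemma act_fusion:
  assumes v: "coaction s t V v" and [simp]: "t \<in> arr C" "src C t = A \<odot> A" "tgt C t = A \<odot> A"
    and [simp]: "Z \<in> obj C" "W \<in> obj C"
  shows "(W \<ltimes> endo V v (A \<odot> Z)) \<rhd> (W \<ltimes> leg s V A A v Z) \<rhd> (W \<ltimes> V \<ltimes> endo A t Z) \<rhd> S
    = (W \<ltimes> V \<ltimes> endo A t Z) \<rhd> (W \<ltimes> endo V v (A \<odot> Z)) \<rhd> S"
proof -
  note [simp] = coactionD[OF v]
  have "endo V v (A \<odot> Z) \<cdot> leg s V A A v Z \<cdot> (V \<ltimes> endo A t Z) = (V \<ltimes> endo A t Z) \<cdot> endo V v (A \<odot> Z)"
    using v by (simp add: coaction_def)
  then show ?thesis
    by (simp flip: act_cmp whisk_cmp)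
qed

lemma act_counit:
  assumes v: "coaction s t V v" and [simp]: "Z \<in> obj C" "W \<in> obj C"
  shows "(W \<ltimes> V \<ltimes> e \<rtimes> Z) \<rhd> (W \<ltimes> endo V v Z) \<rhd> S = (W \<ltimes> V \<ltimes> e \<rtimes> Z) \<rhd> S"
proof -
  note [simp] = coactionD[OF v]
  have "(V \<ltimes> e \<rtimes> Z) \<cdot> endo V v Z = V \<ltimes> e \<rtimes> Z"
    using v by (simp add: coaction_def)
  then show ?thesis
    by (simp flip: act_cmp whisk_cmp)
qed

lemma counit_leg:
  assumes v: "coaction s t V v" and [simp]: "Z \<in> obj C" "W \<in> obj C"
  shows "(V \<ltimes> W \<ltimes> e \<rtimes> Z) \<rhd> leg r V W A v Z \<rhd> S = (V \<ltimes> W \<ltimes> e \<rtimes> Z) \<rhd> S"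
proof -
  note [simp] = coactionD[OF v]
  have nat: "(Y \<ltimes> X \<ltimes> e \<rtimes> Z) \<rhd> cross q X Y (A \<odot> Z) \<rhd> S = cross q X Y (\<I> \<odot> Z) \<rhd> (X \<ltimes> Y \<ltimes> e \<rtimes> Z) \<rhd> S"
    if "X \<in> obj C" "Y \<in> obj C" for X Y q S
    using that by (intro act_natural) auto
  show ?thesis
    by (simp add: act_leg nat act_counit[OF v] act_cancel)
qed

lemma act_tens:
  assumes v: "endo_arr V v" and w: "endo_arr W w" and [simp]: "Z \<in> obj C"
  shows "lift3 V W A V W A (tens1 V v W w) Z \<rhd> S = leg True V W A v Z \<rhd> (V \<ltimes> endo W w Z) \<rhd> S"
    and "lift3 V W A V W A (tens3 V v W w) Z \<rhd> S = (V \<ltimes> endo W w Z) \<rhd> leg True V W A v Z \<rhd> S"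
    and "X \<in> obj C \<Longrightarrow> (X \<ltimes> lift3 V W A V W A (tens1 V v W w) Z) \<rhd> S
      = (X \<ltimes> leg True V W A v Z) \<rhd> (X \<ltimes> V \<ltimes> endo W w Z) \<rhd> S"
    and "X \<in> obj C \<Longrightarrow> (X \<ltimes> lift3 V W A V W A (tens3 V v W w) Z) \<rhd> S
      = (X \<ltimes> V \<ltimes> endo W w Z) \<rhd> (X \<ltimes> leg True V W A v Z) \<rhd> S"
  using endo_arrD[OF v] endo_arrD[OF w] by (simp_all add: lift3_tens[OF v w] act_cmp whisk_cmp)

text \<open>The fusion equation of \<open>v\<close> under a crossing with a spectator \<open>W\<close>: the crossings between the two
  occurrences of \<open>v\<close> cancel, and \<open>t\<close> commutes with the remaining ones.\<close>

lemma leg_fusion: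
  assumes v: "coaction s t V v" and [simp]: "t \<in> arr C" "src C t = A \<odot> A" "tgt C t = A \<odot> A"
    and [simp]: "Z \<in> obj C" "W \<in> obj C"
  shows "leg r V W A v (A \<odot> Z) \<rhd> cross (\<not> r) W V (A \<odot> A \<odot> Z) \<rhd> (W \<ltimes> leg s V A A v Z)
      \<rhd> cross r V W (A \<odot> A \<odot> Z) \<rhd> (V \<ltimes> W \<ltimes> endo A t Z) \<rhd> S
    = (V \<ltimes> W \<ltimes> endo A t Z) \<rhd> leg r V W A v (A \<odot> Z) \<rhd> S"
proof -
  note [simp] = coactionD[OF v]
  have nat: "cross q X Y (A \<odot> A \<odot> Z) \<rhd> (X \<ltimes> Y \<ltimes> endo A t Z) \<rhd> S = (Y \<ltimes> X \<ltimes> endo A t Z) \<rhd> cross q X Y (A \<odot> A \<odot> Z) \<rhd> S"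
    if "X \<in> obj C" "Y \<in> obj C" for X Y q S
    using that by (intro act_natural[symmetric]) auto
  show ?thesis
    by (simp add: act_leg(1) nat act_cancel act_fusion[OF v])
qed

text \<open>The axioms for a coaction on \<open>V \<odot> W\<close>, with \<open>V\<close> and \<open>W\<close> as separate strands.\<close>

lemma coaction_tensI:
  assumes u: "endo_arr (V \<odot> W) u" and [simp]: "V \<in> obj C" "W \<in> obj C"
    and [simp]: "t \<in> arr C" "src C t = A \<odot> A" "tgt C t = A \<odot> A"
    and fus: "\<And>Z S. Z \<in> obj C \<Longrightarrow> lift3 V W A V W A u (A \<odot> Z) \<rhd> (V \<ltimes> cross (\<not> s) A W (A \<odot> Z))
      \<rhd> cross (\<not> s) A V (W \<odot> A \<odot> Z) \<rhd> (A \<ltimes> lift3 V W A V W A u Z)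
      \<rhd> cross s V A (W \<odot> A \<odot> Z) \<rhd> (V \<ltimes> cross s W A (A \<odot> Z)) \<rhd> (V \<ltimes> W \<ltimes> endo A t Z) \<rhd> S
      = (V \<ltimes> W \<ltimes> endo A t Z) \<rhd> lift3 V W A V W A u (A \<odot> Z) \<rhd> S"
    and counit: "\<And>Z S. Z \<in> obj C \<Longrightarrow>
      (V \<ltimes> W \<ltimes> e \<rtimes> Z) \<rhd> lift3 V W A V W A u Z \<rhd> S = (V \<ltimes> W \<ltimes> e \<rtimes> Z) \<rhd> S"
  shows "coaction s t (V \<odot> W) u"
proof -
  note [simp] = endo_arrD[OF u]
  have "endo (V \<odot> W) u (A \<odot> Z) \<cdot> leg s (V \<odot> W) A A u Z \<cdot> ((V \<odot> W) \<ltimes> endo A t Z)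
      = ((V \<odot> W) \<ltimes> endo A t Z) \<cdot> endo (V \<odot> W) u (A \<odot> Z)" (is "?l = ?r") if [simp]: "Z \<in> obj C" for Z
  proof (rule iso_cancel_left)
    show "\<a>[V, W, A \<odot> A \<odot> Z] \<cdot> ?l = \<a>[V, W, A \<odot> A \<odot> Z] \<cdot> ?r"
      by (rule act_eqI)
        (simp_all add: act_cmp act_leg(1) act_assoc_endo[OF u] act_assoc_cross act_assoc_natural fus)
  qed simp_all
  moreover have "((V \<odot> W) \<ltimes> e \<rtimes> Z) \<cdot> endo (V \<odot> W) u Z = (V \<odot> W) \<ltimes> e \<rtimes> Z" (is "?l = ?r") if [simp]: "Z \<in> obj C" for Z
  proof (rule iso_cancel_left)
    show "\<a>[V, W, \<I> \<odot> Z] \<cdot> ?l = \<a>[V, W, \<I> \<odot> Z] \<cdot> ?r"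
      by (rule act_eqI)
        (simp_all add: act_cmp act_assoc_endo[OF u] act_assoc_natural counit)
  qed simp_all
  ultimately show ?thesis by (simp add: coaction_def u)
qed

text \<open>With subscripts for the positions of \<open>V\<close> or \<open>W\<close> and of one of two copies \<open>1, 2\<close> of \<open>A\<close>, the left
  hand side of the fusion equation is \<open>v\<^sub>1 w\<^sub>1 v\<^sub>2 w\<^sub>2 t\<close>. Here \<open>w\<^sub>1\<close> commutes with \<open>v\<^sub>2\<close>, as \<open>V\<close> passes
  \<open>W\<close> and the first copy of \<open>A\<close> on the same side, and the fusion equations of \<open>w\<close> and
  \<open>v\<close> give \<open>t v\<^sub>1 w\<^sub>1\<close>.\<close>

lemma coaction_tens1:
  assumes v: "coaction True t V v" and w: "coaction True t W w"
    and [simp]: "t \<in> arr C" "src C t = A \<odot> A" "tgt C t = A \<odot> A"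
  shows "coaction True t (V \<odot> W) (tens1 V v W w)"
proof -
  note [simp] = coactionD[OF v] coactionD[OF w]
  note tens = act_tens[OF coactionD(1)[OF v] coactionD(1)[OF w]]
  show ?thesis
  proof (rule coaction_tensI)
    fix Z S assume [simp]: "Z \<in> obj C"
    let ?U = "\<lambda>Z. lift3 V W A V W A (tens1 V v W w) Z"
    have "?U (A \<odot> Z) \<rhd> (V \<ltimes> cross (\<not> True) A W (A \<odot> Z)) \<rhd> cross (\<not> True) A V (W \<odot> A \<odot> Z) \<rhd> (A \<ltimes> ?U Z)
        \<rhd> cross True V A (W \<odot> A \<odot> Z) \<rhd> (V \<ltimes> cross True W A (A \<odot> Z)) \<rhd> (V \<ltimes> W \<ltimes> endo A t Z) \<rhd> S
      = leg True V W A v (A \<odot> Z) \<rhd> (V \<ltimes> endo W w (A \<odot> Z))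
        \<rhd> cross (\<not> True) W V (A \<odot> A \<odot> Z) \<rhd> (W \<ltimes> leg True V A A v Z) \<rhd> cross True V W (A \<odot> A \<odot> Z)
        \<rhd> (V \<ltimes> leg True W A A w Z) \<rhd> (V \<ltimes> W \<ltimes> endo A t Z) \<rhd> S"
      using act_cancel(1)[of _ _ _ _ True] act_whisk_cancel(1)[of _ _ _ _ _ True]
      by (simp add: tens leg_past_tensor_right leg_past_tensor_left)
    also have "\<dots> = leg True V W A v (A \<odot> Z) 
        \<rhd> cross (\<not> True) W V (A \<odot> A \<odot> Z) \<rhd> (W \<ltimes> leg True V A A v Z) \<rhd> cross True V W (A \<odot> A \<odot> Z)
        \<rhd> (V \<ltimes> endo W w (A \<odot> Z)) \<rhd> (V \<ltimes> leg True W A A w Z) \<rhd> (V \<ltimes> W \<ltimes> endo A t Z) \<rhd> S"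
      by (subst legs_commute_over) simp_all
    also have "\<dots> = (V \<ltimes> W \<ltimes> endo A t Z) \<rhd> ?U (A \<odot> Z) \<rhd> S"
      using leg_fusion[OF v, of _ _ True] by (simp add: act_fusion[OF w] tens)
    finally show "?U (A \<odot> Z) \<rhd> (V \<ltimes> cross (\<not> True) A W (A \<odot> Z)) \<rhd> cross (\<not> True) A V (W \<odot> A \<odot> Z) \<rhd> (A \<ltimes> ?U Z)
        \<rhd> cross True V A (W \<odot> A \<odot> Z) \<rhd> (V \<ltimes> cross True W A (A \<odot> Z)) \<rhd> (V \<ltimes> W \<ltimes> endo A t Z) \<rhd> S
      = (V \<ltimes> W \<ltimes> endo A t Z) \<rhd> ?U (A \<odot> Z) \<rhd> S" .
    show "(V \<ltimes> W \<ltimes> e \<rtimes> Z) \<rhd> ?U Z \<rhd> S = (V \<ltimes> W \<ltimes> e \<rtimes> Z) \<rhd> S"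
      by (simp add: tens counit_leg[OF v] act_counit[OF w])
  qed (simp_all add: endo_arr_tens)
qed

text \<open>The left hand side of the fusion equation is \<open>w\<^sub>1 v\<^sub>1 w\<^sub>2 v\<^sub>2 t\<close>. Here \<open>v\<^sub>1\<close> commutes with \<open>w\<^sub>2\<close>: the
  crossing of \<open>V\<close> with \<open>W\<close> has sign \<open>True\<close> and that of \<open>W\<close> with the first copy of \<open>A\<close> has sign
  \<open>False\<close>. This is why \<open>tens3\<close> is built with the braiding of \<open>C\<close>.\<close>

lemma coaction_tens3:
  assumes v: "coaction False t V v" and w: "coaction False t W w"
    and [simp]: "t \<in> arr C" "src C t = A \<odot> A" "tgt C t = A \<odot> A"
  shows "coaction False t (V \<odot> W) (tens3 V v W w)"
proof -
  note [simp] = coactionD[OF v] coactionD[OF w]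
  note tens = act_tens[OF coactionD(1)[OF v] coactionD(1)[OF w]]
  show ?thesis
  proof (rule coaction_tensI)
    fix Z S assume [simp]: "Z \<in> obj C"
    let ?U = "\<lambda>Z. lift3 V W A V W A (tens3 V v W w) Z"
    have "?U (A \<odot> Z) \<rhd> (V \<ltimes> cross (\<not> False) A W (A \<odot> Z)) \<rhd> cross (\<not> False) A V (W \<odot> A \<odot> Z) \<rhd> (A \<ltimes> ?U Z)
        \<rhd> cross False V A (W \<odot> A \<odot> Z) \<rhd> (V \<ltimes> cross False W A (A \<odot> Z)) \<rhd> (V \<ltimes> W \<ltimes> endo A t Z) \<rhd> S
      = (V \<ltimes> endo W w (A \<odot> Z)) \<rhd> leg True V W A v (A \<odot> Z) \<rhd> (V \<ltimes> leg False W A A w Z)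
        \<rhd> cross (\<not> True) W V (A \<odot> A \<odot> Z) \<rhd> (W \<ltimes> leg False V A A v Z) \<rhd> cross True V W (A \<odot> A \<odot> Z)
        \<rhd> (V \<ltimes> W \<ltimes> endo A t Z) \<rhd> S"
      using act_cancel(1)[of _ _ _ _ False] act_whisk_cancel(1)[of _ _ _ _ _ False]
      by (simp add: tens leg_past_tensor_right leg_past_tensor_left)
    also have "\<dots> = (V \<ltimes> endo W w (A \<odot> Z)) \<rhd> (V \<ltimes> leg False W A A w Z) \<rhd> leg True V W A v (A \<odot> Z)
        \<rhd> cross (\<not> True) W V (A \<odot> A \<odot> Z) \<rhd> (W \<ltimes> leg False V A A v Z) \<rhd> cross True V W (A \<odot> A \<odot> Z)
        \<rhd> (V \<ltimes> W \<ltimes> endo A t Z) \<rhd> S"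
      using legs_commute_under[of v V A w W A Z True] by simp
    also have "\<dots> = (V \<ltimes> W \<ltimes> endo A t Z) \<rhd> ?U (A \<odot> Z) \<rhd> S"
      by (subst leg_fusion[OF v]) (simp_all add: act_fusion[OF w] tens)
    finally show "?U (A \<odot> Z) \<rhd> (V \<ltimes> cross (\<not> False) A W (A \<odot> Z)) \<rhd> cross (\<not> False) A V (W \<odot> A \<odot> Z) \<rhd> (A \<ltimes> ?U Z)
        \<rhd> cross False V A (W \<odot> A \<odot> Z) \<rhd> (V \<ltimes> cross False W A (A \<odot> Z)) \<rhd> (V \<ltimes> W \<ltimes> endo A t Z) \<rhd> S
      = (V \<ltimes> W \<ltimes> endo A t Z) \<rhd> ?U (A \<odot> Z) \<rhd> S" .
    show "(V \<ltimes> W \<ltimes> e \<rtimes> Z) \<rhd> ?U Z \<rhd> S = (V \<ltimes> W \<ltimes> e \<rtimes> Z) \<rhd> S"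
      by (simp add: tens counit_leg[OF v] act_counit[OF w])
  qed (simp_all add: endo_arr_tens)
qed

end

section \<open>Compatibility, unit and morphisms\<close>

context braided_monoidal_category
begin

lemma braid_natural:
  assumes "f \<in> arr C" "src C f = X" "tgt C f = X'" "g \<in> arr C" "src C g = Y" "tgt C g = Y'"
  shows "braid s X' Y' \<cdot> (f \<otimes> g) = (g \<otimes> f) \<cdot> braid s X Y"
proof (cases s)
  case False
  have obj: "X \<in> obj C" "X' \<in> obj C" "Y \<in> obj C" "Y' \<in> obj C" using assms by auto
  have "Inv[\<b>[Y', X']] \<cdot> (f \<otimes> g) = (g \<otimes> f) \<cdot> Inv[\<b>[Y, X]]"
    by (rule iso_conj) (use assms obj in \<open>auto simp: braiding_nat\<close>)
  then show ?thesis using False by (simp add: braid_def)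
qed (use assms in \<open>auto simp: braid_def braiding_nat\<close>)

lemma cross_natural:
  assumes "f \<in> arr C" "src C f = X" "tgt C f = X'" "g \<in> arr C" "src C g = Y" "tgt C g = Y'" "Z \<in> obj C"
  shows "cross s X' Y' Z \<cdot> (f \<otimes> g \<rtimes> Z) = (g \<otimes> f \<rtimes> Z) \<cdot> cross s X Y Z"
proof -
  have obj: "X \<in> obj C" "X' \<in> obj C" "Y \<in> obj C" "Y' \<in> obj C" using assms by auto
  have "lift X Y Y' X' (braid s X' Y' \<cdot> (f \<otimes> g)) Z = lift X Y Y' X' ((g \<otimes> f) \<cdot> braid s X Y) Z"
    using braid_natural[OF assms(1-6)] by simp
  then show ?thesis
    using assms obj lift_cmp[of "f \<otimes> g" X Y X' Y' "braid s X' Y'" Y' X' Z]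
      lift_cmp[of "braid s X Y" X Y Y X "g \<otimes> f" Y' X' Z]
    by (simp add: lift_tens)
qed

lemma act_cross_natural:
  assumes "f \<in> arr C" "src C f = X" "tgt C f = X'" "g \<in> arr C" "src C g = Y" "tgt C g = Y'" "Z \<in> obj C"
  shows "(g \<otimes> f \<rtimes> Z) \<rhd> cross s X Y Z \<rhd> S = cross s X' Y' Z \<rhd> (f \<otimes> g \<rtimes> Z) \<rhd> S"
proof -
  have obj: "X \<in> obj C" "X' \<in> obj C" "Y \<in> obj C" "Y' \<in> obj C" using assms by auto
  show ?thesis using cross_natural[OF assms, of s] assms obj by (simp flip: act_cmp)
qed

text \<open>Crossing the unit object is trivial. For \<open>Z = \<I> \<odot> Y\<close>, naturality of the braiding at
  \<open>\<l>[\<I>]\<close> and the hexagon yield the claim with an additional crossing on both sides, which cancels.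
  The general case follows by naturality, as \<open>\<l>[Z]\<close> is invertible.\<close>

lemma left_unitor_cross:
  assumes [simp]: "X \<in> obj C" "Z \<in> obj C"
  shows "\<l>[X \<odot> Z] \<cdot> cross s X \<I> Z = X \<ltimes> \<l>[Z]"
proof -
  have "\<l>[X \<odot> Z] \<cdot> cross s X \<I> Z = X \<ltimes> \<l>[Z]" if Z: "Z = \<I> \<odot> Y" and [simp]: "Y \<in> obj C" for Z Y
  proof (rule iso_cancel_left[of "cross s X \<I> Y"])
    have lu: "(\<l>[\<I>] \<rtimes> W) = \<l>[\<I> \<odot> W] \<cdot> \<a>[\<I>, \<I>, W]" if "W \<in> obj C" for W
      using left_unitor_tens[of \<I> W] that by simp
    \<comment> \<open>both sides of the naturality square at \<open>\<l>[\<I>]\<close>, with \<open>\<l>[\<I>] \<otimes> 1\<close> expressed by the unitor of a product\<close>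
    have "cross s X \<I> Y \<cdot> (X \<ltimes> \<l>[\<I> \<odot> Y]) \<cdot> (X \<ltimes> \<a>[\<I>, \<I>, Y]) = cross s X \<I> Y \<cdot> (X \<ltimes> \<l>[\<I>] \<rtimes> Y)"
      by (simp add: lu flip: whisk_cmp)
    also have "\<dots> = (\<l>[\<I>] \<rtimes> (X \<odot> Y)) \<cdot> cross s X (\<I> \<odot> \<I>) Y"
      by (subst cross_natural[where X = X and Y = "\<I> \<odot> \<I>"]) simp_all
    also have "\<dots> = \<l>[\<I> \<odot> X \<odot> Y] \<cdot> \<a>[\<I>, \<I>, X \<odot> Y] \<cdot> cross s X (\<I> \<odot> \<I>) Y"
      by (simp add: lu cmp_assoc_arr)
    also have "\<dots> = (\<l>[\<I> \<odot> X \<odot> Y] \<cdot> (\<I> \<ltimes> cross s X \<I> Y)) \<cdot> cross s X \<I> (\<I> \<odot> Y) \<cdot> (X \<ltimes> \<a>[\<I>, \<I>, Y])"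
      by (simp add: assoc_cross_tens cmp_assoc_arr)
    also have "\<dots> = cross s X \<I> Y \<cdot> \<l>[X \<odot> \<I> \<odot> Y] \<cdot> cross s X \<I> (\<I> \<odot> Y) \<cdot> (X \<ltimes> \<a>[\<I>, \<I>, Y])"
      by (simp add: left_unitor_nat cmp_assoc_arr)
    finally have "(cross s X \<I> Y \<cdot> \<l>[X \<odot> Z] \<cdot> cross s X \<I> Z) \<cdot> (X \<ltimes> \<a>[\<I>, \<I>, Y])
      = (cross s X \<I> Y \<cdot> (X \<ltimes> \<l>[Z])) \<cdot> (X \<ltimes> \<a>[\<I>, \<I>, Y])"
      by (simp add: Z cmp_assoc_arr)
    then show "cross s X \<I> Y \<cdot> \<l>[X \<odot> Z] \<cdot> cross s X \<I> Z = cross s X \<I> Y \<cdot> (X \<ltimes> \<l>[Z])"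
      by (rule iso_cancel_right[rotated]) (simp_all add: Z iso_tens)
  qed (simp_all add: Z)
  \<comment> \<open>naturality of \<open>\<l>\<close> extends the special case along \<open>\<l>[Z] : \<I> \<odot> Z \<rightarrow> Z\<close>\<close>
  from this[of "\<I> \<odot> Z" Z]
  have *: "\<l>[X \<odot> \<I> \<odot> Z] \<cdot> cross s X \<I> (\<I> \<odot> Z) = X \<ltimes> \<l>[\<I> \<odot> Z]" by simp
  have "(\<l>[X \<odot> Z] \<cdot> cross s X \<I> Z) \<cdot> (X \<ltimes> \<I> \<ltimes> \<l>[Z])
      = (\<l>[X \<odot> Z] \<cdot> (\<I> \<ltimes> X \<ltimes> \<l>[Z])) \<cdot> cross s X \<I> (\<I> \<odot> Z)"
    by (simp add: lift_natural[where Z = "\<I> \<odot> Z" and Z' = Z] cmp_assoc_arr)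
  also have "\<dots> = (X \<ltimes> \<l>[Z]) \<cdot> (X \<ltimes> \<l>[\<I> \<odot> Z])"
    by (simp add: left_unitor_nat * cmp_assoc_arr)
  also have "\<dots> = (X \<ltimes> \<l>[Z]) \<cdot> (X \<ltimes> \<I> \<ltimes> \<l>[Z])"
    by (simp add: left_unitor_nat flip: whisk_cmp)
  finally show ?thesis
    by (rule iso_cancel_right[rotated]) (simp_all add: iso_tens)
qed

end

context comodule_data
begin

lemma act_compatible:
  assumes v: "endo_arr V v1" "endo_arr V v3" "compatible V v1 v3"
    and [simp]: "Z \<in> obj C" "W \<in> obj C"
  shows "(W \<ltimes> V \<ltimes> lift_mult A m Z) \<rhd> (W \<ltimes> cross True A V (A \<odot> Z)) \<rhd> (W \<ltimes> A \<ltimes> endo V v1 Z) \<rhd> S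
    = (W \<ltimes> V \<ltimes> lift_mult A m Z) \<rhd> (W \<ltimes> endo V v3 (A \<odot> Z)) \<rhd> (W \<ltimes> cross True A V (A \<odot> Z)) \<rhd> S"
proof -
  note [simp] = endo_arrD[OF v(1)] endo_arrD[OF v(2)]
  have "(V \<ltimes> lift_mult A m Z) \<cdot> cross True A V (A \<odot> Z) \<cdot> (A \<ltimes> endo V v1 Z)
      = (V \<ltimes> lift_mult A m Z) \<cdot> endo V v3 (A \<odot> Z) \<cdot> cross True A V (A \<odot> Z)"
    using v by (simp add: compatible_def)
  then show ?thesis by (simp flip: act_cmp whisk_cmp)
qed

text \<open>Both sides describe \<open>a \<otimes> x \<otimes> y \<otimes> b \<mapsto> x\<^sub>0 \<otimes> y\<^sub>0 \<otimes> a x\<^sub>1 y\<^sub>1 b\<close>. First \<open>V\<close> turns \<open>x\<^sub>1\<close>, which is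
  multiplied onto \<open>y\<^sub>1 b\<close>, into a factor on the right of \<open>a\<close>; then \<open>W\<close> does so with \<open>y\<^sub>1\<close>.\<close>

lemma compatible_tens:
  assumes v: "endo_arr V v1" "endo_arr V v3" "compatible V v1 v3"
    and w: "endo_arr W w1" "endo_arr W w3" "compatible W w1 w3"
  shows "compatible (V \<odot> W) (tens1 V v1 W w1) (tens3 V v3 W w3)"
proof -
  note [simp] = endo_arrD[OF v(1)] endo_arrD[OF v(2)] endo_arrD[OF w(1)] endo_arrD[OF w(2)]
  note u = endo_arr_tens(1)[OF v(1) w(1)] endo_arr_tens(2)[OF v(2) w(2)]
  note [simp] = endo_arrD[OF u(1)] endo_arrD[OF u(2)]
  have "((V \<odot> W) \<ltimes> lift_mult A m Z) \<cdot> cross True A (V \<odot> W) (A \<odot> Z) \<cdot> (A \<ltimes> endo (V \<odot> W) (tens1 V v1 W w1) Z)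
      = ((V \<odot> W) \<ltimes> lift_mult A m Z) \<cdot> endo (V \<odot> W) (tens3 V v3 W w3) (A \<odot> Z) \<cdot> cross True A (V \<odot> W) (A \<odot> Z)"
      (is "?l = ?r") if [simp]: "Z \<in> obj C" for Z
  proof (rule iso_cancel_left)
    let ?m = "\<lambda>X Y. X \<ltimes> Y \<ltimes> lift_mult A m Z"
    let ?AZ = "A \<odot> Z" and ?AAZ = "A \<odot> A \<odot> Z"
    have m_past: "?m X Y \<rhd> cross s Y X ?AAZ \<rhd> S = cross s Y X ?AZ \<rhd> ?m Y X \<rhd> S"
      if "X \<in> obj C" "Y \<in> obj C" for X Y s S
      using that by (intro act_natural) auto
    have a_past: "cross s A W (V \<odot> ?AZ) \<rhd> (A \<ltimes> W \<ltimes> endo V v1 Z) \<rhd> S = (W \<ltimes> A \<ltimes> endo V v1 Z) \<rhd> cross s A W (V \<odot> ?AZ) \<rhd> S" for s S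
      by (intro act_natural[symmetric]) auto
    have a_past': "cross s A V (W \<odot> ?AZ) \<rhd> (A \<ltimes> V \<ltimes> endo W w1 Z) \<rhd> S = (V \<ltimes> A \<ltimes> endo W w1 Z) \<rhd> cross s A V (W \<odot> ?AZ) \<rhd> S" for s S
      by (intro act_natural[symmetric]) auto
    have v_past: "endo V v3 (W \<odot> ?AZ) \<rhd> (V \<ltimes> A \<ltimes> endo W w1 Z) \<rhd> S = (V \<ltimes> A \<ltimes> endo W w1 Z) \<rhd> endo V v3 (W \<odot> ?AZ) \<rhd> S" for S
      by (intro act_natural[symmetric]) auto
    have main: "?m V W \<rhd> (V \<ltimes> cross True A W ?AZ) \<rhd> cross True A V (W \<odot> ?AZ)
        \<rhd> (A \<ltimes> leg True V W A v1 Z) \<rhd> (A \<ltimes> V \<ltimes> endo W w1 Z) \<rhd> S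
      = ?m V W \<rhd> (V \<ltimes> endo W w3 ?AZ) \<rhd> leg True V W A v3 ?AZ
        \<rhd> (V \<ltimes> cross True A W ?AZ) \<rhd> cross True A V (W \<odot> ?AZ) \<rhd> S" for S
    proof -
      \<comment> \<open>the first \<open>A\<close> passes the inner return crossing of \<open>W\<close> with \<open>V\<close>, so that \<open>v1\<close> meets its crossing with \<open>V\<close>\<close>
      have "?m V W \<rhd> (V \<ltimes> cross True A W ?AZ) \<rhd> cross True A V (W \<odot> ?AZ)
          \<rhd> (A \<ltimes> leg True V W A v1 Z) \<rhd> (A \<ltimes> V \<ltimes> endo W w1 Z) \<rhd> S
        = ?m V W \<rhd> cross (\<not> True) W V ?AAZ \<rhd> (W \<ltimes> cross True A V ?AZ) \<rhd> (W \<ltimes> A \<ltimes> endo V v1 Z)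
          \<rhd> cross True A W (V \<odot> ?AZ) \<rhd> (A \<ltimes> cross True V W ?AZ) \<rhd> (A \<ltimes> V \<ltimes> endo W w1 Z) \<rhd> S"
        by (simp add: act_leg(2) act_slide_left a_past)
      \<comment> \<open>compatibility of \<open>V\<close>, under the spectator \<open>W\<close>\<close>
      also have "\<dots> = cross (\<not> True) W V ?AZ \<rhd> ?m W V \<rhd> (W \<ltimes> endo V v3 ?AZ) \<rhd> (W \<ltimes> cross True A V ?AZ)
          \<rhd> cross True A W (V \<odot> ?AZ) \<rhd> (A \<ltimes> cross True V W ?AZ) \<rhd> (A \<ltimes> V \<ltimes> endo W w1 Z) \<rhd> S"
        by (simp add: m_past act_compatible[OF v])
      \<comment> \<open>the crossings of \<open>V\<close> with \<open>W\<close> close up around \<open>v3\<close>\<close>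
      also have "\<dots> = ?m V W \<rhd> leg True V W A v3 ?AZ \<rhd> (V \<ltimes> cross True A W ?AZ) \<rhd> cross True A V (W \<odot> ?AZ)
          \<rhd> (A \<ltimes> V \<ltimes> endo W w1 Z) \<rhd> S"
        by (simp add: m_past act_leg(1) act_slide_left)
      \<comment> \<open>pulling \<open>W\<close> out of \<open>v3\<close> lets \<open>w1\<close> move next to the multiplication\<close>
      also have "\<dots> = ?m V W \<rhd> (V \<ltimes> cross True A W ?AZ) \<rhd> (V \<ltimes> A \<ltimes> endo W w1 Z)
          \<rhd> endo V v3 (W \<odot> ?AZ) \<rhd> cross True A V (W \<odot> ?AZ) \<rhd> S"
        by (simp add: leg_slide a_past' v_past)
      \<comment> \<open>compatibility of \<open>W\<close>, under the spectator \<open>V\<close>\<close>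
      also have "\<dots> = ?m V W \<rhd> (V \<ltimes> endo W w3 ?AZ) \<rhd> (V \<ltimes> cross True A W ?AZ)
          \<rhd> endo V v3 (W \<odot> ?AZ) \<rhd> cross True A V (W \<odot> ?AZ) \<rhd> S"
        by (simp add: act_compatible[OF w])
      also have "\<dots> = ?m V W \<rhd> (V \<ltimes> endo W w3 ?AZ) \<rhd> leg True V W A v3 ?AZ
        \<rhd> (V \<ltimes> cross True A W ?AZ) \<rhd> cross True A V (W \<odot> ?AZ) \<rhd> S"
        by (simp add: leg_slide)
      finally show ?thesis .
    qed
    show "\<a>[V, W, ?AZ] \<cdot> ?l = \<a>[V, W, ?AZ] \<cdot> ?r"
      by (rule act_eqI)
        (simp_all add: act_cmp act_assoc_natural act_assoc_cross act_assoc_endo[OF u(1)] act_assoc_endo[OF u(2)]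
          act_tens[OF v(1) w(1)] act_tens[OF v(2) w(2)] main)
  qed simp_all
  then show ?thesis by (simp add: compatible_def)
qed

lemma comodule_endo:
  assumes "comodule C A t1 t3 e V v1 v3"
  shows "V \<in> obj C" "endo_arr V v1" "endo_arr V v3"
  using assms by (auto simp: comodule_iff dest: coactionD)

lemma comodule_tens:
  assumes "comodule C A t1 t3 e V v1 v3" "comodule C A t1 t3 e W w1 w3"
  shows "comodule C A t1 t3 e (V \<odot> W) (tens1 V v1 W w1) (tens3 V v3 W w3)"
  using assms comodule_endo[OF assms(1)] comodule_endo[OF assms(2)]
  by (simp add: comodule_iff coaction_tens1 coaction_tens3 compatible_tens)

lemma leg_ident:
  assumes [simp]: "V \<in> obj C" "W \<in> obj C" "Z \<in> obj C"
  shows "leg s V W A (ident C (V \<odot> A)) Z = ident C (V \<odot> W \<odot> A \<odot> Z)"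
  using Inv_arr(4)[of "cross s V W (A \<odot> Z)"] by (simp add: leg_def lift_ident)

lemma comodule_unit: "comodule C A t1 t3 e \<I> (ident C (\<I> \<odot> A)) (ident C (\<I> \<odot> A))"
  by (simp add: comodule_iff coaction_def endo_arr_def in_hom compatible_def lift_ident leg_ident)

definition intertwines :: "'o \<Rightarrow> 'a \<Rightarrow> 'o \<Rightarrow> 'a \<Rightarrow> 'a \<Rightarrow> bool"
  where "intertwines V v W w f \<longleftrightarrow> f \<in> hom C V W \<and> (f \<rtimes> A) \<cdot> v = w \<cdot> (f \<rtimes> A)"

lemma intertwinesD:
  assumes "intertwines V v W w f"
  shows "f \<in> arr C" "src C f = V" "tgt C f = W"
  using assms by (simp_all add: intertwines_def in_hom)

lemma intertwines_iff:
  assumes v: "endo_arr V v" and w: "endo_arr W w" and f: "f \<in> hom C V W"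
  shows "intertwines V v W w f
    \<longleftrightarrow> (\<forall>Z \<in> obj C. (f \<rtimes> (A \<odot> Z)) \<cdot> endo V v Z = endo W w Z \<cdot> (f \<rtimes> (A \<odot> Z)))"
proof -
  note [simp] = endo_arrD[OF v] endo_arrD[OF w]
  have [simp]: "f \<in> arr C" "src C f = V" "tgt C f = W" using f by (simp_all add: in_hom)
  have "(f \<rtimes> A) \<cdot> v = w \<cdot> (f \<rtimes> A) \<longleftrightarrow>
    (\<forall>Z \<in> obj C. lift V A W A ((f \<rtimes> A) \<cdot> v) Z = lift V A W A (w \<cdot> (f \<rtimes> A)) Z)"
    by (rule lift_eq_iff) simp_all
  moreover have "lift V A W A ((f \<rtimes> A) \<cdot> v) Z = (f \<rtimes> (A \<odot> Z)) \<cdot> endo V v Z" if "Z \<in> obj C" for Z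
    using that by (simp add: lift_cmp[where X' = V and Y' = A] lift_tens)
  moreover have "lift V A W A (w \<cdot> (f \<rtimes> A)) Z = endo W w Z \<cdot> (f \<rtimes> (A \<odot> Z))" if "Z \<in> obj C" for Z
    using that by (simp add: lift_cmp[where X' = W and Y' = A] lift_tens)
  ultimately show ?thesis using f by (simp add: intertwines_def)
qed

lemma intertwines_Inv:
  assumes f: "intertwines V v W w f" "iso_arr C f" and v: "endo_arr V v" and w: "endo_arr W w"
  shows "intertwines W w V v Inv[f]"
proof -
  note [simp] = endo_arrD[OF v] endo_arrD[OF w] intertwinesD[OF f(1)] f(2)
  have "Inv[f \<rtimes> A] \<cdot> w = v \<cdot> Inv[f \<rtimes> A]"
    by (rule iso_conj) (use f(1) in \<open>auto simp: intertwines_def iso_tens\<close>)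
  then show ?thesis by (simp add: intertwines_def in_hom iso_tens)
qed

text \<open>The crossings are natural in both strands, so that only the intertwining property of \<open>f\<close> remains.\<close>

lemma leg_natural:
  assumes v: "endo_arr V v" and v': "endo_arr V' v'" and f: "intertwines V v V' v' f"
    and g: "g \<in> arr C" "src C g = W" "tgt C g = W'" and [simp]: "Z \<in> obj C"
  shows "(f \<otimes> g \<rtimes> (A \<odot> Z)) \<rhd> leg s V W A v Z \<rhd> S = leg s V' W' A v' Z \<rhd> (f \<otimes> g \<rtimes> (A \<odot> Z)) \<rhd> S"
proof -
  note [simp] = endo_arrD[OF v] endo_arrD[OF v'] intertwinesD[OF f] g
  have [simp]: "W \<in> obj C" "W' \<in> obj C" using src_in_obj[OF g(1)] tgt_in_obj[OF g(1)] by simp_all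
  have "(f \<rtimes> (A \<odot> Z)) \<cdot> endo V v Z = endo V' v' Z \<cdot> (f \<rtimes> (A \<odot> Z))"
    using intertwines_iff[OF v v'] f by (auto simp: intertwines_def)
  then have "(g \<otimes> f \<rtimes> (A \<odot> Z)) \<cdot> (W \<ltimes> endo V v Z) = (W' \<ltimes> endo V' v' Z) \<cdot> (g \<otimes> f \<rtimes> (A \<odot> Z))"
    by (simp add: tens_cmp_tens)
  then have *: "(g \<otimes> f \<rtimes> (A \<odot> Z)) \<rhd> (W \<ltimes> endo V v Z) \<rhd> S = (W' \<ltimes> endo V' v' Z) \<rhd> (g \<otimes> f \<rtimes> (A \<odot> Z)) \<rhd> S" for S
    by (simp flip: act_cmp)
  show ?thesis
    by (simp add: act_leg(1) * act_cross_natural[where X = W and Y = V] act_cross_natural[where X = V and Y = W])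
qed

lemma intertwines_tens:
  assumes v: "endo_arr V v" and v': "endo_arr V' v'" and f: "intertwines V v V' v' f"
    and w: "endo_arr W w" and w': "endo_arr W' w'" and g: "intertwines W w W' w' g"
  shows "intertwines (V \<odot> W) (tens1 V v W w) (V' \<odot> W') (tens1 V' v' W' w') (f \<otimes> g)"
    and "intertwines (V \<odot> W) (tens3 V v W w) (V' \<odot> W') (tens3 V' v' W' w') (f \<otimes> g)"
proof -
  note [simp] = endo_arrD[OF v] endo_arrD[OF v'] endo_arrD[OF w] endo_arrD[OF w']
    intertwinesD[OF f] intertwinesD[OF g]
  note u = endo_arr_tens[OF v w] endo_arr_tens[OF v' w']
  note [simp] = u[THEN endo_arrD(1)] u[THEN endo_arrD(2)] u[THEN endo_arrD(3)] u[THEN endo_arrD(4)]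
  have fg: "f \<otimes> g \<in> hom C (V \<odot> W) (V' \<odot> W')" by (simp add: in_hom)
  have g_past: "(f \<otimes> g \<rtimes> (A \<odot> Z)) \<rhd> (V \<ltimes> endo W w Z) \<rhd> S = (V' \<ltimes> endo W' w' Z) \<rhd> (f \<otimes> g \<rtimes> (A \<odot> Z)) \<rhd> S"
    if [simp]: "Z \<in> obj C" for Z S
  proof -
    have "(g \<rtimes> (A \<odot> Z)) \<cdot> endo W w Z = endo W' w' Z \<cdot> (g \<rtimes> (A \<odot> Z))"
      using intertwines_iff[OF w w'] g by (auto simp: intertwines_def)
    then have "(f \<otimes> g \<rtimes> (A \<odot> Z)) \<cdot> (V \<ltimes> endo W w Z) = (V' \<ltimes> endo W' w' Z) \<cdot> (f \<otimes> g \<rtimes> (A \<odot> Z))"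
      by (simp add: tens_cmp_tens)
    then show ?thesis by (simp flip: act_cmp)
  qed
  have assoc_past: "\<a>[V', W', A \<odot> Z] \<rhd> ((f \<otimes> g) \<rtimes> (A \<odot> Z)) \<rhd> S = (f \<otimes> g \<rtimes> (A \<odot> Z)) \<rhd> \<a>[V, W, A \<odot> Z] \<rhd> S"
    if "Z \<in> obj C" for Z S
    using that by (simp add: assoc_nat flip: act_cmp)
  note simps = act_cmp assoc_past g_past leg_natural[OF v v' f] u[THEN act_assoc_endo(1)] act_tens[OF v w] act_tens[OF v' w']
  show "intertwines (V \<odot> W) (tens1 V v W w) (V' \<odot> W') (tens1 V' v' W' w') (f \<otimes> g)"
    unfolding intertwines_iff[OF u(1) u(3) fg]
  proof (rule ballI, rule iso_cancel_left)
    fix Z assume [simp]: "Z \<in> obj C"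
    show "\<a>[V', W', A \<odot> Z] \<cdot> ((f \<otimes> g) \<rtimes> (A \<odot> Z)) \<cdot> endo (V \<odot> W) (tens1 V v W w) Z
      = \<a>[V', W', A \<odot> Z] \<cdot> endo (V' \<odot> W') (tens1 V' v' W' w') Z \<cdot> ((f \<otimes> g) \<rtimes> (A \<odot> Z))"
      by (rule act_eqI) (simp_all add: simps)
  qed simp_all
  show "intertwines (V \<odot> W) (tens3 V v W w) (V' \<odot> W') (tens3 V' v' W' w') (f \<otimes> g)"
    unfolding intertwines_iff[OF u(2) u(4) fg]
  proof (rule ballI, rule iso_cancel_left)
    fix Z assume [simp]: "Z \<in> obj C"
    show "\<a>[V', W', A \<odot> Z] \<cdot> ((f \<otimes> g) \<rtimes> (A \<odot> Z)) \<cdot> endo (V \<odot> W) (tens3 V v W w) Z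
      = \<a>[V', W', A \<odot> Z] \<cdot> endo (V' \<odot> W') (tens3 V' v' W' w') Z \<cdot> ((f \<otimes> g) \<rtimes> (A \<odot> Z))"
      by (rule act_eqI) (simp_all add: simps)
  qed simp_all
qed

end

section \<open>Associator and unitors\<close>

context comodule_data
begin

text \<open>On both sides, the three coactions act one after the other on the last factor, each passing the
  objects between. After composition with the remaining sides of the pentagon, no
  associator is left inside the composites, and \<open>leg_past_tensor_left\<close> identifies the two ways
  in which \<open>V\<close> passes \<open>W\<close> and \<open>U\<close>.\<close>

lemma intertwines_associator:
  assumes v: "endo_arr V v" and w: "endo_arr W w" and u: "endo_arr U u"
  shows "intertwines ((V \<odot> W) \<odot> U) (tens1 (V \<odot> W) (tens1 V v W w) U u)
      (V \<odot> W \<odot> U) (tens1 V v (W \<odot> U) (tens1 W w U u)) \<a>[V, W, U]" (is "intertwines ?X ?x ?Y ?y _")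
    and "intertwines ((V \<odot> W) \<odot> U) (tens3 (V \<odot> W) (tens3 V v W w) U u)
      (V \<odot> W \<odot> U) (tens3 V v (W \<odot> U) (tens3 W w U u)) \<a>[V, W, U]" (is "intertwines ?X ?x' ?Y ?y' _")
proof -
  note [simp] = endo_arrD[OF v] endo_arrD[OF w] endo_arrD[OF u]
  note vw = endo_arr_tens[OF v w] and wu = endo_arr_tens[OF w u]
  note vw_u = endo_arr_tens(1)[OF vw(1) u] endo_arr_tens(2)[OF vw(2) u]
  note v_wu = endo_arr_tens(1)[OF v wu(1)] endo_arr_tens(2)[OF v wu(2)]
  note endos = vw wu vw_u v_wu
  note [simp] = endos[THEN endo_arrD(1)] endos[THEN endo_arrD(2)] endos[THEN endo_arrD(3)] endos[THEN endo_arrD(4)]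
  have hom: "\<a>[V, W, U] \<in> hom C ?X ?Y" by (simp add: in_hom)
  have pent: "(V \<ltimes> \<a>[W, U, Z]) \<rhd> \<a>[V, W \<odot> U, Z] \<rhd> (\<a>[V, W, U] \<rtimes> Z) \<rhd> S
      = \<a>[V, W, U \<odot> Z] \<rhd> \<a>[V \<odot> W, U, Z] \<rhd> S" if "Z \<in> obj C" for Z S
    using pentagon[of V W U Z] that by (simp flip: act_cmp)
  note tens = act_tens[OF v w] act_tens[OF w u] act_tens[OF vw(1) u] act_tens[OF vw(2) u]
    act_tens[OF v wu(1)] act_tens[OF v wu(2)]
  \<comment> \<open>the left hand side arises from the bracketing \<open>(V \<odot> W) \<odot> U\<close>, the inner composite on the right from \<open>V \<odot> W \<odot> U\<close>\<close>
  have leg_past: "(U \<ltimes> leg True V W A v Z) \<rhd> cross True V U (W \<odot> A \<odot> Z) \<rhd> (V \<ltimes> cross True W U (A \<odot> Z)) \<rhd> S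
    = cross True V U (W \<odot> A \<odot> Z) \<rhd> (V \<ltimes> cross True W U (A \<odot> Z))
      \<rhd> cross (\<not> True) W V (U \<odot> A \<odot> Z) \<rhd> (W \<ltimes> cross (\<not> True) U V (A \<odot> Z)) \<rhd> (W \<ltimes> U \<ltimes> endo V v Z)
      \<rhd> (W \<ltimes> cross True V U (A \<odot> Z)) \<rhd> cross True V W (U \<odot> A \<odot> Z) \<rhd> S" if [simp]: "Z \<in> obj C" for Z S
    by (subst leg_past_tensor_left) (simp_all add: act_leg(2))
  note simps = act_cmp whisk_cmp pent endos[THEN act_assoc_endo(1)] endos[THEN act_assoc_endo(2)] tens
    act_leg(1) act_assoc_cross act_assoc_natural leg_past_tensor_right
    leg_past[simplified] act_cancel(1)[where s = True, simplified] act_whisk_cancel(1)[where s = True, simplified]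
  show "intertwines ?X ?x ?Y ?y \<a>[V, W, U]"
    unfolding intertwines_iff[OF vw_u(1) v_wu(1) hom]
  proof (rule ballI, rule iso_cancel_left)
    fix Z assume [simp]: "Z \<in> obj C"
    let ?p = "(V \<ltimes> \<a>[W, U, A \<odot> Z]) \<cdot> \<a>[V, W \<odot> U, A \<odot> Z]"
    show "?p \<cdot> (\<a>[V, W, U] \<rtimes> (A \<odot> Z)) \<cdot> endo ?X ?x Z = ?p \<cdot> endo ?Y ?y Z \<cdot> (\<a>[V, W, U] \<rtimes> (A \<odot> Z))"
      by (rule act_eqI) (simp_all add: simps)
  qed (simp_all add: iso_cmp iso_tens)
  show "intertwines ?X ?x' ?Y ?y' \<a>[V, W, U]"
    unfolding intertwines_iff[OF vw_u(2) v_wu(2) hom]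
  proof (rule ballI, rule iso_cancel_left)
    fix Z assume [simp]: "Z \<in> obj C"
    let ?p = "(V \<ltimes> \<a>[W, U, A \<odot> Z]) \<cdot> \<a>[V, W \<odot> U, A \<odot> Z]"
    show "?p \<cdot> (\<a>[V, W, U] \<rtimes> (A \<odot> Z)) \<cdot> endo ?X ?x' Z = ?p \<cdot> endo ?Y ?y' Z \<cdot> (\<a>[V, W, U] \<rtimes> (A \<odot> Z))"
      by (rule act_eqI) (simp_all add: simps)
  qed (simp_all add: iso_cmp iso_tens)
qed

lemma intertwines_left_unitor:
  assumes v: "endo_arr V v"
  shows "intertwines (\<I> \<odot> V) (tens1 \<I> (ident C (\<I> \<odot> A)) V v) V v \<l>[V]"
    and "intertwines (\<I> \<odot> V) (tens3 \<I> (ident C (\<I> \<odot> A)) V v) V v \<l>[V]"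
proof -
  note [simp] = endo_arrD[OF v]
  have i: "endo_arr \<I> (ident C (\<I> \<odot> A))" by (simp add: endo_arr_def in_hom)
  note iv = endo_arr_tens[OF i v]
  note [simp] = iv[THEN endo_arrD(2)] iv[THEN endo_arrD(3)] iv[THEN endo_arrD(4)]
  have hom: "\<l>[V] \<in> hom C (\<I> \<odot> V) V" by (simp add: in_hom)
  have l: "\<l>[V] \<rtimes> X = \<l>[V \<odot> X] \<cdot> \<a>[\<I>, V, X]" if "X \<in> obj C" for X
    using left_unitor_tens[of V X] that by simp
  have nat: "\<l>[V \<odot> A \<odot> Z] \<rhd> (\<I> \<ltimes> endo V v Z) \<rhd> S = endo V v Z \<rhd> \<l>[V \<odot> A \<odot> Z] \<rhd> S" if "Z \<in> obj C" for Z S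
    using that by (simp add: left_unitor_nat flip: act_cmp)
  show "intertwines (\<I> \<odot> V) (tens1 \<I> (ident C (\<I> \<odot> A)) V v) V v \<l>[V]"
    unfolding intertwines_iff[OF iv(1) v hom]
  proof
    fix Z assume [simp]: "Z \<in> obj C"
    show "(\<l>[V] \<rtimes> (A \<odot> Z)) \<cdot> endo (\<I> \<odot> V) (tens1 \<I> (ident C (\<I> \<odot> A)) V v) Z = endo V v Z \<cdot> (\<l>[V] \<rtimes> (A \<odot> Z))"
      by (rule act_eqI) (simp_all add: l act_cmp iv[THEN act_assoc_endo(1)] act_tens[OF i v] leg_ident act_ident nat)
  qed
  show "intertwines (\<I> \<odot> V) (tens3 \<I> (ident C (\<I> \<odot> A)) V v) V v \<l>[V]"
    unfolding intertwines_iff[OF iv(2) v hom]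
  proof
    fix Z assume [simp]: "Z \<in> obj C"
    show "(\<l>[V] \<rtimes> (A \<odot> Z)) \<cdot> endo (\<I> \<odot> V) (tens3 \<I> (ident C (\<I> \<odot> A)) V v) Z = endo V v Z \<cdot> (\<l>[V] \<rtimes> (A \<odot> Z))"
      by (rule act_eqI) (simp_all add: l act_cmp iv[THEN act_assoc_endo(1)] act_tens[OF i v] leg_ident act_ident nat)
  qed
qed

lemma intertwines_right_unitor:
  assumes v: "endo_arr V v"
  shows "intertwines (V \<odot> \<I>) (tens1 V v \<I> (ident C (\<I> \<odot> A))) V v \<r>[V]"
    and "intertwines (V \<odot> \<I>) (tens3 V v \<I> (ident C (\<I> \<odot> A))) V v \<r>[V]"
proof -
  note [simp] = endo_arrD[OF v]
  have i: "endo_arr \<I> (ident C (\<I> \<odot> A))" by (simp add: endo_arr_def in_hom)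
  note vi = endo_arr_tens[OF v i]
  note [simp] = vi[THEN endo_arrD(2)] vi[THEN endo_arrD(3)] vi[THEN endo_arrD(4)]
  have hom: "\<r>[V] \<in> hom C (V \<odot> \<I>) V" by (simp add: in_hom)
  have r: "\<r>[V] \<rtimes> X = (V \<ltimes> \<l>[X]) \<cdot> \<a>[V, \<I>, X]" if "X \<in> obj C" for X
    using triangle[of V X] that by simp
  \<comment> \<open>without the crossings with the unit, only \<open>v\<close> is left\<close>
  have nat: "(V \<ltimes> \<l>[A \<odot> Z]) \<rhd> leg True V \<I> A v Z \<rhd> S = endo V v Z \<rhd> (V \<ltimes> \<l>[A \<odot> Z]) \<rhd> S"
    if [simp]: "Z \<in> obj C" for Z S
  proof -
    have "\<l>[V \<odot> A \<odot> Z] \<cdot> cross True V \<I> (A \<odot> Z) \<cdot> cross False \<I> V (A \<odot> Z) = \<l>[V \<odot> A \<odot> Z]"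
      using Inv_arr(5)[of "cross True V \<I> (A \<odot> Z)"] by simp
    then have *: "(V \<ltimes> \<l>[A \<odot> Z]) \<cdot> cross False \<I> V (A \<odot> Z) = \<l>[V \<odot> A \<odot> Z]"
      by (simp add: left_unitor_cross flip: cmp_assoc_arr)
    have "(V \<ltimes> \<l>[A \<odot> Z]) \<cdot> leg True V \<I> A v Z
      = ((V \<ltimes> \<l>[A \<odot> Z]) \<cdot> cross False \<I> V (A \<odot> Z)) \<cdot> (\<I> \<ltimes> endo V v Z) \<cdot> cross True V \<I> (A \<odot> Z)"
      by (simp add: leg_def cmp_assoc_arr)
    also have "\<dots> = (\<l>[V \<odot> A \<odot> Z] \<cdot> (\<I> \<ltimes> endo V v Z)) \<cdot> cross True V \<I> (A \<odot> Z)"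
      unfolding * by (simp add: cmp_assoc_arr)
    also have "\<dots> = endo V v Z \<cdot> (V \<ltimes> \<l>[A \<odot> Z])"
      by (simp add: left_unitor_nat left_unitor_cross cmp_assoc_arr)
    finally show ?thesis by (simp flip: act_cmp)
  qed
  have drop: "(V \<ltimes> \<l>[A \<odot> Z]) \<rhd> ident C (V \<odot> \<I> \<odot> A \<odot> Z) \<rhd> S = (V \<ltimes> \<l>[A \<odot> Z]) \<rhd> S" if "Z \<in> obj C" for Z S
    using that by (simp flip: act_cmp)
  show "intertwines (V \<odot> \<I>) (tens1 V v \<I> (ident C (\<I> \<odot> A))) V v \<r>[V]"
    unfolding intertwines_iff[OF vi(1) v hom]
  proof
    fix Z assume [simp]: "Z \<in> obj C"
    show "(\<r>[V] \<rtimes> (A \<odot> Z)) \<cdot> endo (V \<odot> \<I>) (tens1 V v \<I> (ident C (\<I> \<odot> A))) Z = endo V v Z \<cdot> (\<r>[V] \<rtimes> (A \<odot> Z))"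
      by (rule act_eqI) (simp_all add: r act_cmp vi[THEN act_assoc_endo(1)] act_tens[OF v i] lift_ident act_ident nat)
  qed
  show "intertwines (V \<odot> \<I>) (tens3 V v \<I> (ident C (\<I> \<odot> A))) V v \<r>[V]"
    unfolding intertwines_iff[OF vi(2) v hom]
  proof
    fix Z assume [simp]: "Z \<in> obj C"
    show "(\<r>[V] \<rtimes> (A \<odot> Z)) \<cdot> endo (V \<odot> \<I>) (tens3 V v \<I> (ident C (\<I> \<odot> A))) Z = endo V v Z \<cdot> (\<r>[V] \<rtimes> (A \<odot> Z))"
      by (rule act_eqI) (simp_all add: r act_cmp vi[THEN act_assoc_endo(1)] act_tens[OF v i] lift_ident drop nat)
  qed
qed

end

section \<open>The monoidal category of comodules\<close>

context comodule_data
begin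

definition Comod :: "('o \<times> 'a \<times> 'a) set"
  where "Comod = {(V, v1, v3). comodule C A t1 t3 e V v1 v3}"

lemma Comod_iff: "(V, v1, v3) \<in> Comod \<longleftrightarrow> comodule C A t1 t3 e V v1 v3"
  by (simp add: Comod_def)

lemma ComodD:
  assumes "(V, v1, v3) \<in> Comod"
  shows "V \<in> obj C" "endo_arr V v1" "endo_arr V v3"
  using assms comodule_endo by (auto simp: Comod_iff)

abbreviation morphism :: "'o \<times> 'a \<times> 'a \<Rightarrow> 'o \<times> 'a \<times> 'a \<Rightarrow> 'a \<Rightarrow> bool"
  where "morphism \<equiv> comodule_morphism C A"

definition tensor :: "'o \<times> 'a \<times> 'a \<Rightarrow> 'o \<times> 'a \<times> 'a \<Rightarrow> 'o \<times> 'a \<times> 'a"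
  where "tensor = (\<lambda>(V, v1, v3) (W, w1, w3). (V \<odot> W, tens1 V v1 W w1, tens3 V v3 W w3))"

definition unit :: "'o \<times> 'a \<times> 'a"
  where "unit = (\<I>, ident C (\<I> \<odot> A), ident C (\<I> \<odot> A))"

lemma morphism_iff:
  "morphism (V, v1, v3) (W, w1, w3) f \<longleftrightarrow> intertwines V v1 W w1 f \<and> intertwines V v3 W w3 f"
  by (auto simp: comodule_morphism_def intertwines_def)

lemma fst_tensor [simp]: "fst (tensor P Q) = fst P \<odot> fst Q"
  by (simp add: tensor_def split: prod.splits)

lemma fst_unit [simp]: "fst unit = \<I>"
  by (simp add: unit_def)

lemma fst_Comod [simp]: "P \<in> Comod \<Longrightarrow> fst P \<in> obj C"
  by (cases P) (auto dest: ComodD)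

lemma tensor_Comod [simp]: "P \<in> Comod \<Longrightarrow> Q \<in> Comod \<Longrightarrow> tensor P Q \<in> Comod"
  by (cases P; cases Q) (simp add: tensor_def Comod_iff comodule_tens)

lemma unit_Comod [simp]: "unit \<in> Comod"
  by (simp add: unit_def Comod_iff comodule_unit)

lemma morphism_arr:
  assumes "morphism P Q f"
  shows "f \<in> arr C" "src C f = fst P" "tgt C f = fst Q"
  using assms by (auto simp: comodule_morphism_def in_hom split: prod.splits)

lemma morphism_ident:
  assumes "P \<in> Comod"
  shows "morphism P P (ident C (fst P))"
proof (cases P)
  case (fields V v1 v3)
  note D = ComodD[OF assms[unfolded fields]]
  show ?thesis
    using endo_arrD[OF D(2)] endo_arrD[OF D(3)] by (simp add: fields morphism_iff intertwines_def in_hom)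
qed

lemma morphism_cmp:
  assumes "P \<in> Comod" "Q \<in> Comod" "R \<in> Comod" "morphism P Q f" "morphism Q R g"
  shows "morphism P R (g \<cdot> f)"
proof -
  have *: "intertwines V v U u (g \<cdot> f)"
    if v: "endo_arr V v" and w: "endo_arr W w" and u: "endo_arr U u"
      and f: "intertwines V v W w f" and g: "intertwines W w U u g" for V v W w U u
  proof -
    note [simp] = endo_arrD[OF v] endo_arrD[OF w] endo_arrD[OF u] intertwinesD[OF f] intertwinesD[OF g]
    have f': "(f \<rtimes> A) \<cdot> v = w \<cdot> (f \<rtimes> A)" and g': "(g \<rtimes> A) \<cdot> w = u \<cdot> (g \<rtimes> A)"
      using f g by (simp_all add: intertwines_def)
    have "((g \<cdot> f) \<rtimes> A) \<cdot> v = (g \<rtimes> A) \<cdot> w \<cdot> (f \<rtimes> A)" by (simp add: whisk_cmp cmp_assoc_arr f')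
    also have "\<dots> = ((g \<rtimes> A) \<cdot> w) \<cdot> (f \<rtimes> A)" by (simp add: cmp_assoc_arr)
    also have "\<dots> = u \<cdot> ((g \<cdot> f) \<rtimes> A)" unfolding g' by (simp add: whisk_cmp cmp_assoc_arr)
    finally show ?thesis by (simp add: intertwines_def in_hom)
  qed
  show ?thesis using assms
    by (cases P; cases Q; cases R) (auto simp: morphism_iff intro: * dest: ComodD)
qed

text \<open>So that the coherence isomorphisms of \<open>C\<close> are invertible as morphisms of comodules.\<close>

lemma morphism_Inv:
  assumes "P \<in> Comod" "Q \<in> Comod" "morphism P Q f" "iso_arr C f"
  shows "morphism Q P Inv[f]"
  using assms by (cases P; cases Q) (auto simp: morphism_iff intro: intertwines_Inv dest: ComodD)

lemma morphism_tens:
  assumes "P \<in> Comod" "Q \<in> Comod" "P' \<in> Comod" "Q' \<in> Comod" "morphism P P' f" "morphism Q Q' g"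
  shows "morphism (tensor P Q) (tensor P' Q') (f \<otimes> g)"
  using assms by (cases P; cases Q; cases P'; cases Q')
    (auto simp: morphism_iff tensor_def intro: intertwines_tens dest: ComodD)

lemma morphism_associator:
  assumes "P \<in> Comod" "Q \<in> Comod" "R \<in> Comod"
  shows "morphism (tensor (tensor P Q) R) (tensor P (tensor Q R)) \<a>[fst P, fst Q, fst R]"
  using assms by (cases P; cases Q; cases R)
    (auto simp: morphism_iff tensor_def intro: intertwines_associator dest: ComodD)

lemma morphism_unitors:
  assumes "P \<in> Comod"
  shows "morphism (tensor unit P) P \<l>[fst P]" "morphism (tensor P unit) P \<r>[fst P]"
  using assms by (cases P; auto simp: morphism_iff tensor_def unit_def
      intro: intertwines_left_unitor intertwines_right_unitor dest: ComodD)+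

definition comodules ::
    "('o \<times> 'a \<times> 'a, ('o \<times> 'a \<times> 'a) \<times> 'a \<times> ('o \<times> 'a \<times> 'a)) monoidal_category"
  where "comodules = category.extend (comodule_category C A t1 t3 e) (monoidal_category.fields
    tensor
    (\<lambda>(P, f, Q) (P', g, Q'). (tensor P P', f \<otimes> g, tensor Q Q'))
    unit
    (\<lambda>P Q R. (tensor (tensor P Q) R, \<a>[fst P, fst Q, fst R], tensor P (tensor Q R)))
    (\<lambda>P. (tensor unit P, \<l>[fst P], P))
    (\<lambda>P. (tensor P unit, \<r>[fst P], P)))"

lemma comodules_simps [simp]:
  "obj comodules = Comod"
  "arr comodules = {(P, f, Q). P \<in> Comod \<and> Q \<in> Comod \<and> morphism P Q f}"
  "src comodules (P, f, Q) = P" "tgt comodules (P, f, Q) = Q"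
  "ident comodules P = (P, ident C (fst P), P)"
  "cmp comodules (Q', g, R) (P, f, Q) = (P, g \<cdot> f, R)"
  "tens_obj comodules = tensor"
  "tens_arr comodules (P, f, Q) (P', g, Q') = (tensor P P', f \<otimes> g, tensor Q Q')"
  "unit_obj comodules = unit"
  "associator comodules P Q R = (tensor (tensor P Q) R, \<a>[fst P, fst Q, fst R], tensor P (tensor Q R))"
  "left_unitor comodules P = (tensor unit P, \<l>[fst P], P)"
  "right_unitor comodules P = (tensor P unit, \<r>[fst P], P)"
  by (simp_all add: comodules_def comodule_category_def category.defs monoidal_category.defs Let_def Comod_def
      split: prod.splits)

lemma truncate_comodules: "category.truncate comodules = comodule_category C A t1 t3 e"
  by (simp add: comodules_def comodule_category_def category.defs monoidal_category.defs Let_def)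

lemma hom_comodules:
  "x \<in> hom comodules P Q \<longleftrightarrow> P \<in> Comod \<and> Q \<in> Comod \<and> (\<exists>f. x = (P, f, Q) \<and> morphism P Q f)"
  by (cases x) (auto simp: hom_def)

lemma iso_comodules:
  assumes "P \<in> Comod" "Q \<in> Comod" "morphism P Q f" "iso_arr C f"
  shows "iso_arr comodules (P, f, Q)"
proof -
  have "inverse_arrs comodules (P, f, Q) (Q, Inv[f], P)"
    using assms morphism_arr[OF assms(3)] morphism_Inv[OF assms]
    by (simp add: inverse_arrs_def hom_comodules)
  then show ?thesis unfolding iso_arr_def by blast
qed

lemma category_comodules: "category comodules"
proof
  fix x y z :: "('o \<times> 'a \<times> 'a) \<times> 'a \<times> ('o \<times> 'a \<times> 'a)" and P Q R S
  show "src comodules x \<in> obj comodules" "tgt comodules x \<in> obj comodules" if "x \<in> arr comodules"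
    using that by auto
  show "ident comodules P \<in> hom comodules P P" if "P \<in> obj comodules"
    using that by (simp add: hom_comodules morphism_ident)
  show "cmp comodules y x \<in> hom comodules P R" if "x \<in> hom comodules P Q" "y \<in> hom comodules Q R"
    using that by (auto simp: hom_comodules intro: morphism_cmp)
  show "cmp comodules x (ident comodules P) = x" "cmp comodules (ident comodules Q) x = x"
    if "x \<in> hom comodules P Q"
    using that by (auto simp: hom_comodules morphism_arr)
  show "cmp comodules (cmp comodules z y) x = cmp comodules z (cmp comodules y x)"
    if "x \<in> hom comodules P Q" "y \<in> hom comodules Q R" "z \<in> hom comodules R S"
    using that by (auto simp: hom_comodules morphism_arr cmp_assoc_arr)
qed

text \<open>All equations are those of \<open>C\<close>, because morphisms of comodules with equal source and target are
  equal if the underlying arrows are.\<close>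

lemma monoidal_category_comodules: "monoidal_category comodules"
proof -
  interpret K: category comodules by (rule category_comodules)
  show ?thesis
  proof
    fix P Q R S P' Q' R' P'' Q'' and x x' y y' z :: "('o \<times> 'a \<times> 'a) \<times> 'a \<times> ('o \<times> 'a \<times> 'a)"
    show "tens_obj comodules P Q \<in> obj comodules" if "P \<in> obj comodules" "Q \<in> obj comodules"
      using that by simp
    show "unit_obj comodules \<in> obj comodules" by simp
    show "tens_arr comodules x y \<in> hom comodules (tens_obj comodules P Q) (tens_obj comodules P' Q')"
      if "x \<in> hom comodules P P'" "y \<in> hom comodules Q Q'"
      using that by (auto simp: hom_comodules morphism_tens)
    show "tens_arr comodules (ident comodules P) (ident comodules Q) = ident comodules (tens_obj comodules P Q)"
      if "P \<in> obj comodules" "Q \<in> obj comodules"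
      using that by simp
    show "tens_arr comodules (cmp comodules x' x) (cmp comodules y' y)
        = cmp comodules (tens_arr comodules x' y') (tens_arr comodules x y)"
      if "x \<in> hom comodules P P'" "x' \<in> hom comodules P' P''" "y \<in> hom comodules Q Q'" "y' \<in> hom comodules Q' Q''"
      using that by (auto simp: hom_comodules morphism_arr tens_cmp_tens)
    show "associator comodules P Q R \<in> hom comodules
        (tens_obj comodules (tens_obj comodules P Q) R) (tens_obj comodules P (tens_obj comodules Q R))"
      "iso_arr comodules (associator comodules P Q R)"
      if "P \<in> obj comodules" "Q \<in> obj comodules" "R \<in> obj comodules"
      using that by (simp_all add: hom_comodules morphism_associator iso_comodules)
    show "cmp comodules (associator comodules P' Q' R') (tens_arr comodules (tens_arr comodules x y) z)
        = cmp comodules (tens_arr comodules x (tens_arr comodules y z)) (associator comodules P Q R)"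
      if "x \<in> hom comodules P P'" "y \<in> hom comodules Q Q'" "z \<in> hom comodules R R'"
      using that by (auto simp: hom_comodules morphism_arr assoc_nat)
    show "left_unitor comodules P \<in> hom comodules (tens_obj comodules (unit_obj comodules) P) P"
      "iso_arr comodules (left_unitor comodules P)"
      "right_unitor comodules P \<in> hom comodules (tens_obj comodules P (unit_obj comodules)) P"
      "iso_arr comodules (right_unitor comodules P)"
      if "P \<in> obj comodules"
      using that by (simp_all add: hom_comodules morphism_unitors iso_comodules)
    show "cmp comodules (left_unitor comodules Q) (tens_arr comodules (ident comodules (unit_obj comodules)) x)
        = cmp comodules x (left_unitor comodules P)"
      "cmp comodules (right_unitor comodules Q) (tens_arr comodules x (ident comodules (unit_obj comodules)))
        = cmp comodules x (right_unitor comodules P)"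
      if "x \<in> hom comodules P Q"
      using that by (auto simp: hom_comodules morphism_arr left_unitor_nat right_unitor_nat)
    show "cmp comodules (tens_arr comodules (ident comodules P) (associator comodules Q R S))
        (cmp comodules (associator comodules P (tens_obj comodules Q R) S)
          (tens_arr comodules (associator comodules P Q R) (ident comodules S)))
      = cmp comodules (associator comodules P Q (tens_obj comodules R S))
          (associator comodules (tens_obj comodules P Q) R S)"
      if "P \<in> obj comodules" "Q \<in> obj comodules" "R \<in> obj comodules" "S \<in> obj comodules"
      using that by (simp add: pentagon)
    show "cmp comodules (tens_arr comodules (ident comodules P) (left_unitor comodules Q))
        (associator comodules P (unit_obj comodules) Q)
      = tens_arr comodules (right_unitor comodules P) (ident comodules Q)"
      if "P \<in> obj comodules" "Q \<in> obj comodules"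
      using that by (simp add: triangle)
  qed
qed

lemma strict_monoidal_functor_forget: "strict_monoidal_functor comodules C forget_obj forget_arr"
proof -
  interpret K: monoidal_category comodules by (rule monoidal_category_comodules)
  have [simp]: "forget_obj P = fst P" "forget_arr (P, f, Q) = f" for P Q f
    by (simp_all add: forget_obj_def forget_arr_def split: prod.splits)
  show ?thesis
  proof
    fix P Q R and x y :: "('o \<times> 'a \<times> 'a) \<times> 'a \<times> ('o \<times> 'a \<times> 'a)"
    show "forget_arr x \<in> hom C (forget_obj P) (forget_obj Q)" if "x \<in> hom comodules P Q"
      using that by (auto simp: hom_comodules in_hom morphism_arr)
    show "forget_arr (cmp comodules y x) = forget_arr y \<cdot> forget_arr x"
      if "x \<in> hom comodules P Q" "y \<in> hom comodules Q R"
      using that by (auto simp: hom_comodules)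
    show "forget_arr (tens_arr comodules x y) = forget_arr x \<otimes> forget_arr y"
      if "x \<in> arr comodules" "y \<in> arr comodules"
      by (cases x; cases y) simp
  qed simp_all
qed

end

lemma (in regular_multiplier_bimonoid) comodule_dataI:
  assumes "braided_monoidal_category C"
  shows "comodule_data C A t1 t3 e"
proof -
  interpret braided_monoidal_category C by (rule assms)
  interpret t1: counital_fusion_morphism C A t1 e
    using t1_t2_bimonoid by (simp add: multiplier_bimonoid_def)
  interpret t3: counital_fusion_morphism "bar C" A t3 e
    using t3_t4_bimonoid by (simp add: multiplier_bimonoid_def)
  show ?thesis
    using t1.A_obj t1.t_hom t1.e_hom t3.t_hom by unfold_locales (simp_all add: in_hom)
qed

theorem corollary4p8:
  fixes C :: "('o, 'a) braided_monoidal_category"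
    and A :: 'o and t1 t2 t3 t4 e :: 'a
  assumes "braided_monoidal_category C"
    and "regular_multiplier_bimonoid C A t1 t2 t3 t4 e"
  shows "\<exists>M :: ('o \<times> 'a \<times> 'a, ('o \<times> 'a \<times> 'a) \<times> 'a \<times> ('o \<times> 'a \<times> 'a)) monoidal_category.
    category.truncate M = comodule_category C A t1 t3 e \<and>
    monoidal_category M \<and>
    strict_monoidal_functor M C forget_obj forget_arr"
proof -
  interpret comodule_data C A t1 t3 e
    using assms by (rule regular_multiplier_bimonoid.comodule_dataI[rotated])
  show ?thesis
    using truncate_comodules monoidal_category_comodules strict_monoidal_functor_forget by blast
qed

end
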